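(* Let $\theta>0$ and let $\mu$ be a probability distribution on $(0,\infty)$ satisfying the extreme value assumption (EV) stated in the context. Let $(S_i(n)\colon i\ge 1)_{n\ge 0}$ be the disordered Chinese restaurant process with parameter $\theta$ and weight distribution $\mu$. Then $$\max_{i\ge 1}\frac{S_i(n)}{n}\to 1\qquad\text{in probability as } n\to\infty.$$
   Context: **Model.** Sample i.i.d. weights $(W_i)_{i\ge1}$ with distribution $\mu$. Given the weights, $(S_i(n)\colon i\ge1)_{n\ge0}$ is the Markov chain with $S_1(0)=1$ and $S_i(0)=0$ for $i\ge2$, and the following transitions. Let $K_n=\max\{i\ge1\colon S_i(n)\ne0\}$. Given the configuration at time $n$: for each $i\le K_n$, with probability proportional to $W_iS_i(n)$, one has $S_i(n+1)=S_i(n)+1$ and all other coordinates are unchanged; with probability proportional to $\theta$, one has $S_{K_n+1}(n+1)=1$ and all other coordinates are unchanged. ($S_i(n)$ is the number of customers at table $i$ at time $n$.) **Assumption (EV).** $\mu$ is absolutely continuous. If $\mu$ has bounded support, its essential supremum is normalised to be $1$ and $M:=1$; if its support is unbounded, $M:=\infty$. There are continuous functions $A,B$ on $[0,\infty)$, with $B\ge 0$ (and non-zero wherever one divides by it), such that for all $x\in\mathbb R$ $$t\,\mu\big((A(t)+xB(t),M)\big)\to\Phi(x)\quad\text{as } t\to\infty$$ (the measure being $0$ if the left endpoint is $\ge M$), where one of the following holds: - Weibull case: $M=1$, $A\equiv1$, $\Phi(x)=|x|^\alpha\mathbf 1_{x<0}$ for some $\alpha>0$; - Gumbel case: $M\in\{1,\infty\}$,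 $A$ is increasing, bounded away from zero and converges to $M$, $\Phi(x)=e^{-x}$; - Fréchet case: $M=\infty$, $A\equiv0$, $\Phi(x)=\infty$ for $x\le0$ and $\Phi(x)=x^{-\alpha}$ for $x>0$, for some $\alpha>0$. In the Weibull and Gumbel cases, moreover, $A(t)/B(t)$ is non-decreasing and tends to infinity as $t\to\infty$, and for all $x>0$ $$\int_x^\infty t\,\mu\big((A(t)+uB(t),M)\big)\,du\to\int_x^\infty\Phi(u)\,du\quad\text{as } t\to\infty.$$ *)

theory Defs
  imports "HOL-Probability.Probability"
begin

section \<open>The disordered Chinese restaurant process\<close>

text \<open>
  Tables are numbered from 1; the coordinates \<open>W 0\<close> and \<open>S 0\<close> play no role.
  \<open>S i n \<omega>\<close> is the number of customers at table \<open>i\<close> at time \<open>n\<close>.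
\<close>

definition last_table :: "(nat \<Rightarrow> nat \<Rightarrow> 'a \<Rightarrow> nat) \<Rightarrow> nat \<Rightarrow> 'a \<Rightarrow> nat" where
  "last_table S n \<omega> = Max {i. 1 \<le> i \<and> S i n \<omega> \<noteq> 0}"

text \<open>The \<open>\<sigma>\<close>-algebra generated by all the weights and by the configurations up to time \<open>n\<close>.\<close>

definition history ::
  "'a measure \<Rightarrow> (nat \<Rightarrow> 'a \<Rightarrow> real) \<Rightarrow> (nat \<Rightarrow> nat \<Rightarrow> 'a \<Rightarrow> nat) \<Rightarrow> nat \<Rightarrow> 'a measure" where
  "history P W S n = sigma (space P)
     ({W i -` B \<inter> space P | i B. 1 \<le> i \<and> B \<in> sets borel} \<union>
      {S i k -` C \<inter> space P | i k C. 1 \<le> i \<and> k \<le> n})"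

definition joins_table ::
  "'a measure \<Rightarrow> (nat \<Rightarrow> nat \<Rightarrow> 'a \<Rightarrow> nat) \<Rightarrow> nat \<Rightarrow> nat \<Rightarrow> 'a set" where
  "joins_table P S n i =
     {\<omega> \<in> space P. S i (Suc n) \<omega> = S i n \<omega> + 1 \<and>
                   (\<forall>j\<ge>1. j \<noteq> i \<longrightarrow> S j (Suc n) \<omega> = S j n \<omega>)}"

definition opens_table ::
  "'a measure \<Rightarrow> (nat \<Rightarrow> nat \<Rightarrow> 'a \<Rightarrow> nat) \<Rightarrow> nat \<Rightarrow> 'a set" where
  "opens_table P S n =
     {\<omega> \<in> space P. S (last_table S n \<omega> + 1) (Suc n) \<omega> = 1 \<and>
                   (\<forall>j\<ge>1. j \<noteq> last_table S n \<omega> + 1 \<longrightarrow> S j (Suc n) \<omega> = S j n \<omega>)}"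

definition total_rate ::
  "real \<Rightarrow> (nat \<Rightarrow> 'a \<Rightarrow> real) \<Rightarrow> (nat \<Rightarrow> nat \<Rightarrow> 'a \<Rightarrow> nat) \<Rightarrow> nat \<Rightarrow> 'a \<Rightarrow> real" where
  "total_rate \<theta> W S n \<omega> = \<theta> + (\<Sum>i = 1..last_table S n \<omega>. W i \<omega> * real (S i n \<omega>))"

text \<open>
  ``Given the weights, \<open>S\<close> is a Markov chain'' is expressed by conditioning on \<open>history\<close>,
  which contains the weights: the conditional probability of each transition depends
  on the weights and on the current configuration only.
\<close>

locale disordered_CRP = prob_space P
  for P :: "'a measure" +
  fixes \<theta> :: real and \<mu> :: "real measure"
    and W :: "nat \<Rightarrow> 'a \<Rightarrow> real" and S :: "nat \<Rightarrow> nat \<Rightarrow> 'a \<Rightarrow> nat"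
  assumes weights_indep: "indep_vars (\<lambda>_. borel) W {1..}"
    and weights_distr: "\<And>i. 1 \<le> i \<Longrightarrow> distr P borel (W i) = \<mu>"
    and S_measurable: "\<And>i n. 1 \<le> i \<Longrightarrow> S i n \<in> measurable P (count_space UNIV)"
    and S_initial: "AE \<omega> in P. S 1 0 \<omega> = 1 \<and> (\<forall>i\<ge>2. S i 0 \<omega> = 0)"
    and join_transition: "\<And>n i. AE \<omega> in P. 1 \<le> i \<and> i \<le> last_table S n \<omega> \<longrightarrow>
          real_cond_exp P (history P W S n) (indicator (joins_table P S n i)) \<omega>
            = W i \<omega> * real (S i n \<omega>) / total_rate \<theta> W S n \<omega>"
    and open_transition: "\<And>n. AE \<omega> in P.
          real_cond_exp P (history P W S n) (indicator (opens_table P S n)) \<omega>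
            = \<theta> / total_rate \<theta> W S n \<omega>"

section \<open>The extreme value assumption\<close>

definition bounded_support :: "real measure \<Rightarrow> bool" where
  "bounded_support \<mu> \<longleftrightarrow> (\<exists>C. bounded C \<and> (AE x in \<mu>. x \<in> C))"

text \<open>
  The number \<open>M\<close> of the assumption. The value 1 is correct only together with the
  normalisation of the essential supremum, which is part of \<open>extreme_value\<close> below.
\<close>

definition upper_end :: "real measure \<Rightarrow> ereal" where
  "upper_end \<mu> = (if bounded_support \<mu> then 1 else \<infinity>)"

definition tail :: "real measure \<Rightarrow> real \<Rightarrow> ennreal" where
  "tail \<mu> a = emeasure \<mu> {y. a < y \<and> ereal y < upper_end \<mu>}"

definition tail_limit ::
  "real measure \<Rightarrow> (real \<Rightarrow> real) \<Rightarrow> (real \<Rightarrow> real) \<Rightarrow> (real \<Rightarrow> ennreal) \<Rightarrow> bool" where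
  "tail_limit \<mu> A B \<Phi> \<longleftrightarrow>
     (\<forall>x. ((\<lambda>t. ennreal t * tail \<mu> (A t + x * B t)) \<longlongrightarrow> \<Phi> x) at_top)"

text \<open>
  The additional requirement of the Weibull and Gumbel cases. Here one divides by \<open>B\<close>
  at every \<open>t \<ge> 0\<close>, so \<open>B\<close> must not vanish.
\<close>

definition regular_scaling ::
  "real measure \<Rightarrow> (real \<Rightarrow> real) \<Rightarrow> (real \<Rightarrow> real) \<Rightarrow> (real \<Rightarrow> ennreal) \<Rightarrow> bool" where
  "regular_scaling \<mu> A B \<Phi> \<longleftrightarrow>
     (\<forall>t\<ge>0. B t \<noteq> 0) \<and>
     mono_on {0..} (\<lambda>t. A t / B t) \<and>
     filterlim (\<lambda>t. A t / B t) at_top at_top \<and>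
     (\<forall>x>0. ((\<lambda>t. \<integral>\<^sup>+ u \<in> {x<..}. ennreal t * tail \<mu> (A t + u * B t) \<partial>lborel)
               \<longlongrightarrow> (\<integral>\<^sup>+ u \<in> {x<..}. \<Phi> u \<partial>lborel)) at_top)"

definition Phi_Weibull :: "real \<Rightarrow> real \<Rightarrow> ennreal" where
  "Phi_Weibull \<alpha> x = (if x < 0 then ennreal (\<bar>x\<bar> powr \<alpha>) else 0)"

definition Phi_Gumbel :: "real \<Rightarrow> ennreal" where
  "Phi_Gumbel x = ennreal (exp (- x))"

definition Phi_Frechet :: "real \<Rightarrow> real \<Rightarrow> ennreal" where
  "Phi_Frechet \<alpha> x = (if x \<le> 0 then \<infinity> else ennreal (x powr (- \<alpha>)))"

definition Weibull_case :: "real measure \<Rightarrow> (real \<Rightarrow> real) \<Rightarrow> (real \<Rightarrow> real) \<Rightarrow> bool" where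
  "Weibull_case \<mu> A B \<longleftrightarrow>
     upper_end \<mu> = 1 \<and> (\<forall>t\<ge>0. A t = 1) \<and>
     (\<exists>\<alpha>>0. tail_limit \<mu> A B (Phi_Weibull \<alpha>) \<and> regular_scaling \<mu> A B (Phi_Weibull \<alpha>))"

text \<open>\<open>A\<close> is only required to be increasing in the weak sense.\<close>

definition Gumbel_case :: "real measure \<Rightarrow> (real \<Rightarrow> real) \<Rightarrow> (real \<Rightarrow> real) \<Rightarrow> bool" where
  "Gumbel_case \<mu> A B \<longleftrightarrow>
     upper_end \<mu> \<in> {1, \<infinity>} \<and> mono_on {0..} A \<and> (\<exists>c>0. \<forall>t\<ge>0. c \<le> \<bar>A t\<bar>) \<and>
     ((\<lambda>t. ereal (A t)) \<longlongrightarrow> upper_end \<mu>) at_top \<and>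
     tail_limit \<mu> A B Phi_Gumbel \<and> regular_scaling \<mu> A B Phi_Gumbel"

definition Frechet_case :: "real measure \<Rightarrow> (real \<Rightarrow> real) \<Rightarrow> (real \<Rightarrow> real) \<Rightarrow> bool" where
  "Frechet_case \<mu> A B \<longleftrightarrow>
     upper_end \<mu> = \<infinity> \<and> (\<forall>t\<ge>0. A t = 0) \<and> (\<exists>\<alpha>>0. tail_limit \<mu> A B (Phi_Frechet \<alpha>))"

definition extreme_value :: "real measure \<Rightarrow> bool" where
  "extreme_value \<mu> \<longleftrightarrow>
     absolutely_continuous lborel \<mu> \<and>
     (bounded_support \<mu> \<longrightarrow> esssup \<mu> ereal = 1) \<and>
     (\<exists>A B. continuous_on {0..} A \<and> continuous_on {0..} B \<and> (\<forall>t\<ge>0. 0 \<le> B t) \<and>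
            (Weibull_case \<mu> A B \<or> Gumbel_case \<mu> A B \<or> Frechet_case \<mu> A B))"

section \<open>Convergence in probability\<close>

definition tendsto_in_probability ::
  "'a measure \<Rightarrow> (nat \<Rightarrow> 'a \<Rightarrow> real) \<Rightarrow> real \<Rightarrow> bool" where
  "tendsto_in_probability P X c \<longleftrightarrow>
     (\<forall>\<epsilon>>0. (\<lambda>n. measure P {\<omega> \<in> space P. \<bar>X n \<omega> - c\<bar> > \<epsilon>}) \<longlonglongrightarrow> 0)"

end

theory Submission
  imports Defs "HOL-Real_Asymp.Real_Asymp"
begin

text \<open>Run time so that step \<open>k\<close> lasts \<open>1 / rate k\<close>. In this clock new tables appear at rate
  \<open>\<theta>\<close>, so table \<open>i\<close> is opened around time \<open>i / \<theta>\<close>, and its size then grows like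
  \<open>exp (W i * t)\<close>; both statements hold up to logarithmic, respectively square root, errors by
  supermartingale bounds. Table \<open>i\<close> alone would therefore fill the restaurant of size
  \<open>n + 1 = exp L\<close> at time \<open>Z i = i / \<theta> + L / W i\<close>, and the table with the smallest \<open>Z i\<close> wins if
  the runner-up is sufficiently later. Since the \<open>Z i\<close> involve independent identically distributed
  weights, a first moment computation shows that two of the relevant \<open>Z i\<close> are unlikely to be
  close. The extreme value assumption enters only through polynomial bounds on the tail of \<open>\<mu>\<close>
  at a scale \<open>t\<close> which solves \<open>\<theta> * L * d t = K * t\<close>.\<close>

section \<open>Domination by one table\<close>

text \<open>The obstacle is that (EV) controls only the mass of half-lines near the upper end of
  \<open>\<mu>\<close>, not its density, so the chance that two given finishing times come within
  \<open>g\<close> of each other cannot be bounded pair by pair. It is bounded after summing over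
  pairs: for fixed weights the opening times \<open>j / \<theta>\<close> are spaced by
  \<open>1 / \<theta>\<close>, so for each \<open>i\<close> at most
  \<open>2 * \<theta> * g + 1\<close> indices \<open>j\<close> come close, and two factors of tail
  mass remain.

  The scale equation balances two counts. A weight with \<open>1 / W i \<le> v1 t\<close> has
  probability at least of order \<open>1 / t\<close>, so for large \<open>K\<close> one is likely to
  occur among the first \<open>K * t\<close> tables. These open within time
  \<open>K * t / \<theta>\<close>, which has to fit between \<open>L * v1 t\<close> and
  \<open>L * v2 t\<close>, that is, into \<open>L * d t\<close>.

  About \<open>t powr (11/10)\<close> tables can compete. Their opening times are known up to order
  \<open>t powr (11/20) * ln t\<close>, which is below the margin \<open>g = t powr (3/5)\<close>,
  while the close pairs have total probability of order \<open>t powr (11/10 + 3/5 - 2)\<close>.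
  This leaves room: any loss exponent below 1/3 in place of the 1/10 in \<open>tail_scales\<close>
  would admit a suitable \<open>g\<close>.\<close>

text \<open>Table \<open>i\<close> waits for the time \<open>c i\<close> and then grows like \<open>exp (w i * t)\<close>, so it alone would reach
  size \<open>exp L\<close> at time \<open>c i + L / w i\<close>. If one table \<open>z\<close> reaches it earlier than all others by a
  margin \<open>g\<close>, no other table is comparable to it when the total is \<open>exp L\<close>.\<close>

lemma dominant_table:
  fixes s :: "nat \<Rightarrow> nat" and w c a :: "nat \<Rightarrow> real" and K m n r z :: nat
    and \<theta> L x \<phi> g D \<tau> v0 v2 v3 :: real
  assumes w: "\<And>i. 1 \<le> i \<Longrightarrow> 0 < w i" and \<theta>: "0 < \<theta>"
    and total: "(\<Sum>i=1..K. s i) = Suc n"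
    and L: "L = ln (real (Suc n))" "0 < L"
    and \<tau>: "\<And>i. 1 \<le> i \<Longrightarrow> c i + a i = \<tau>" and a: "\<And>i. 0 \<le> a i" and c: "\<And>i. 0 \<le> c i"
    and c_mono: "\<And>i j. 1 \<le> i \<Longrightarrow> i \<le> j \<Longrightarrow> c i \<le> c j"
    and a0: "\<And>i. K < i \<Longrightarrow> a i = 0"
    and upper: "\<And>i. i \<in> {1..m} \<Longrightarrow> i \<le> K \<Longrightarrow> real (s i) \<le> exp (x + w i * a i)"
    and lower: "\<And>i. i \<in> {1..r} \<Longrightarrow> i \<le> K \<Longrightarrow> exp (w i * a i) \<le> exp x * real (s i)"
    and c_le: "\<And>i. i \<in> {1..Suc r} \<Longrightarrow> c i \<le> real i / \<theta> + \<phi>"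
    and c_ge: "\<And>i. i \<in> {1..Suc r} \<Longrightarrow> i \<le> K \<Longrightarrow> real i / \<theta> - \<phi> \<le> c i"
    and c_m: "m \<le> K \<Longrightarrow> L * v3 < c m" and m: "1 \<le> m"
    and z: "z \<in> {1..r}" "real z / \<theta> + L / w z \<le> L * v2"
    and gap: "\<And>j. j \<in> {1..r} \<Longrightarrow> j \<noteq> z \<Longrightarrow> real z / \<theta> + L / w z + g \<le> real j / \<theta> + L / w j"
    and v0: "\<And>j. 1 \<le> j \<Longrightarrow> v0 \<le> 1 / w j"
    and r: "L * (v3 - v0) \<le> real (Suc r) / \<theta>" and g: "g \<le> L * (v3 - v2)"
    and D: "2 * \<phi> + x * v2 + 2 * v3 * D \<le> g" "D \<le> L / 2" "0 \<le> D"
    and nonneg: "0 \<le> x" "0 \<le> \<phi>" "0 < v2" "0 < v3"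
  shows "real (Suc n) * (1 - real m * exp (x - D)) \<le> real (s z)"
proof -
  have z1: "1 \<le> z" "0 < w z" using z w by auto
  have eL: "exp L = real (Suc n)" using L by simp
  have s_le: "real (s i) \<le> exp L" if "i \<in> {1..K}" for i
  proof -
    have "s i \<le> (\<Sum>i=1..K. s i)" using that by (intro member_le_sum) auto
    then show ?thesis unfolding eL total by simp
  qed
  have wz: "1 / w z \<le> v2"
  proof -
    have "L / w z \<le> L * v2" using z \<theta> z1 by (smt (verit) divide_nonneg_pos of_nat_0_le_iff)
    then show ?thesis using L(2) by (simp add: divide_inverse)
  qed
  \<comment> \<open>The total is \<open>exp L\<close>, so table \<open>z\<close> cannot have
    outgrown it, and \<open>lower\<close> then caps its age; if \<open>z\<close> is not open yet,
    its age is 0. Either way the elapsed time \<open>\<tau>\<close> exceeds the finishing time of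
    \<open>z\<close> by at most the error terms.\<close>
  have az: "a z \<le> (L + x) / w z"
  proof (cases "z \<le> K")
    case True
    have "exp (w z * a z) \<le> exp x * exp L"
      using lower[OF z(1) True] s_le[of z] True z1 by (smt (verit) atLeastAtMost_iff exp_gt_zero mult_left_mono)
    then have "w z * a z \<le> x + L" by (simp add: exp_add[symmetric])
    then show ?thesis using z1 by (simp add: field_simps)
  next
    case False
    then show ?thesis using a0[of z] L nonneg z1 by simp
  qed
  have "\<tau> \<le> real z / \<theta> + \<phi> + (L + x) / w z"
    using az c_le[of z] z \<tau>[OF z1(1)] by auto
  also have "\<dots> = real z / \<theta> + L / w z + \<phi> + x * (1 / w z)" by (simp add: add_divide_distrib)
  finally have \<tau>_le: "\<tau> \<le> real z / \<theta> + L / w z + \<phi> + x * v2"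
    using mult_left_mono[OF wz nonneg(1)] by linarith
  have v3D: "0 \<le> v3 * D" using nonneg D by simp
  have g': "\<phi> + x * v2 \<le> g" "0 \<le> g - 2 * \<phi> - x * v2" using D nonneg v3D by linarith+
  have g_le: "L * v2 + g \<le> L * v3" using g by (simp add: right_diff_distrib)
  have r_le: "L * v3 - L * v0 \<le> real (Suc r) / \<theta>" using r by (simp add: right_diff_distrib)
  have \<tau>_v3: "\<tau> \<le> L * v3" using \<tau>_le z(2) g_le g' by linarith
  have Km: "K < m"
  proof (rule ccontr)
    assume "\<not> K < m"
    then have "L * v3 < c m" using c_m by simp
    moreover have "c m \<le> \<tau>" using \<tau>[OF m] a[of m] by linarith
    ultimately show False using \<tau>_v3 by simp
  qed
  have other: "real (s j) \<le> exp (x + L - D)" if j: "j \<in> {1..K}" "j \<noteq> z" for j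
  proof -
    have wj: "0 < w j" using w j by auto
    \<comment> \<open>Tables beyond \<open>r\<close> are outside the gap hypothesis. They open no
      earlier than table \<open>r + 1\<close> and need a further \<open>L * v0\<close> at least, so
      they finish no earlier than \<open>L * v3 - \<phi>\<close>.\<close>
    have cj: "real z / \<theta> + L / w z + g - \<phi> \<le> c j + L / w j"
    proof (cases "j \<le> r")
      case True
      then show ?thesis using gap[of j] c_ge[of j] j by auto
    next
      case False
      then have "real (Suc r) / \<theta> - \<phi> \<le> c j" using c_ge[of "Suc r"] c_mono[of "Suc r" j] j by auto
      moreover have "L * v0 \<le> L / w j"
        using mult_left_mono[OF v0[of j], of L] L j by simp
      ultimately show ?thesis using r_le z(2) g_le by linarith
    qed
    have aj: "a j \<le> L / w j - 2 * v3 * D"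
      using \<tau>[of j] j cj \<tau>_le D(1) by auto
    have "w j * a j \<le> L - D"
    \<comment> \<open>A delay of \<open>2 * v3 * D\<close> costs a factor \<open>exp D\<close> only
      if \<open>w j\<close> is at least \<open>1 / (2 * v3)\<close>. A slower table has grown for at
      most \<open>L * v3\<close>, so its exponent is at most \<open>L / 2\<close>, and
      \<open>D \<le> L / 2\<close> suffices.\<close>
    proof (cases "1 / w j \<le> 2 * v3")
      case True
      then have "1 \<le> w j * (2 * v3)" using wj by (simp add: field_simps)
      then have "D \<le> w j * (2 * v3 * D)" using mult_right_mono[of 1 "w j * (2 * v3)" D] D by (simp add: mult.assoc)
      moreover have "w j * a j \<le> w j * (L / w j - 2 * v3 * D)" using aj wj by simp
      moreover have "w j * (L / w j - 2 * v3 * D) = L - w j * (2 * v3 * D)" using wj by (simp add: field_simps)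
      ultimately show ?thesis by linarith
    next
      case False
      then have "w j * v3 \<le> 1 / 2" using wj by (simp add: field_simps)
      have "a j \<le> L * v3" using \<tau>[of j] c[of j] \<tau>_v3 j by auto
      then have "w j * a j \<le> w j * (L * v3)" using wj by simp
      also have "\<dots> = L * (w j * v3)" by simp
      also have "\<dots> \<le> L * (1 / 2)" using \<open>w j * v3 \<le> 1 / 2\<close> L by (intro mult_left_mono) auto
      finally show ?thesis using D by simp
    qed
    then have "exp (x + w j * a j) \<le> exp (x + L - D)" by simp
    moreover have "real (s j) \<le> exp (x + w j * a j)" using j Km by (intro upper) auto
    ultimately show ?thesis by linarith
  qed
  have "real (Suc n) = (\<Sum>i=1..K. real (s i))" using total by (metis of_nat_sum)
  also have "\<dots> \<le> real (s z) + (\<Sum>i\<in>{1..K}-{z}. real (s i))"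
    by (cases "z \<in> {1..K}") (auto simp: sum.remove)
  also have "(\<Sum>i\<in>{1..K}-{z}. real (s i)) \<le> (\<Sum>i\<in>{1..K}-{z}. exp (x + L - D))"
    using other by (intro sum_mono) auto
  also have "\<dots> \<le> real m * exp (x + L - D)"
  proof -
    have "card ({1..K} - {z}) \<le> card {1..K}" by (intro card_mono) auto
    then show ?thesis using Km by simp
  qed
  also have "exp (x + L - D) = real (Suc n) * exp (x - D)"
  proof -
    have "x + L - D = L + (x - D)" by simp
    then show ?thesis by (simp only: exp_add eL)
  qed
  finally show ?thesis by (simp add: algebra_simps)
qed

section \<open>Scales of the weight distribution\<close>

text \<open>Iterating \<open>step\<close> pulls every \<open>t\<close> back to the compact interval
  from \<open>t0\<close> to \<open>\<beta> * t0\<close>, where continuity bounds \<open>q\<close>.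
  Comparisons of the scaling functions at \<open>t\<close> and \<open>\<beta> * t\<close> thereby
  become power bounds.\<close>

lemma polynomial_growth:
  fixes q :: "real \<Rightarrow> real"
  assumes \<beta>: "1 < \<beta>" and t0: "1 \<le> t0" and p: "0 \<le> p" and cont: "continuous_on {t0..} q"
    and step: "\<And>t. t0 \<le> t \<Longrightarrow> q (\<beta> * t) \<le> \<beta> powr p * q t"
  obtains Q where "0 < Q" "\<And>t. t0 \<le> t \<Longrightarrow> q t \<le> Q * t powr p"
proof -
  have "compact (q ` {t0..\<beta> * t0})"
    by (intro compact_continuous_image continuous_on_subset[OF cont]) auto
  then have "bounded (q ` {t0..\<beta> * t0})" by (rule compact_imp_bounded)
  then obtain Q0 where Q0: "\<And>t. t \<in> {t0..\<beta> * t0} \<Longrightarrow> \<bar>q t\<bar> \<le> Q0"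
    unfolding bounded_iff by (metis image_eqI real_norm_def)
  define Q where "Q = \<bar>Q0\<bar> + 1"
  have base: "q t \<le> Q * t powr p" if "t0 \<le> t" "t \<le> \<beta> * t0" for t
  proof -
    have "q t \<le> Q * 1" using Q0[of t] that by (simp add: Q_def)
    also have "\<dots> \<le> Q * t powr p" using that t0 p by (intro mult_left_mono ge_one_powr_ge_zero) (auto simp: Q_def)
    finally show ?thesis .
  qed
  have main: "\<forall>t. t0 \<le> t \<and> t \<le> \<beta> ^ Suc k * t0 \<longrightarrow> q t \<le> Q * t powr p" for k
  proof (induction k)
    case 0
    then show ?case using base by auto
  next
    case (Suc k)
    show ?case
    proof (intro allI impI)
      fix t assume t: "t0 \<le> t \<and> t \<le> \<beta> ^ Suc (Suc k) * t0"
      show "q t \<le> Q * t powr p"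
      proof (cases "t \<le> \<beta> * t0")
        case True
        then show ?thesis using base t by blast
      next
        case False
        then have s: "t0 \<le> t / \<beta>" "t / \<beta> \<le> \<beta> ^ Suc k * t0" using t \<beta> by (auto simp: field_simps)
        have "q t = q (\<beta> * (t / \<beta>))" using \<beta> by simp
        also have "\<dots> \<le> \<beta> powr p * q (t / \<beta>)" by (rule step[OF s(1)])
        also have "\<dots> \<le> \<beta> powr p * (Q * (t / \<beta>) powr p)"
          using Suc s by (intro mult_left_mono) auto
        also have "\<dots> = Q * t powr p" using \<beta> t t0 by (simp add: powr_divide)
        finally show ?thesis .
      qed
    qed
  qed
  show thesis
  proof
    show "0 < Q" by (simp add: Q_def)
    fix t assume t: "t0 \<le> t"
    obtain k where "t / t0 < \<beta> ^ k" using real_arch_pow[OF \<beta>] by blast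
    then have "t \<le> \<beta> ^ k * t0" using t0 by (simp add: field_simps)
    also have "\<dots> \<le> \<beta> ^ Suc k * t0" using \<beta> t0 by simp
    finally show "q t \<le> Q * t powr p" using main[of k] t by blast
  qed
qed

text \<open>Absolute continuity excludes atoms, so neither the closed end nor the cut at
  \<open>upper_end\<close> changes the mass.\<close>

lemma tail_eq_measure:
  assumes "prob_space \<mu>" and sets: "sets \<mu> = sets borel" and ev: "extreme_value \<mu>"
  shows "tail \<mu> a = ennreal (measure \<mu> {a..})"
proof -
  interpret prob_space \<mu> by fact
  have no_atom: "AE y in \<mu>. y \<noteq> b" for b
  proof -
    have "{b} \<in> null_sets lborel" by (rule finite_imp_null_set_lborel) simp
    then have "{b} \<in> null_sets \<mu>" using ev unfolding extreme_value_def absolutely_continuous_def by blast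
    then show ?thesis using AE_not_in by fastforce
  qed
  have upper: "AE y in \<mu>. ereal y < upper_end \<mu>"
  proof (cases "bounded_support \<mu>")
    case True
    then have "esssup \<mu> ereal = 1" using ev by (simp add: extreme_value_def)
    moreover have "AE y in \<mu>. ereal y \<le> esssup \<mu> ereal" by (rule esssup_AE)
    ultimately have "AE y in \<mu>. ereal y \<le> 1" by simp
    with no_atom[of 1] show ?thesis
    proof eventually_elim
      case (elim y)
      then show ?case using True by (auto simp: upper_end_def one_ereal_def)
    qed
  qed (simp add: upper_end_def)
  have "emeasure \<mu> {y. a < y \<and> ereal y < upper_end \<mu>} = emeasure \<mu> {a..}"
  proof (rule emeasure_eq_AE)
    show "AE y in \<mu>. y \<in> {y. a < y \<and> ereal y < upper_end \<mu>} \<longleftrightarrow> y \<in> {a..}"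
      using upper no_atom[of a] by eventually_elim auto
    have "{y. a < y \<and> ereal y < upper_end \<mu>} \<in> sets borel" by measurable
    then show "{y. a < y \<and> ereal y < upper_end \<mu>} \<in> sets \<mu>" by (simp add: sets)
  qed (simp add: sets)
  then show ?thesis by (simp add: tail_def emeasure_eq_measure)
qed

lemma AE_le_one_if_upper_end:
  assumes "prob_space \<mu>" "sets \<mu> = sets borel" "extreme_value \<mu>" "upper_end \<mu> = 1"
  shows "AE y in \<mu>. y \<le> 1"
proof -
  have "bounded_support \<mu>" using assms(4) by (auto simp: upper_end_def split: if_splits)
  then have "esssup \<mu> ereal = 1" using assms(3) by (simp add: extreme_value_def)
  moreover have "AE y in \<mu>. ereal y \<le> esssup \<mu> ereal" by (rule esssup_AE)
  ultimately show ?thesis by (simp add: one_ereal_def)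
qed

text \<open>All that is needed of the tail of \<open>\<mu>\<close> near its upper end, in terms of the reciprocals
  \<open>v = 1 / y\<close> of the weights. At time scale \<open>t\<close> about \<open>1 / t\<close> of the mass lies in \<open>v \<le> v1 t\<close>,
  and the window \<open>[v0, v3 t]\<close> is not much wider than the spacings of \<open>v1 t\<close>, \<open>v2 t\<close>, \<open>v3 t\<close>.\<close>

definition tail_scales ::
  "real measure \<Rightarrow> real \<Rightarrow> (real \<Rightarrow> real) \<Rightarrow> (real \<Rightarrow> real) \<Rightarrow> (real \<Rightarrow> real) \<Rightarrow> (real \<Rightarrow> real) \<Rightarrow> real \<Rightarrow> real \<Rightarrow> real \<Rightarrow> bool" where
  "tail_scales \<mu> v0 d v1 v2 v3 p C t0 \<longleftrightarrow>
     0 \<le> v0 \<and> 0 \<le> p \<and> 1 \<le> C \<and> 1 \<le> t0 \<and> (AE y in \<mu>. v0 \<le> 1 / y) \<and> continuous_on {t0..} d \<and>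
     (\<forall>t\<ge>t0. 0 < v1 t \<and> 0 < d t \<and> d t \<le> v2 t - v1 t \<and> d t \<le> v3 t - v2 t \<and>
        v3 t - v0 \<le> C * t powr (1/10) * d t \<and> v3 t \<le> C \<and> 1 \<le> C * t powr p * d t \<and>
        t * measure \<mu> {1 / v3 t..} \<le> C \<and> 1 \<le> C * (t * measure \<mu> {1 / v1 t..}))"

lemma tail_scalesI:
  assumes "0 \<le> v0" "0 \<le> p" "AE y in \<mu>. v0 \<le> 1 / y" "continuous_on {t1..} d" "0 < c"
    and ev: "\<forall>\<^sub>F t in at_top. 0 < v1 t \<and> 0 < d t \<and> d t \<le> v2 t - v1 t \<and> d t \<le> v3 t - v2 t"
      "\<forall>\<^sub>F t in at_top. v3 t - v0 \<le> C1 * t powr (1/10) * d t"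
      "\<forall>\<^sub>F t in at_top. v3 t \<le> C2" "\<forall>\<^sub>F t in at_top. 1 \<le> C3 * t powr p * d t"
      "\<forall>\<^sub>F t in at_top. t * measure \<mu> {1 / v3 t..} \<le> C4"
      "\<forall>\<^sub>F t in at_top. c \<le> t * measure \<mu> {1 / v1 t..}"
  shows "\<exists>C t0. tail_scales \<mu> v0 d v1 v2 v3 p C t0"
proof -
  define C where "C = Max {1, C1, C2, C3, C4, 1 / c}"
  have C: "1 \<le> C" "C1 \<le> C" "C2 \<le> C" "C3 \<le> C" "C4 \<le> C" "1 / c \<le> C" by (auto simp: C_def)
  have "\<forall>\<^sub>F t in at_top. 0 < v1 t \<and> 0 < d t \<and> d t \<le> v2 t - v1 t \<and> d t \<le> v3 t - v2 t \<and>
        v3 t - v0 \<le> C * t powr (1/10) * d t \<and> v3 t \<le> C \<and> 1 \<le> C * t powr p * d t \<and>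
        t * measure \<mu> {1 / v3 t..} \<le> C \<and> 1 \<le> C * (t * measure \<mu> {1 / v1 t..})"
    using ev
  proof eventually_elim
    case (elim t)
    have 1: "C1 * (t powr (1/10) * d t) \<le> C * (t powr (1/10) * d t)"
      "C3 * (t powr p * d t) \<le> C * (t powr p * d t)"
      using elim(1) C by (intro mult_right_mono; simp)+
    have "1 / c * c \<le> C * (t * measure \<mu> {1 / v1 t..})"
      using C elim(6) assms(5) by (intro mult_mono) auto
    then have "1 \<le> C * (t * measure \<mu> {1 / v1 t..})" using assms(5) by simp
    with 1 elim C show ?case by (auto simp: mult.assoc)
  qed
  then obtain t2 where t2: "\<And>t. t2 \<le> t \<Longrightarrow> 0 < v1 t \<and> 0 < d t \<and> d t \<le> v2 t - v1 t \<and> d t \<le> v3 t - v2 t \<and>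
        v3 t - v0 \<le> C * t powr (1/10) * d t \<and> v3 t \<le> C \<and> 1 \<le> C * t powr p * d t \<and>
        t * measure \<mu> {1 / v3 t..} \<le> C \<and> 1 \<le> C * (t * measure \<mu> {1 / v1 t..})"
    unfolding eventually_at_top_linorder by blast
  define t0 where "t0 = max 1 (max t1 t2)"
  have "continuous_on {t0..} d" by (rule continuous_on_subset[OF assms(4)]) (auto simp: t0_def)
  then have "tail_scales \<mu> v0 d v1 v2 v3 p C t0"
    unfolding tail_scales_def using assms(1-3) C(1) t2 by (auto simp: t0_def)
  then show ?thesis by blast
qed

lemma tail_limit_real:
  assumes "prob_space \<mu>" "sets \<mu> = sets borel" "extreme_value \<mu>"
    and "tail_limit \<mu> A B \<Phi>" "\<Phi> x = ennreal l" "0 \<le> l"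
  shows "((\<lambda>t. t * measure \<mu> {A t + x * B t..}) \<longlongrightarrow> l) at_top"
proof (rule tendsto_ennrealD)
  have "((\<lambda>t. ennreal t * tail \<mu> (A t + x * B t)) \<longlongrightarrow> ennreal l) at_top"
    using assms(4,5) unfolding tail_limit_def by metis
  moreover have "\<forall>\<^sub>F t in at_top. ennreal t * tail \<mu> (A t + x * B t) = ennreal (t * measure \<mu> {A t + x * B t..})"
    using eventually_ge_at_top[of 0]
    by eventually_elim (simp add: tail_eq_measure[OF assms(1-3)] ennreal_mult)
  ultimately show "((\<lambda>t. ennreal (t * measure \<mu> {A t + x * B t..})) \<longlongrightarrow> ennreal l) at_top"
    by (rule Lim_transform_eventually)
  show "\<forall>\<^sub>F t in at_top. 0 \<le> t * measure \<mu> {A t + x * B t..}"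
    using eventually_ge_at_top[of 0] by eventually_elim simp
qed fact

text \<open>The mass of a half-line decreases in its end point, so an order of limiting masses
  forces the opposite order of the thresholds. Applied to a tail limit at \<open>t\<close> and a
  rescaled one at \<open>\<beta> * t\<close>, it yields the growth inequalities for \<open>A\<close>
  and \<open>B\<close>.\<close>

lemma eventually_threshold_less:
  fixes \<mu> :: "real measure" and f g :: "real \<Rightarrow> real"
  assumes "prob_space \<mu>" "sets \<mu> = sets borel"
    and "((\<lambda>t. t * measure \<mu> {f t..}) \<longlongrightarrow> a) at_top" "((\<lambda>t. t * measure \<mu> {g t..}) \<longlongrightarrow> b) at_top" "a < b"
  shows "\<forall>\<^sub>F t in at_top. g t < f t"
proof -
  interpret prob_space \<mu> by fact
  obtain c where c: "a < c" "c < b" using assms(5) dense by blast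
  show ?thesis
    using order_tendstoD(2)[OF assms(3) c(1)] order_tendstoD(1)[OF assms(4) c(2)] eventually_gt_at_top[of 0]
  proof eventually_elim
    case (elim t)
    then have "t * measure \<mu> {f t..} < t * measure \<mu> {g t..}" by linarith
    then have lt: "measure \<mu> {f t..} < measure \<mu> {g t..}" using elim by simp
    show ?case
    proof (rule ccontr)
      assume "\<not> g t < f t"
      then have "measure \<mu> {g t..} \<le> measure \<mu> {f t..}"
        by (intro finite_measure_mono) (simp_all add: assms(2))
      with lt show False by simp
    qed
  qed
qed

lemma tendsto_rescale:
  fixes f :: "real \<Rightarrow> real"
  assumes "((\<lambda>t. t * f t) \<longlongrightarrow> l) at_top" "0 < \<beta>"
  shows "((\<lambda>t. t * f (\<beta> * t)) \<longlongrightarrow> l / \<beta>) at_top"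
proof -
  have "filterlim (\<lambda>t. \<beta> * t) at_top at_top"
    using assms(2) by (intro filterlim_tendsto_pos_mult_at_top[OF tendsto_const] filterlim_ident)
  from filterlim_compose[OF assms(1) this]
  have "((\<lambda>t. (\<beta> * t) * f (\<beta> * t) / \<beta>) \<longlongrightarrow> l / \<beta>) at_top"
    using assms(2) by (intro tendsto_divide) auto
  then show ?thesis using assms(2) by simp
qed

section \<open>Scales in the three extreme value classes\<close>

lemma Weibull_tail_scales:
  assumes P: "prob_space \<mu>" and S: "sets \<mu> = sets borel" and ev: "extreme_value \<mu>" and pos: "AE y in \<mu>. 0 < y"
    and contB: "continuous_on {0..} B" and B0: "\<forall>t\<ge>0. 0 \<le> B t" and W: "Weibull_case \<mu> A B"
  shows "\<exists>v0 d v1 v2 v3 p C t0. tail_scales \<mu> v0 d v1 v2 v3 p C t0"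
proof -
  obtain \<alpha> where \<alpha>: "0 < \<alpha>" "tail_limit \<mu> A B (Phi_Weibull \<alpha>)" "regular_scaling \<mu> A B (Phi_Weibull \<alpha>)"
    and A: "\<forall>t\<ge>0. A t = 1" and ue: "upper_end \<mu> = 1"
    using W unfolding Weibull_case_def by blast
  have Bpos: "0 < B t" if "0 \<le> t" for t
    using B0 \<alpha>(3) that unfolding regular_scaling_def by (metis order_le_less)
  have Blim: "filterlim (\<lambda>t. 1 / B t) at_top at_top"
  proof (rule filterlim_mono_eventually)
    show "filterlim (\<lambda>t. A t / B t) at_top at_top" using \<alpha>(3) by (simp add: regular_scaling_def)
    show "\<forall>\<^sub>F t in at_top. A t / B t = 1 / B t" using eventually_ge_at_top[of 0] by eventually_elim (simp add: A)
  qed auto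
  have lim: "((\<lambda>t. t * measure \<mu> {1 - x * B t..}) \<longlongrightarrow> x powr \<alpha>) at_top" if "0 < x" for x
  proof (rule Lim_transform_eventually)
    show "((\<lambda>t. t * measure \<mu> {A t + (- x) * B t..}) \<longlongrightarrow> x powr \<alpha>) at_top"
      by (rule tail_limit_real[OF P S ev \<alpha>(2)]) (use that in \<open>auto simp: Phi_Weibull_def\<close>)
    show "\<forall>\<^sub>F t in at_top. t * measure \<mu> {A t + (- x) * B t..} = t * measure \<mu> {1 - x * B t..}"
      using eventually_ge_at_top[of 0] by eventually_elim (simp add: A)
  qed
  \<comment> \<open>In units of \<open>1 / t\<close>, the half-line from
    \<open>1 - B (\<beta> * t)\<close> has limiting mass \<open>2 powr (- \<alpha>)\<close>, more
    than the \<open>4 powr (- \<alpha>)\<close> of the one from \<open>1 - B t / 4\<close>. So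
    \<open>B\<close> loses at most a factor 4 from \<open>t\<close> to \<open>\<beta> * t\<close>,
    and \<open>\<beta> powr (2 / \<alpha>) = 4\<close> gives the exponent.\<close>
  define \<beta> :: real where "\<beta> = 2 powr \<alpha>"
  have \<beta>: "1 < \<beta>" using \<alpha> by (simp add: \<beta>_def)
  have "((\<lambda>t. t * measure \<mu> {1 - 1 * B (\<beta> * t)..}) \<longlongrightarrow> (1 powr \<alpha>) / \<beta>) at_top"
    by (rule tendsto_rescale[OF lim]) (use \<beta> in auto)
  then have "\<forall>\<^sub>F t in at_top. 1 - 1 * B (\<beta> * t) < 1 - 1/4 * B t"
  proof (rule eventually_threshold_less[OF P S lim[of "1/4"], rotated])
    have "(1/4::real) powr \<alpha> < (1/2) powr \<alpha>" using \<alpha> by (intro powr_less_mono2) auto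
    then show "(1/4::real) powr \<alpha> < 1 powr \<alpha> / \<beta>" by (simp add: \<beta>_def powr_divide)
  qed simp
  then obtain t1 where t1: "\<And>t. t1 \<le> t \<Longrightarrow> B t < 4 * B (\<beta> * t)"
    unfolding eventually_at_top_linorder by force
  define t2 where "t2 = max 1 t1"
  obtain Q where Q: "0 < Q" "\<And>t. t2 \<le> t \<Longrightarrow> 1 / B t \<le> Q * t powr (2 / \<alpha>)"
  proof (rule polynomial_growth[of \<beta> t2 "2 / \<alpha>" "\<lambda>t. 1 / B t"])
    show "continuous_on {t2..} (\<lambda>t. 1 / B t)"
    proof (intro continuous_on_divide continuous_on_const continuous_on_subset[OF contB] ballI)
      fix t assume "t \<in> {t2..}"
      then show "B t \<noteq> 0" using Bpos[of t] by (auto simp: t2_def)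
    qed (auto simp: t2_def)
    fix t assume t: "t2 \<le> t"
    have "B t < 4 * B (\<beta> * t)" "0 < B t" "0 < B (\<beta> * t)" using t1[of t] t Bpos[of t] Bpos[of "\<beta> * t"] \<beta> by (auto simp: t2_def)
    then have "1 / B (\<beta> * t) \<le> 4 * (1 / B t)" by (simp add: field_simps)
    moreover have "\<beta> powr (2 / \<alpha>) = 4" using \<alpha> by (simp add: \<beta>_def powr_powr)
    ultimately show "1 / B (\<beta> * t) \<le> \<beta> powr (2 / \<alpha>) * (1 / B t)" by simp
  qed (use \<beta> \<alpha> in \<open>auto simp: t2_def\<close>)
  have small: "\<forall>\<^sub>F t in at_top. 0 < B t \<and> B t \<le> 1/6"
    using filterlim_at_top[THEN iffD1, OF Blim, rule_format, of 6] eventually_ge_at_top[of 0]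
  proof eventually_elim
    case (elim t)
    then show ?case using Bpos[of t] by (simp add: field_simps)
  qed
  \<comment> \<open>The thresholds are \<open>1 - k * B t\<close> for \<open>k = 1, 2, 3\<close>.
    Weights are at most 1, so \<open>v0 = 1\<close> is admissible, and this choice makes the window
    \<open>v3 t - v0\<close> of the order of \<open>B t\<close>.\<close>
  have "\<exists>C t0. tail_scales \<mu> 1 B (\<lambda>t. 1 / (1 - B t)) (\<lambda>t. 1 / (1 - 2 * B t)) (\<lambda>t. 1 / (1 - 3 * B t)) (2 / \<alpha>) C t0"
  proof (rule tail_scalesI)
    show "AE y in \<mu>. 1 \<le> 1 / y"
      using pos AE_le_one_if_upper_end[OF P S ev ue] by eventually_elim simp
    show "\<forall>\<^sub>F t in at_top. 0 < 1 / (1 - B t) \<and> 0 < B t \<and> B t \<le> 1 / (1 - 2 * B t) - 1 / (1 - B t) \<and>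
        B t \<le> 1 / (1 - 3 * B t) - 1 / (1 - 2 * B t)"
      using small
    proof eventually_elim
      case (elim t)
      have "B t * ((1 - 2 * B t) * (1 - B t)) \<le> B t * 1" "B t * ((1 - 3 * B t) * (1 - 2 * B t)) \<le> B t * 1"
        using elim by (intro mult_left_mono mult_le_one; simp)+
      then have "B t \<le> B t / ((1 - 2 * B t) * (1 - B t))" "B t \<le> B t / ((1 - 3 * B t) * (1 - 2 * B t))"
        using elim by (simp_all add: pos_le_divide_eq)
      moreover have "1 / (1 - 2 * B t) - 1 / (1 - B t) = B t / ((1 - 2 * B t) * (1 - B t))"
        "1 / (1 - 3 * B t) - 1 / (1 - 2 * B t) = B t / ((1 - 3 * B t) * (1 - 2 * B t))"
        using elim by (simp_all add: field_simps)
      ultimately show ?case using elim by simp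
    qed
    show "\<forall>\<^sub>F t in at_top. 1 / (1 - 3 * B t) - 1 \<le> 6 * t powr (1/10) * B t"
      using small eventually_ge_at_top[of 1]
    proof eventually_elim
      case (elim t)
      have "1 / (1 - 3 * B t) - 1 = 3 * B t / (1 - 3 * B t)" using elim by (simp add: field_simps)
      also have "\<dots> \<le> 3 * B t / (1 / 2)" using elim by (intro divide_left_mono) auto
      also have "\<dots> = 6 * 1 * B t" by simp
      also have "\<dots> \<le> 6 * t powr (1/10) * B t" using elim by (intro mult_right_mono mult_left_mono ge_one_powr_ge_zero) auto
      finally show ?case .
    qed
    show "\<forall>\<^sub>F t in at_top. 1 / (1 - 3 * B t) \<le> 2"
      using small by eventually_elim (simp add: field_simps)
    show "\<forall>\<^sub>F t in at_top. 1 \<le> Q * t powr (2 / \<alpha>) * B t"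
      using eventually_ge_at_top[of t2] eventually_ge_at_top[of 0]
    proof eventually_elim
      case (elim t)
      then show ?case using Q(2)[of t] Bpos[of t] by (simp add: field_simps)
    qed
    show "\<forall>\<^sub>F t in at_top. t * measure \<mu> {1 / (1 / (1 - 3 * B t))..} \<le> 3 powr \<alpha> + 1"
      using order_tendstoD(2)[OF lim[of 3], of "3 powr \<alpha> + 1"] by (auto elim: eventually_mono)
    show "\<forall>\<^sub>F t in at_top. 1/2 \<le> t * measure \<mu> {1 / (1 / (1 - B t))..}"
      using order_tendstoD(1)[OF lim[of 1], of "1/2"] by (auto elim: eventually_mono)
  qed (use \<alpha> contB in auto)
  then show ?thesis by blast
qed

lemma Frechet_tail_scales:
  assumes P: "prob_space \<mu>" and S: "sets \<mu> = sets borel" and ev: "extreme_value \<mu>" and pos: "AE y in \<mu>. 0 < y"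
    and contB: "continuous_on {0..} B" and W: "Frechet_case \<mu> A B"
  shows "\<exists>v0 d v1 v2 v3 p C t0. tail_scales \<mu> v0 d v1 v2 v3 p C t0"
proof -
  interpret prob_space \<mu> by fact
  obtain \<alpha> where \<alpha>: "0 < \<alpha>" "tail_limit \<mu> A B (Phi_Frechet \<alpha>)" and A: "\<forall>t\<ge>0. A t = 0"
    using W unfolding Frechet_case_def by blast
  have lim: "((\<lambda>t. t * measure \<mu> {x * B t..}) \<longlongrightarrow> x powr (- \<alpha>)) at_top" if "0 < x" for x
  proof (rule Lim_transform_eventually)
    show "((\<lambda>t. t * measure \<mu> {A t + x * B t..}) \<longlongrightarrow> x powr (- \<alpha>)) at_top"
      by (rule tail_limit_real[OF P S ev \<alpha>(2)]) (use that in \<open>auto simp: Phi_Frechet_def\<close>)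
    show "\<forall>\<^sub>F t in at_top. t * measure \<mu> {A t + x * B t..} = t * measure \<mu> {x * B t..}"
      using eventually_ge_at_top[of 0] by eventually_elim (simp add: A)
  qed
  have "\<forall>\<^sub>F t in at_top. 1 * B t < 2 * B t"
    by (rule eventually_threshold_less[OF P S lim lim]) (use \<alpha> powr_less_mono2_neg[of "- \<alpha>" 1 2] in auto)
  then have Bpos: "\<forall>\<^sub>F t in at_top. 0 < B t" by eventually_elim simp
  \<comment> \<open>This bounds \<open>v3\<close>. Fix \<open>s\<close> such that the half-line from
    \<open>B s > 0\<close> has mass \<open>m > 0\<close>. The mass above \<open>B t\<close> is
    eventually below \<open>2 / t\<close>, hence below \<open>m\<close>, so \<open>B t\<close> must
    have passed \<open>B s\<close>.\<close>
  have "\<exists>b>0. \<forall>\<^sub>F t in at_top. b < B t"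
  proof -
    have l1: "((\<lambda>t. t * measure \<mu> {B t..}) \<longlongrightarrow> 1) at_top" using lim[of 1] by simp
    have e1: "\<forall>\<^sub>F t in at_top. 1/2 < t * measure \<mu> {B t..}" "\<forall>\<^sub>F t in at_top. t * measure \<mu> {B t..} < 2"
      using order_tendstoD(1)[OF l1, of "1/2"] order_tendstoD(2)[OF l1, of 2] by simp_all
    have "\<forall>\<^sub>F t in at_top. 0 < B t \<and> 1/2 < t * measure \<mu> {B t..}"
      using Bpos e1(1) by eventually_elim auto
    then obtain s where s: "0 < B s" "1/2 < s * measure \<mu> {B s..}"
      unfolding eventually_at_top_linorder by blast
    define m where "m = measure \<mu> {B s..}"
    have m: "0 < m"
    proof (rule ccontr)
      assume "\<not> 0 < m"
      then have "m = 0" using measure_nonneg[of \<mu> "{B s..}"] by (simp add: m_def)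
      then show False using s(2) by (simp add: m_def)
    qed
    have "\<forall>\<^sub>F t in at_top. B s < B t"
      using e1(2) eventually_gt_at_top[of "2 / m"] eventually_gt_at_top[of 0]
    proof eventually_elim
      case (elim t)
      show ?case
      proof (rule ccontr)
        assume "\<not> B s < B t"
        then have "m \<le> measure \<mu> {B t..}" unfolding m_def by (intro finite_measure_mono) (simp_all add: S)
        then have "t * m \<le> t * measure \<mu> {B t..}" using elim by simp
        moreover have "2 < t * m" using elim m by (simp add: field_simps)
        ultimately show False using elim by linarith
      qed
    qed
    then show ?thesis using s(1) by blast
  qed
  then obtain b where b: "0 < b" "\<forall>\<^sub>F t in at_top. b < B t" by blast
  define \<beta> :: real where "\<beta> = 2 powr \<alpha>"
  have \<beta>: "1 < \<beta>" using \<alpha> by (simp add: \<beta>_def)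
  have "((\<lambda>t. t * measure \<mu> {1 * B (\<beta> * t)..}) \<longlongrightarrow> (1 powr (- \<alpha>)) / \<beta>) at_top"
    by (rule tendsto_rescale[OF lim]) (use \<beta> in auto)
  then have "\<forall>\<^sub>F t in at_top. 1 * B (\<beta> * t) < 4 * B t"
  proof (rule eventually_threshold_less[OF P S lim[of 4], rotated])
    have "(4::real) powr (- \<alpha>) < 2 powr (- \<alpha>)" using \<alpha> by (intro powr_less_mono2_neg) auto
    then show "(4::real) powr (- \<alpha>) < 1 powr (- \<alpha>) / \<beta>" by (simp add: \<beta>_def powr_minus_divide)
  qed simp
  with b(2) have "\<forall>\<^sub>F t in at_top. B (\<beta> * t) < 4 * B t \<and> b < B t" by eventually_elim simp
  then obtain t1 where t1: "\<And>t. t1 \<le> t \<Longrightarrow> B (\<beta> * t) < 4 * B t \<and> b < B t"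
    unfolding eventually_at_top_linorder by blast
  define t2 where "t2 = max 1 t1"
  obtain Q where Q: "0 < Q" "\<And>t. t2 \<le> t \<Longrightarrow> B t \<le> Q * t powr (2 / \<alpha>)"
  proof (rule polynomial_growth[of \<beta> t2 "2 / \<alpha>" B])
    show "continuous_on {t2..} B" by (rule continuous_on_subset[OF contB]) (auto simp: t2_def)
    fix t assume t: "t2 \<le> t"
    have "\<beta> powr (2 / \<alpha>) = 4" using \<alpha> by (simp add: \<beta>_def powr_powr)
    then show "B (\<beta> * t) \<le> \<beta> powr (2 / \<alpha>) * B t" using t1[of t] t by (simp add: t2_def)
  qed (use \<beta> \<alpha> in \<open>auto simp: t2_def\<close>)
  \<comment> \<open>Here \<open>1 / B t\<close> is the only scale: even the window starting at 0 has
    width \<open>3 / B t\<close>, a multiple of the spacing.\<close>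
  have "\<exists>C t0. tail_scales \<mu> 0 (\<lambda>t. 1 / B t) (\<lambda>t. 1 / B t) (\<lambda>t. 2 / B t) (\<lambda>t. 3 / B t) (2 / \<alpha>) C t0"
  proof (rule tail_scalesI)
    show "AE y in \<mu>. 0 \<le> 1 / y" using pos by eventually_elim simp
    show "continuous_on {t2..} (\<lambda>t. 1 / B t)"
      by (intro continuous_on_divide continuous_on_const continuous_on_subset[OF contB])
         (use t1 b in \<open>force simp: t2_def\<close>)+
    show "\<forall>\<^sub>F t in at_top. 0 < 1 / B t \<and> 0 < 1 / B t \<and> 1 / B t \<le> 2 / B t - 1 / B t \<and> 1 / B t \<le> 3 / B t - 2 / B t"
      using Bpos by eventually_elim (simp add: field_simps)
    show "\<forall>\<^sub>F t in at_top. 3 / B t - 0 \<le> 3 * t powr (1/10) * (1 / B t)"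
      using Bpos eventually_ge_at_top[of 1]
    proof eventually_elim
      case (elim t)
      have "3 * 1 * (1 / B t) \<le> 3 * t powr (1/10) * (1 / B t)"
        using elim by (intro mult_right_mono mult_left_mono ge_one_powr_ge_zero) auto
      then show ?case by simp
    qed
    show "\<forall>\<^sub>F t in at_top. 3 / B t \<le> 3 / b"
      using b(2) by eventually_elim (use b(1) in \<open>simp add: frac_le\<close>)
    show "\<forall>\<^sub>F t in at_top. 1 \<le> Q * t powr (2 / \<alpha>) * (1 / B t)"
      using eventually_ge_at_top[of t2] Bpos
    proof eventually_elim
      case (elim t)
      then show ?case using Q(2)[of t] by (simp add: field_simps)
    qed
    show "\<forall>\<^sub>F t in at_top. t * measure \<mu> {1 / (3 / B t)..} \<le> (1/3) powr (- \<alpha>) + 1"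
      using order_tendstoD(2)[OF lim[of "1/3"], of "(1/3) powr (- \<alpha>) + 1"] by (auto elim: eventually_mono)
    show "\<forall>\<^sub>F t in at_top. 1/2 \<le> t * measure \<mu> {1 / (1 / B t)..}"
      using order_tendstoD(1)[OF lim[of 1], of "1/2"] by (auto elim: eventually_mono)
  qed (use \<alpha> in auto)
  then show ?thesis by blast
qed

lemma Gumbel_tail_scales:
  assumes P: "prob_space \<mu>" and S: "sets \<mu> = sets borel" and ev: "extreme_value \<mu>" and pos: "AE y in \<mu>. 0 < y"
    and contA: "continuous_on {0..} A" and contB: "continuous_on {0..} B" and B0: "\<forall>t\<ge>0. 0 \<le> B t"
    and W: "Gumbel_case \<mu> A B"
  shows "\<exists>v0 d v1 v2 v3 p C t0. tail_scales \<mu> v0 d v1 v2 v3 p C t0"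
proof -
  have TL: "tail_limit \<mu> A B Phi_Gumbel" and RS: "regular_scaling \<mu> A B Phi_Gumbel"
    and Alim: "((\<lambda>t. ereal (A t)) \<longlongrightarrow> upper_end \<mu>) at_top"
    using W unfolding Gumbel_case_def by blast+
  obtain c where c: "0 < c" "\<And>t. 0 \<le> t \<Longrightarrow> c \<le> \<bar>A t\<bar>" using W unfolding Gumbel_case_def by blast
  have Bpos: "0 < B t" if "0 \<le> t" for t
    using B0 RS that unfolding regular_scaling_def by (metis order_le_less)
  have qlim: "filterlim (\<lambda>t. A t / B t) at_top at_top" using RS by (simp add: regular_scaling_def)
  have "0 < upper_end \<mu>" by (simp add: upper_end_def)
  then have "\<forall>\<^sub>F t in at_top. 0 < ereal (A t)" by (rule order_tendstoD(1)[OF Alim])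
  then have Age: "\<forall>\<^sub>F t in at_top. c \<le> A t"
    using eventually_ge_at_top[of 0]
  proof eventually_elim
    case (elim t)
    then show ?case using c(2)[of t] by simp
  qed
  have lim: "((\<lambda>t. t * measure \<mu> {A t + x * B t..}) \<longlongrightarrow> exp (- x)) at_top" for x
    by (rule tail_limit_real[OF P S ev TL]) (auto simp: Phi_Gumbel_def)
  have limA: "((\<lambda>t. t * measure \<mu> {A t..}) \<longlongrightarrow> 1) at_top" using lim[of 0] by simp
  have lim_exp: "((\<lambda>t. t * measure \<mu> {A (exp x * t)..}) \<longlongrightarrow> exp (- x)) at_top" for x
    using tendsto_rescale[OF limA, of "exp x"] by (simp add: exp_minus divide_inverse)
  have less_shift: "\<forall>\<^sub>F t in at_top. A (exp x * t) < A t + y * B t" if "x < y" for x y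
    by (rule eventually_threshold_less[OF P S lim lim_exp]) (use that in simp)
  have shift_less: "\<forall>\<^sub>F t in at_top. A t + y * B t < A (exp x * t)" if "y < x" for x y
    by (rule eventually_threshold_less[OF P S lim_exp lim]) (use that in simp)
  \<comment> \<open>To leading order \<open>A (exp x * t)\<close> is \<open>A t + x * B t\<close>.
    The slacks 51/50 and 99/50, together with \<open>51 \<le> A t / B t\<close>, are tuned so that
    \<open>A / B\<close> grows per factor \<open>exp 1\<close> by at most
    \<open>51 * 102 / (50 * 96) < 11/10 \<le> exp (1/10)\<close>.\<close>
  have E1: "\<forall>\<^sub>F t in at_top. A (exp 1 * t) < A t + 51/50 * B t" by (rule less_shift) simp
  have "filterlim (\<lambda>t :: real. exp 1 * t) at_top at_top"
    by (intro filterlim_tendsto_pos_mult_at_top[OF tendsto_const] filterlim_ident) simp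
  from eventually_compose_filterlim[OF E1 this]
  have E2: "\<forall>\<^sub>F t in at_top. A (exp 2 * t) < A (exp 1 * t) + 51/50 * B (exp 1 * t)"
    by (simp add: mult.assoc[symmetric] exp_add[symmetric])
  have E3: "\<forall>\<^sub>F t in at_top. A t + 99/50 * B t < A (exp 2 * t)" by (rule shift_less) simp
  have E4: "\<forall>\<^sub>F t in at_top. 51 \<le> A t / B t" using qlim by (simp add: filterlim_at_top)
  have "\<forall>\<^sub>F t in at_top. A (exp 1 * t) < A t + 51/50 * B t \<and> 96/102 * B t < B (exp 1 * t) \<and> 51 * B t \<le> A t \<and> c \<le> A t"
    using E1 E2 E3 E4 Age eventually_ge_at_top[of 0]
  proof eventually_elim
    case (elim t)
    \<comment> \<open>Two single steps of \<open>A\<close>, from \<open>t\<close> to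
      \<open>exp 1 * t\<close> to \<open>exp 2 * t\<close>, must cover the double step in
      \<open>E3\<close>; the first covers at most \<open>51/50 * B t\<close>, so \<open>B\<close>
      cannot drop by much before the second.\<close>
    have "96/102 * B t < B (exp 1 * t)" using elim(1-3) by linarith
    moreover have "51 * B t \<le> A t" using elim(4) Bpos[of t] elim(6) by (simp add: field_simps)
    ultimately show ?case using elim by blast
  qed
  then obtain t1 where t1: "\<And>t. t1 \<le> t \<Longrightarrow>
      A (exp 1 * t) < A t + 51/50 * B t \<and> 96/102 * B t < B (exp 1 * t) \<and> 51 * B t \<le> A t \<and> c \<le> A t"
    unfolding eventually_at_top_linorder by blast
  define t2 where "t2 = max 1 t1"
  have t2: "1 \<le> t2" "t1 \<le> t2" by (auto simp: t2_def)
  have e1: "1 < exp (1 :: real)" "(2 :: real) \<le> exp 1" using exp_ge_add_one_self[of 1] by auto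
  have e01: "(11 / 10 :: real) \<le> exp (1/10)" using exp_ge_add_one_self[of "1/10"] by simp
  have contA': "continuous_on {t2..} A" and contB': "continuous_on {t2..} B"
    using t2 by (auto intro: continuous_on_subset[OF contA] continuous_on_subset[OF contB])
  have Bne: "\<forall>t\<in>{t2..}. B t \<noteq> 0"
  proof
    fix t assume "t \<in> {t2..}"
    then show "B t \<noteq> 0" using Bpos[of t] t2 by auto
  qed
  have Ane: "\<forall>t\<in>{t2..}. (A t)\<^sup>2 \<noteq> 0"
  proof
    fix t assume "t \<in> {t2..}"
    then show "(A t)\<^sup>2 \<noteq> 0" using t1[of t] t2 c by auto
  qed
  obtain Q1 where Q1: "0 < Q1" "\<And>t. t2 \<le> t \<Longrightarrow> A t \<le> Q1 * t powr 1"
  proof (rule polynomial_growth[of "exp 1" t2 1 A])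
    fix t assume t: "t2 \<le> t"
    have "A (exp 1 * t) \<le> 2 * A t" using t1[of t] t t2 Bpos[of t] by auto
    also have "\<dots> \<le> exp 1 * A t" using e1 t1[of t] t t2 c by (intro mult_right_mono) auto
    finally show "A (exp 1 * t) \<le> exp 1 powr 1 * A t" by simp
  qed (use e1 t2 contA' in auto)
  obtain Q2 where Q2: "0 < Q2" "\<And>t. t2 \<le> t \<Longrightarrow> A t / B t \<le> Q2 * t powr (1/10)"
  proof (rule polynomial_growth[of "exp 1" t2 "1/10" "\<lambda>t. A t / B t"])
    show "continuous_on {t2..} (\<lambda>t. A t / B t)"
      by (intro continuous_on_divide contA' contB' Bne)
    fix t assume t: "t2 \<le> t"
    note T = t1[of t]
    have B: "0 < B t" "0 < B (exp 1 * t)" using Bpos[of t] Bpos[of "exp 1 * t"] t t2 by auto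
    have "A (exp 1 * t) \<le> 51/50 * A t" using T t t2 by auto
    then have "A (exp 1 * t) / B (exp 1 * t) \<le> (51/50 * A t) / (96/102 * B t)"
      using T t t2 B c by (intro frac_le) auto
    also have "\<dots> = 51 * 102 / (50 * 96) * (A t / B t)" by simp
    also have "\<dots> \<le> exp (1/10) * (A t / B t)"
      using e01 T t t2 B c by (intro mult_right_mono) auto
    finally show "A (exp 1 * t) / B (exp 1 * t) \<le> exp 1 powr (1/10) * (A t / B t)"
      by (simp add: powr_def)
  qed (use e1 t2 in auto)
  have base: "\<forall>\<^sub>F t in at_top. t2 \<le> t \<and> 1 \<le> t \<and> c \<le> A t \<and> 0 < B t \<and> 51 * B t \<le> A t"
    using eventually_ge_at_top[of t2]
  proof eventually_elim
    case (elim t)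
    then show ?case using t1[of t] t2 Bpos[of t] by auto
  qed
  \<comment> \<open>Moving a threshold from \<open>A\<close> to \<open>A - B\<close> moves its
    reciprocal by about \<open>B / A^2\<close>. With \<open>v0 = 0\<close>, both for
    \<open>M = 1\<close> and for \<open>M = \<infinity>\<close>, the window has order
    \<open>1 / A\<close>, which exceeds the spacing by the factor \<open>A / B\<close>; this slowly
    growing factor is the reason for the loss \<open>t powr (1/10)\<close>. The exponent 11/10 comes
    from \<open>1 / d = A * (A / B)\<close> and the linear bound on \<open>A\<close>.\<close>
  have "\<exists>C t0. tail_scales \<mu> 0 (\<lambda>t. B t / (A t)\<^sup>2) (\<lambda>t. 1 / A t) (\<lambda>t. 1 / (A t - B t)) (\<lambda>t. 1 / (A t - 2 * B t)) (11/10) C t0"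
  proof (rule tail_scalesI)
    show "AE y in \<mu>. 0 \<le> 1 / y" using pos by eventually_elim simp
    show "continuous_on {t2..} (\<lambda>t. B t / (A t)\<^sup>2)"
      by (intro continuous_on_divide continuous_on_power contA' contB' Ane)
    show "\<forall>\<^sub>F t in at_top. 0 < 1 / A t \<and> 0 < B t / (A t)\<^sup>2 \<and> B t / (A t)\<^sup>2 \<le> 1 / (A t - B t) - 1 / A t \<and>
       B t / (A t)\<^sup>2 \<le> 1 / (A t - 2 * B t) - 1 / (A t - B t)"
      using base
    proof eventually_elim
      case (elim t)
      have A: "0 < A t" "0 < A t - B t" "0 < A t - 2 * B t" using elim c by auto
      have "1 / (A t - B t) - 1 / A t = B t / ((A t - B t) * A t)"
        "1 / (A t - 2 * B t) - 1 / (A t - B t) = B t / ((A t - 2 * B t) * (A t - B t))"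
        using A by (simp_all add: field_simps)
      moreover have "B t / (A t * A t) \<le> B t / ((A t - B t) * A t)"
        using A elim by (intro divide_left_mono mult_mono mult_pos_pos) auto
      moreover have "B t / (A t * A t) \<le> B t / ((A t - 2 * B t) * (A t - B t))"
        using A elim by (intro divide_left_mono mult_mono mult_pos_pos) auto
      ultimately show ?case using A elim by (simp add: power2_eq_square)
    qed
    show "\<forall>\<^sub>F t in at_top. 1 / (A t - 2 * B t) - 0 \<le> (2 * Q2) * t powr (1/10) * (B t / (A t)\<^sup>2)"
      using base
    proof eventually_elim
      case (elim t)
      then have A: "0 < A t" "A t / 2 \<le> A t - 2 * B t" "0 < B t" using c by auto
      have "1 / (A t - 2 * B t) \<le> 1 / (A t / 2)" using A by (intro divide_left_mono mult_pos_pos) auto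
      also have "\<dots> = 2 * (A t / B t) * (B t / (A t)\<^sup>2)" using A by (simp add: power2_eq_square)
      also have "\<dots> \<le> 2 * (Q2 * t powr (1/10)) * (B t / (A t)\<^sup>2)"
        using Q2(2)[of t] elim A by (intro mult_right_mono mult_left_mono) auto
      finally show ?case by (simp add: mult.assoc)
    qed
    show "\<forall>\<^sub>F t in at_top. 1 / (A t - 2 * B t) \<le> 2 / c"
      using base
    proof eventually_elim
      case (elim t)
      then have "c / 2 \<le> A t - 2 * B t" using c by auto
      then have "1 / (A t - 2 * B t) \<le> 1 / (c / 2)" using c by (intro divide_left_mono mult_pos_pos) auto
      then show ?case by simp
    qed
    show "\<forall>\<^sub>F t in at_top. 1 \<le> (Q1 * Q2) * t powr (11/10) * (B t / (A t)\<^sup>2)"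
      using base
    proof eventually_elim
      case (elim t)
      then have A: "0 < A t" "0 < B t" "0 < t" using c by auto
      have "A t * (A t / B t) \<le> (Q1 * t powr 1) * (Q2 * t powr (1/10))"
        using Q1(1) Q1(2)[of t] Q2(2)[of t] elim A by (intro mult_mono) auto
      also have "\<dots> = Q1 * Q2 * (t powr 1 * t powr (1/10))" by (simp only: mult_ac)
      also have "t powr 1 * t powr (1/10) = t powr (11/10)" by (simp only: powr_add[symmetric]) simp
      finally have "(A t * (A t / B t)) * (B t / (A t)\<^sup>2) \<le> Q1 * Q2 * t powr (11/10) * (B t / (A t)\<^sup>2)"
        using A by (intro mult_right_mono) auto
      then show ?case using A by (simp add: power2_eq_square)
    qed
    have "\<forall>\<^sub>F t in at_top. t * measure \<mu> {A t + (- 2) * B t..} < exp 2 + 1"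
      using order_tendstoD(2)[OF lim[of "- 2"], of "exp 2 + 1"] by simp
    then show "\<forall>\<^sub>F t in at_top. t * measure \<mu> {1 / (1 / (A t - 2 * B t))..} \<le> exp 2 + 1"
      by (auto elim: eventually_mono)
    show "\<forall>\<^sub>F t in at_top. 1/2 \<le> t * measure \<mu> {1 / (1 / A t)..}"
      using order_tendstoD(1)[OF limA, of "1/2"] by (auto elim: eventually_mono)
  qed auto
  then show ?thesis by blast
qed

lemma extreme_value_tail_scales:
  assumes "prob_space \<mu>" "sets \<mu> = sets borel" "extreme_value \<mu>" "AE y in \<mu>. 0 < y"
  obtains v0 d v1 v2 v3 p C t0 where "tail_scales \<mu> v0 d v1 v2 v3 p C t0"
proof -
  obtain A B where AB: "continuous_on {0..} A" "continuous_on {0..} B" "\<forall>t\<ge>0. 0 \<le> B t"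
    "Weibull_case \<mu> A B \<or> Gumbel_case \<mu> A B \<or> Frechet_case \<mu> A B"
    using assms(3) unfolding extreme_value_def by blast
  then have "\<exists>v0 d v1 v2 v3 p C t0. tail_scales \<mu> v0 d v1 v2 v3 p C t0"
    using Weibull_tail_scales[OF assms AB(2,3)] Frechet_tail_scales[OF assms AB(2)]
      Gumbel_tail_scales[OF assms AB(1-3)] by blast
  then show ?thesis using that by blast
qed

section \<open>One-step estimates\<close>

text \<open>\<open>real_cond_exp\<close> is a difference of two nonnegative conditional
  expectations, and the one belonging to the negative part vanishes for an indicator. Staying with
  nonnegative integrals avoids integrability conditions on \<open>h\<close>.\<close>

lemma (in prob_space) nn_integral_mult_indicator_cond:
  assumes sub: "subalgebra M F" and J: "J \<in> events" and h: "h \<in> borel_measurable F"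
  shows "(\<integral>\<^sup>+\<omega>. h \<omega> * indicator J \<omega> \<partial>M)
       = (\<integral>\<^sup>+\<omega>. h \<omega> * ennreal (real_cond_exp M F (indicator J) \<omega>) \<partial>M)"
    and "AE \<omega> in M. 0 \<le> real_cond_exp M F (indicator J) \<omega> \<and> real_cond_exp M F (indicator J) \<omega> \<le> 1"
proof -
  interpret finite_measure_subalgebra M F
    by unfold_locales (rule sub)
  let ?n = "nn_cond_exp M F (\<lambda>\<omega>. ennreal (indicator J \<omega>))"
  have m: "(\<lambda>\<omega>. ennreal (indicator J \<omega>)) \<in> borel_measurable M" using J by simp
  have "AE \<omega> in M. ?n \<omega> \<le> nn_cond_exp M F (\<lambda>_. 1) \<omega>"
    by (rule nn_cond_exp_mono) (auto simp: m split: split_indicator)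
  moreover have "AE \<omega> in M. nn_cond_exp M F (\<lambda>_. 1) \<omega> = (1::ennreal)"
    using nn_cond_exp_F_meas[of "\<lambda>_. 1"] by simp
  ultimately have le1: "AE \<omega> in M. ?n \<omega> \<le> 1" by eventually_elim simp
  have eq0: "(\<lambda>\<omega>. ennreal (- indicator J \<omega>)) = (\<lambda>_. 0)"
    by (auto simp: fun_eq_iff ennreal_neg split: split_indicator)
  have zero: "AE \<omega> in M. nn_cond_exp M F (\<lambda>\<omega>. ennreal (- indicator J \<omega>)) \<omega> = 0"
    unfolding eq0 using nn_cond_exp_F_meas[of "\<lambda>_. 0"] by auto
  have eq: "AE \<omega> in M. real_cond_exp M F (indicator J) \<omega> = enn2real (?n \<omega>)"
    using zero by eventually_elim (simp add: real_cond_exp_def)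
  show "AE \<omega> in M. 0 \<le> real_cond_exp M F (indicator J) \<omega> \<and> real_cond_exp M F (indicator J) \<omega> \<le> 1"
    using eq le1
    by eventually_elim (simp add: enn2real_leI)
  have "(\<integral>\<^sup>+\<omega>. h \<omega> * ennreal (real_cond_exp M F (indicator J) \<omega>) \<partial>M) = (\<integral>\<^sup>+\<omega>. h \<omega> * ?n \<omega> \<partial>M)"
  proof (rule nn_integral_cong_AE)
    show "AE \<omega> in M. h \<omega> * ennreal (real_cond_exp M F (indicator J) \<omega>) = h \<omega> * ?n \<omega>"
      using eq le1
    proof eventually_elim
      case (elim \<omega>)
      have "?n \<omega> < top" using elim(2) ennreal_one_less_top by (rule le_less_trans)
      with elim show ?case by simp
    qed
  qed
  also have "\<dots> = (\<integral>\<^sup>+\<omega>. h \<omega> * ennreal (indicator J \<omega>) \<partial>M)"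
    by (rule nn_cond_exp_intg[OF h m])
  also have "\<dots> = (\<integral>\<^sup>+\<omega>. h \<omega> * indicator J \<omega> \<partial>M)"
    by (intro nn_integral_cong) (auto split: split_indicator)
  finally show "(\<integral>\<^sup>+\<omega>. h \<omega> * indicator J \<omega> \<partial>M)
       = (\<integral>\<^sup>+\<omega>. h \<omega> * ennreal (real_cond_exp M F (indicator J) \<omega>) \<partial>M)" by simp
qed

text \<open>One supermartingale step: given the past, the next value is \<open>h1\<close> or
  \<open>h0\<close> according to \<open>J\<close>, with conditional mean
  \<open>h0 + (h1 - h0) * p\<close>. The probability \<open>p\<close> is asked for only where the
  branches differ, because the model prescribes the chance of joining a table only once that table
  is occupied.\<close>

lemma (in prob_space) nn_integral_branch_le:
  fixes h0 h1 X X' p :: "'a \<Rightarrow> real"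
  assumes sub: "subalgebra M F" and J: "J \<in> events"
    and h: "h0 \<in> borel_measurable F" "h1 \<in> borel_measurable F"
    and nonneg: "\<And>\<omega>. 0 \<le> h0 \<omega>" "\<And>\<omega>. 0 \<le> h1 \<omega>"
    and p: "AE \<omega> in M. h0 \<omega> \<noteq> h1 \<omega> \<longrightarrow> real_cond_exp M F (indicator J) \<omega> = p \<omega>"
    and X': "AE \<omega> in M. X' \<omega> = (if \<omega> \<in> J then h1 \<omega> else h0 \<omega>)"
    and le: "AE \<omega> in M. h0 \<omega> + (h1 \<omega> - h0 \<omega>) * p \<omega> \<le> X \<omega>"
  shows "(\<integral>\<^sup>+\<omega>. ennreal (X' \<omega>) \<partial>M) \<le> (\<integral>\<^sup>+\<omega>. ennreal (X \<omega>) \<partial>M)"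
proof -
  interpret finite_measure_subalgebra M F
    by unfold_locales (rule sub)
  define q where "q = real_cond_exp M F (indicator J)"
  define q' where "q' = real_cond_exp M F (indicator (space M - J))"
  have hM[measurable]: "h0 \<in> borel_measurable M" "h1 \<in> borel_measurable M"
    using h measurable_from_subalg[OF sub] by auto
  have [measurable]: "J \<in> sets M" "q \<in> borel_measurable M" "q' \<in> borel_measurable M"
    using J by (auto simp: q_def q'_def)
  have q: "AE \<omega> in M. 0 \<le> q \<omega> \<and> q \<omega> \<le> 1" unfolding q_def
    by (rule nn_integral_mult_indicator_cond(2)[OF sub J, of "\<lambda>_. 0"]) simp
  have J': "space M - J \<in> events" using J by auto
  have iJ: "integrable M (indicator J :: 'a \<Rightarrow> real)" "integrable M (indicator (space M - J) :: 'a \<Rightarrow> real)"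
    using J J' by (simp_all add: less_top[symmetric])
  have "AE \<omega> in M. q \<omega> + q' \<omega> = real_cond_exp M F (\<lambda>\<omega>. indicator J \<omega> + indicator (space M - J) \<omega>) \<omega>"
    unfolding q_def q'_def using real_cond_exp_add[OF iJ] by (auto elim!: eventually_mono)
  moreover have "AE \<omega> in M. real_cond_exp M F (\<lambda>\<omega>. indicator J \<omega> + indicator (space M - J) \<omega>) \<omega>
      = real_cond_exp M F (\<lambda>_. 1) \<omega>"
    by (rule real_cond_exp_cong) (use iJ in \<open>auto split: split_indicator\<close>)
  moreover have "AE \<omega> in M. real_cond_exp M F (\<lambda>_. 1) \<omega> = 1"
    by (rule real_cond_exp_F_meas) auto
  ultimately have qq: "AE \<omega> in M. q' \<omega> = 1 - q \<omega>" by eventually_elim auto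
  have "(\<integral>\<^sup>+\<omega>. ennreal (X' \<omega>) \<partial>M)
      = (\<integral>\<^sup>+\<omega>. ennreal (h1 \<omega>) * indicator J \<omega> + ennreal (h0 \<omega>) * indicator (space M - J) \<omega> \<partial>M)"
  proof (rule nn_integral_cong_AE)
    show "AE \<omega> in M. ennreal (X' \<omega>)
      = ennreal (h1 \<omega>) * indicator J \<omega> + ennreal (h0 \<omega>) * indicator (space M - J) \<omega>"
      using X' AE_space by eventually_elim (auto split: split_indicator)
  qed
  also have "\<dots> = (\<integral>\<^sup>+\<omega>. ennreal (h1 \<omega>) * indicator J \<omega> \<partial>M)
      + (\<integral>\<^sup>+\<omega>. ennreal (h0 \<omega>) * indicator (space M - J) \<omega> \<partial>M)"
    by (rule nn_integral_add) auto
  also have "(\<integral>\<^sup>+\<omega>. ennreal (h1 \<omega>) * indicator J \<omega> \<partial>M) = (\<integral>\<^sup>+\<omega>. ennreal (h1 \<omega>) * ennreal (q \<omega>) \<partial>M)"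
    unfolding q_def by (rule nn_integral_mult_indicator_cond(1)[OF sub J]) (use h in measurable)
  also have "(\<integral>\<^sup>+\<omega>. ennreal (h0 \<omega>) * indicator (space M - J) \<omega> \<partial>M) = (\<integral>\<^sup>+\<omega>. ennreal (h0 \<omega>) * ennreal (q' \<omega>) \<partial>M)"
    unfolding q'_def by (rule nn_integral_mult_indicator_cond(1)[OF sub J']) (use h in measurable)
  also have "(\<integral>\<^sup>+\<omega>. ennreal (h1 \<omega>) * ennreal (q \<omega>) \<partial>M) + (\<integral>\<^sup>+\<omega>. ennreal (h0 \<omega>) * ennreal (q' \<omega>) \<partial>M)
     = (\<integral>\<^sup>+\<omega>. ennreal (h1 \<omega>) * ennreal (q \<omega>) + ennreal (h0 \<omega>) * ennreal (q' \<omega>) \<partial>M)"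
    by (rule nn_integral_add[symmetric]) auto
  also have "\<dots> \<le> (\<integral>\<^sup>+\<omega>. ennreal (X \<omega>) \<partial>M)"
  proof (rule nn_integral_mono_AE)
    show "AE \<omega> in M. ennreal (h1 \<omega>) * ennreal (q \<omega>) + ennreal (h0 \<omega>) * ennreal (q' \<omega>) \<le> ennreal (X \<omega>)"
      using q qq p le
    proof eventually_elim
      case (elim \<omega>)
      have "h1 \<omega> * q \<omega> + h0 \<omega> * q' \<omega> = h0 \<omega> + (h1 \<omega> - h0 \<omega>) * p \<omega>"
      proof (cases "h0 \<omega> = h1 \<omega>")
        case False
        then have "q \<omega> = p \<omega>" using elim by (simp add: q_def)
        then show ?thesis unfolding elim(2) by (simp add: algebra_simps)
      next
        case True
        then show ?thesis unfolding elim(2) by (simp add: algebra_simps)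
      qed
      then have "h1 \<omega> * q \<omega> + h0 \<omega> * q' \<omega> \<le> X \<omega>" using elim by simp
      moreover have "ennreal (h1 \<omega>) * ennreal (q \<omega>) + ennreal (h0 \<omega>) * ennreal (q' \<omega>)
        = ennreal (h1 \<omega> * q \<omega> + h0 \<omega> * q' \<omega>)"
        using elim nonneg[of \<omega>] by (simp add: ennreal_mult ennreal_plus)
      ultimately show ?case by (metis ennreal_leI)
    qed
  qed
  finally show ?thesis .
qed

section \<open>The history and the events of one step\<close>

locale positive_CRP = disordered_CRP +
  assumes theta_pos: "0 < \<theta>" and weights_pos: "AE x in \<mu>. 0 < x"
begin

abbreviation "Hist \<equiv> history P W S"

lemma W_measurable: "1 \<le> i \<Longrightarrow> W i \<in> borel_measurable P"
  using weights_indep by (simp add: indep_vars_def)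

lemma subalgebra_history: "subalgebra P (Hist n)"
proof -
  have "{W i -` B \<inter> space P | i B. 1 \<le> i \<and> B \<in> sets borel} \<union>
      {S i k -` C \<inter> space P | i k C. 1 \<le> i \<and> k \<le> n} \<subseteq> sets P"
    using W_measurable S_measurable by (auto intro!: measurable_sets)
  then have "sigma_sets (space P) ({W i -` B \<inter> space P | i B. 1 \<le> i \<and> B \<in> sets borel} \<union>
      {S i k -` C \<inter> space P | i k C. 1 \<le> i \<and> k \<le> n}) \<subseteq> sets P"
    by (rule sets.sigma_sets_subset)
  then show ?thesis
    unfolding subalgebra_def history_def space_measure_of_conv
    by (subst sets_measure_of) (auto simp del: One_nat_def)
qed

lemma space_history [simp]: "space (Hist n) = space P"
  by (simp add: history_def space_measure_of_conv)

lemma W_history [measurable (raw)]: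
  assumes "1 \<le> i" shows "W i \<in> borel_measurable (Hist n)"
proof (rule measurableI)
  fix B :: "real set" assume "B \<in> sets borel"
  then have "W i -` B \<inter> space P \<in> {W i -` B \<inter> space P | i B. 1 \<le> i \<and> B \<in> sets borel} \<union>
      {S i k -` C \<inter> space P | i k C. 1 \<le> i \<and> k \<le> n}"
    using assms by blast
  then show "W i -` B \<inter> space (Hist n) \<in> sets (Hist n)"
    unfolding space_history unfolding history_def by (intro in_measure_of) auto
qed simp

lemma S_history [measurable (raw)]:
  assumes "1 \<le> i" "k \<le> n" shows "S i k \<in> measurable (Hist n) (count_space UNIV)"
proof (rule measurableI)
  fix C :: "nat set"
  have "S i k -` C \<inter> space P \<in> {W i -` B \<inter> space P | i B. 1 \<le> i \<and> B \<in> sets borel} \<union>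
      {S i k -` C \<inter> space P | i k C. 1 \<le> i \<and> k \<le> n}"
    using assms by blast
  then show "S i k -` C \<inter> space (Hist n) \<in> sets (Hist n)"
    unfolding space_history unfolding history_def by (intro in_measure_of) auto
qed simp

lemma AE_W_pos: "AE \<omega> in P. \<forall>i\<ge>1. 0 < W i \<omega>"
proof -
  have "AE \<omega> in P. 1 \<le> i \<longrightarrow> 0 < W i \<omega>" for i
  proof (cases "1 \<le> i")
    case True
    have "AE x in distr P borel (W i). 0 < x" unfolding weights_distr[OF True] by (rule weights_pos)
    then have "AE \<omega> in P. 0 < W i \<omega>" by (rule AE_distrD[OF W_measurable[OF True]])
    then show ?thesis by (rule AE_mp) simp
  qed simp
  then show ?thesis by (simp add: AE_all_countable)
qed

text \<open>Stands in for \<open>last_table\<close>, whose \<open>Max\<close> is meaningful only for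
  a finite nonempty set of tables. As a condition on single coordinates it is measurable with
  respect to the history before anything is known about the path.\<close>

definition occupied :: "nat \<Rightarrow> nat \<Rightarrow> 'a \<Rightarrow> bool" where
  "occupied n k \<omega> \<longleftrightarrow> (\<forall>i\<ge>1. S i n \<omega> \<noteq> 0 \<longleftrightarrow> i \<le> k)"

lemma last_table_occupied:
  assumes "occupied n k \<omega>" "1 \<le> k" shows "last_table S n \<omega> = k"
proof -
  have "{i. 1 \<le> i \<and> S i n \<omega> \<noteq> 0} = {1..k}" using assms by (auto simp: occupied_def)
  moreover have "Max {1..k} = k" by (rule Max_eqI) (use assms(2) in auto)
  ultimately show ?thesis unfolding last_table_def by simp
qed

lemma joins_event: "1 \<le> i \<Longrightarrow> joins_table P S n i \<in> events"
proof -
  assume i: "1 \<le> i"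
  have eq: "{\<omega> \<in> space P. S j (Suc n) \<omega> = S j n \<omega> + d} \<in> events" if "1 \<le> j" for j d
  proof -
    have "{\<omega> \<in> space P. S j (Suc n) \<omega> = S j n \<omega> + d}
      = (\<Union>m. (S j n -` {m} \<inter> space P) \<inter> (S j (Suc n) -` {m + d} \<inter> space P))" by auto
    also have "\<dots> \<in> events"
      by (intro sets.countable_UN'' sets.Int measurable_sets[OF S_measurable[OF that]]) auto
    finally show ?thesis .
  qed
  have "{\<omega> \<in> space P. S i (Suc n) \<omega> = S i n \<omega> + 1} \<in> events" by (rule eq[OF i])
  moreover have "{\<omega> \<in> space P. 1 \<le> j \<longrightarrow> j \<noteq> i \<longrightarrow> S j (Suc n) \<omega> = S j n \<omega>} \<in> events" for j
    using eq[of j 0] by (cases "1 \<le> j \<and> j \<noteq> i") auto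
  moreover have "joins_table P S n i = {\<omega> \<in> space P. S i (Suc n) \<omega> = S i n \<omega> + 1} \<inter>
    (\<Inter>j. {\<omega> \<in> space P. 1 \<le> j \<longrightarrow> j \<noteq> i \<longrightarrow> S j (Suc n) \<omega> = S j n \<omega>})"
    by (auto simp: joins_table_def)
  moreover have "(\<Inter>j. {\<omega> \<in> space P. 1 \<le> j \<longrightarrow> j \<noteq> i \<longrightarrow> S j (Suc n) \<omega> = S j n \<omega>}) \<in> events"
    by (rule sets.countable_INT') (use calculation(2) in blast)+
  ultimately show ?thesis by (simp only: sets.Int)
qed

lemma occupied_history: "{\<omega> \<in> space P. occupied n k \<omega>} \<in> sets (Hist n)"
proof -
  have "{\<omega> \<in> space P. 1 \<le> i \<longrightarrow> (S i n \<omega> \<noteq> 0 \<longleftrightarrow> i \<le> k)} \<in> sets (Hist n)" for i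
  proof (cases "1 \<le> i")
    case True
    have [measurable]: "S i n \<in> measurable (Hist n) (count_space UNIV)" using True by measurable
    have "{\<omega> \<in> space (Hist n). S i n \<omega> \<noteq> 0 \<longleftrightarrow> i \<le> k} \<in> sets (Hist n)" by measurable
    moreover have "{\<omega> \<in> space P. 1 \<le> i \<longrightarrow> (S i n \<omega> \<noteq> 0 \<longleftrightarrow> i \<le> k)}
      = {\<omega> \<in> space (Hist n). S i n \<omega> \<noteq> 0 \<longleftrightarrow> i \<le> k}" using True by auto
    ultimately show ?thesis by (simp only:)
  next
    case False
    then have "{\<omega> \<in> space P. 1 \<le> i \<longrightarrow> (S i n \<omega> \<noteq> 0 \<longleftrightarrow> i \<le> k)} = space (Hist n)" by auto
    then show ?thesis by (simp only: sets.top)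
  qed
  moreover have "{\<omega> \<in> space P. occupied n k \<omega>} =
     (\<Inter>i. {\<omega> \<in> space P. 1 \<le> i \<longrightarrow> (S i n \<omega> \<noteq> 0 \<longleftrightarrow> i \<le> k)})"
    by (auto simp: occupied_def)
  moreover have "(\<Inter>i. {\<omega> \<in> space P. 1 \<le> i \<longrightarrow> (S i n \<omega> \<noteq> 0 \<longleftrightarrow> i \<le> k)}) \<in> sets (Hist n)"
    by (rule sets.countable_INT') (use calculation(1) in blast)+
  ultimately show ?thesis by (simp only:)
qed

end

section \<open>Structure of the configurations\<close>

context positive_CRP
begin

lemma total_rate_pos:
  assumes "\<forall>i\<ge>1. 0 < W i \<omega>" shows "0 < total_rate \<theta> W S n \<omega>"
proof -
  have "0 \<le> (\<Sum>i = 1..last_table S n \<omega>. W i \<omega> * real (S i n \<omega>))"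
    using assms by (intro sum_nonneg mult_nonneg_nonneg) (auto intro: less_imp_le)
  then show ?thesis using theta_pos by (simp add: total_rate_def)
qed

text \<open>Were the event not measurable, the conditional expectation would be the constant 0 by
  convention, contradicting \<open>open_transition\<close>.\<close>

lemma opens_event: "opens_table P S n \<in> events"
proof (rule ccontr)
  assume notin: "opens_table P S n \<notin> events"
  have sub: "opens_table P S n \<subseteq> space P" by (auto simp: opens_table_def)
  have "(\<lambda>\<omega>. ennreal (indicator (opens_table P S n) \<omega>)) \<notin> borel_measurable P"
  proof
    assume "(\<lambda>\<omega>. ennreal (indicator (opens_table P S n) \<omega>)) \<in> borel_measurable P"
    then have "(\<lambda>\<omega>. ennreal (indicator (opens_table P S n) \<omega>)) -` {1} \<inter> space P \<in> events"
      by (rule measurable_sets) simp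
    moreover have "(\<lambda>\<omega>. ennreal (indicator (opens_table P S n) \<omega>)) -` {1} \<inter> space P = opens_table P S n"
      using sub by (auto split: split_indicator_asm)
    ultimately show False using notin by simp
  qed
  moreover have "(\<lambda>\<omega>. ennreal (- indicator (opens_table P S n) \<omega>)) = (\<lambda>_. 0)"
    by (auto simp: fun_eq_iff ennreal_neg split: split_indicator)
  moreover have "AE \<omega> in P. nn_cond_exp P (Hist n) (\<lambda>_. 0) \<omega> = 0"
  proof -
    interpret finite_measure_subalgebra P "Hist n"
      by unfold_locales (rule subalgebra_history)
    show ?thesis using nn_cond_exp_F_meas[of "\<lambda>_. 0"] by auto
  qed
  ultimately have "AE \<omega> in P. real_cond_exp P (Hist n) (indicator (opens_table P S n)) \<omega> = 0"
    by (auto simp: real_cond_exp_def nn_cond_exp_def[of _ _ "\<lambda>\<omega>. ennreal (indicator _ \<omega>)"] elim!: eventually_mono)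
  with open_transition[of n] AE_W_pos have "AE \<omega> in P. False"
  proof eventually_elim
    case (elim \<omega>)
    then show ?case using total_rate_pos[of \<omega> n] theta_pos by auto
  qed
  then show False by simp
qed

text \<open>The model only prescribes conditional probabilities of certain transitions. That nothing
  else happens follows because, on \<open>occupied n k\<close>, these transitions are disjoint and
  their probabilities add up to 1 by the form of \<open>total_rate\<close>.\<close>

lemma AE_step:
  "AE \<omega> in P. occupied n k \<omega> \<and> 1 \<le> k \<longrightarrow>
     \<omega> \<in> opens_table P S n \<or> (\<exists>i\<in>{1..k}. \<omega> \<in> joins_table P S n i)"
proof (cases "1 \<le> k")
  case k: True
  define D where "D = {\<omega> \<in> space P. occupied n k \<omega>}"
  \<comment> \<open>Index 0 stands for opening a table, so that all transitions form one family over
    \<open>{0..k}\<close>.\<close>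
  define E where "E i = (if i = 0 then opens_table P S n else joins_table P S n i)" for i :: nat
  define q where "q i = real_cond_exp P (Hist n) (indicator (E i))" for i
  have D: "D \<in> sets (Hist n)" unfolding D_def by (rule occupied_history)
  have DP: "D \<in> events" using D subalgebra_history[of n] by (auto simp: subalgebra_def)
  have E: "E i \<in> events" for i using opens_event joins_event by (auto simp: E_def)
  have "disjoint_family_on (\<lambda>i. D \<inter> E i) {0..k}"
    unfolding disjoint_family_on_def
  proof (intro ballI impI)
    fix i j assume ij: "i \<in> {0..k}" "j \<in> {0..k}" "i \<noteq> j"
    have aux: "E i \<inter> E j = {}" if "1 \<le> i" "1 \<le> j" "i \<noteq> j" for i j
      using that unfolding E_def joins_table_def by force
    \<comment> \<open>Opening leaves table \<open>i \<le> k\<close> unchanged, whereas joining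
      increases it; the intersection with \<open>D\<close> is what identifies
      \<open>last_table\<close> with \<open>k\<close>.\<close>
    have aux0: "D \<inter> E 0 \<inter> E i = {}" if "1 \<le> i" "i \<le> k" for i
    proof (rule ccontr)
      assume "D \<inter> E 0 \<inter> E i \<noteq> {}"
      then obtain \<omega> where \<omega>: "\<omega> \<in> D" "\<omega> \<in> E 0" "\<omega> \<in> E i" by auto
      then have "last_table S n \<omega> = k" using last_table_occupied k by (auto simp: D_def)
      with \<omega>(2) have "S i (Suc n) \<omega> = S i n \<omega>" using that by (auto simp: E_def opens_table_def)
      with \<omega>(3) show False using that by (auto simp: E_def joins_table_def)
    qed
    show "D \<inter> E i \<inter> (D \<inter> E j) = {}"
      using ij aux[of i j] aux0[of i] aux0[of j] by (cases "i = 0"; cases "j = 0") auto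
  qed
  then have "emeasure P (\<Union>i\<in>{0..k}. D \<inter> E i) = (\<Sum>i\<in>{0..k}. emeasure P (D \<inter> E i))"
    using DP E by (subst sum_emeasure) auto
  also have "\<dots> = (\<Sum>i\<in>{0..k}. \<integral>\<^sup>+\<omega>. indicator D \<omega> * ennreal (q i \<omega>) \<partial>P)"
  proof (rule sum.cong)
    fix i
    have "emeasure P (D \<inter> E i) = (\<integral>\<^sup>+\<omega>. indicator (D \<inter> E i) \<omega> \<partial>P)"
      using DP E[of i] by simp
    also have "\<dots> = (\<integral>\<^sup>+\<omega>. indicator D \<omega> * indicator (E i) \<omega> \<partial>P)"
      by (simp only: indicator_inter_arith)
    also have "\<dots> = (\<integral>\<^sup>+\<omega>. indicator D \<omega> * ennreal (q i \<omega>) \<partial>P)"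
      unfolding q_def using D
      by (intro nn_integral_mult_indicator_cond[OF subalgebra_history E]) simp
    finally show "emeasure P (D \<inter> E i) = (\<integral>\<^sup>+\<omega>. indicator D \<omega> * ennreal (q i \<omega>) \<partial>P)" .
  qed simp
  also have "\<dots> = (\<integral>\<^sup>+\<omega>. (\<Sum>i\<in>{0..k}. indicator D \<omega> * ennreal (q i \<omega>)) \<partial>P)"
    using DP by (subst nn_integral_sum) (auto simp: q_def)
  also have "\<dots> = (\<integral>\<^sup>+\<omega>. indicator D \<omega> \<partial>P)"
  proof (rule nn_integral_cong_AE)
    have "AE \<omega> in P. \<forall>i. 1 \<le> i \<and> i \<le> last_table S n \<omega> \<longrightarrow>
        q i \<omega> = W i \<omega> * real (S i n \<omega>) / total_rate \<theta> W S n \<omega>"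
      unfolding AE_all_countable
    proof
      fix i :: nat
      show "AE \<omega> in P. 1 \<le> i \<and> i \<le> last_table S n \<omega> \<longrightarrow>
        q i \<omega> = W i \<omega> * real (S i n \<omega>) / total_rate \<theta> W S n \<omega>"
        using join_transition[of i n] by eventually_elim (auto simp: q_def E_def)
    qed
    moreover have "AE \<omega> in P. q 0 \<omega> = \<theta> / total_rate \<theta> W S n \<omega>"
      using open_transition[of n] by (simp add: q_def E_def)
    ultimately show "AE \<omega> in P. (\<Sum>i\<in>{0..k}. indicator D \<omega> * ennreal (q i \<omega>)) = indicator D \<omega>"
      using AE_W_pos
    proof eventually_elim
      case (elim \<omega>)
      show ?case
      proof (cases "\<omega> \<in> D")
        case True
        then have lt: "last_table S n \<omega> = k" using last_table_occupied k by (auto simp: D_def)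
        let ?T = "total_rate \<theta> W S n \<omega>"
        have T: "0 < ?T" using elim total_rate_pos by blast
        have qi: "q i \<omega> = W i \<omega> * real (S i n \<omega>) / ?T" if "i \<in> {1..k}" for i
          using elim(1) that lt by auto
        have "(\<Sum>i\<in>{0..k}. q i \<omega>) = q 0 \<omega> + (\<Sum>i\<in>{1..k}. q i \<omega>)"
          by (simp add: sum.atLeast_Suc_atMost)
        also have "\<dots> = (\<theta> + (\<Sum>i\<in>{1..k}. W i \<omega> * real (S i n \<omega>))) / ?T"
          using qi elim(2) by (simp add: add_divide_distrib sum_divide_distrib)
        also have "\<dots> = 1" using T by (simp add: total_rate_def lt)
        finally have one: "(\<Sum>i\<in>{0..k}. q i \<omega>) = 1" .
        have nn: "0 \<le> q i \<omega>" if "i \<in> {0..k}" for i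
        proof (cases "i = 0")
          case True
          then show ?thesis using elim(2) T theta_pos by simp
        next
          case False
          then have "i \<in> {1..k}" using that by auto
          then have "0 \<le> W i \<omega>" using elim(3) by (auto intro: less_imp_le)
          then show ?thesis using qi[OF \<open>i \<in> {1..k}\<close>] T by simp
        qed
        have "(\<Sum>i\<in>{0..k}. indicator D \<omega> * ennreal (q i \<omega>)) = (\<Sum>i\<in>{0..k}. ennreal (q i \<omega>))"
          using True by simp
        also have "\<dots> = ennreal (\<Sum>i\<in>{0..k}. q i \<omega>)" using nn by (rule sum_ennreal)
        finally show ?thesis using one True by simp
      qed simp
    qed
  qed
  also have "\<dots> = emeasure P D" using DP by simp
  finally have eq: "emeasure P (\<Union>i\<in>{0..k}. D \<inter> E i) = emeasure P D" .
  have U: "(\<Union>i\<in>{0..k}. D \<inter> E i) \<in> events" using DP E by auto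
  have "emeasure P (D - (\<Union>i\<in>{0..k}. D \<inter> E i)) = emeasure P D - emeasure P (\<Union>i\<in>{0..k}. D \<inter> E i)"
    by (rule emeasure_Diff) (use U DP in \<open>auto simp: emeasure_eq_measure\<close>)
  also have "\<dots> = 0" unfolding eq by (simp add: emeasure_eq_measure)
  finally have "D - (\<Union>i\<in>{0..k}. D \<inter> E i) \<in> null_sets P" using U DP by (auto intro!: null_setsI)
  then have "AE \<omega> in P. \<omega> \<notin> D - (\<Union>i\<in>{0..k}. D \<inter> E i)" by (rule AE_not_in)
  then show ?thesis using AE_space
  proof eventually_elim
    case (elim \<omega>)
    show ?case
    proof
      assume "occupied n k \<omega> \<and> 1 \<le> k"
      then obtain i where i: "i \<in> {0..k}" "\<omega> \<in> E i" using elim by (auto simp: D_def)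
      show "\<omega> \<in> opens_table P S n \<or> (\<exists>i\<in>{1..k}. \<omega> \<in> joins_table P S n i)"
      proof (cases "i = 0")
        case False
        then have "i \<in> {1..k}" "\<omega> \<in> joins_table P S n i" using i by (auto simp: E_def)
        then show ?thesis by blast
      qed (use i in \<open>auto simp: E_def\<close>)
    qed
  qed
qed simp

text \<open>Collects the almost sure properties once, so that all later statements about paths are
  deterministic. The dichotomy ranges over all \<open>n\<close> and \<open>k\<close>, a countable
  family, since the actual number of tables is only identified afterwards by induction.\<close>

definition regular :: "'a \<Rightarrow> bool" where
  "regular \<omega> \<longleftrightarrow> \<omega> \<in> space P \<and> (\<forall>i\<ge>1. 0 < W i \<omega>) \<and> S 1 0 \<omega> = 1 \<and> (\<forall>i\<ge>2. S i 0 \<omega> = 0) \<and>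
     (\<forall>n k. occupied n k \<omega> \<and> 1 \<le> k \<longrightarrow>
        \<omega> \<in> opens_table P S n \<or> (\<exists>i\<in>{1..k}. \<omega> \<in> joins_table P S n i))"

lemma AE_regular: "AE \<omega> in P. regular \<omega>"
proof -
  have "AE \<omega> in P. \<forall>n k. occupied n k \<omega> \<and> 1 \<le> k \<longrightarrow>
        \<omega> \<in> opens_table P S n \<or> (\<exists>i\<in>{1..k}. \<omega> \<in> joins_table P S n i)"
    unfolding AE_all_countable using AE_step by blast
  with AE_space AE_W_pos S_initial show ?thesis
    by eventually_elim (auto simp: regular_def)
qed

text \<open>Here and in \<open>rate\<close> the indices run over the fixed range
  \<open>{1..Suc n}\<close>, which contains all tables that can be open at time \<open>n\<close>.
  This makes both functions measurable with respect to the history; on regular paths they agree with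
  \<open>last_table\<close> and \<open>total_rate\<close>.\<close>

definition ntables :: "nat \<Rightarrow> 'a \<Rightarrow> nat" where
  "ntables n \<omega> = card {i \<in> {1..Suc n}. S i n \<omega> \<noteq> 0}"

definition rate :: "nat \<Rightarrow> 'a \<Rightarrow> real" where
  "rate n \<omega> = \<theta> + (\<Sum>i = 1..Suc n. W i \<omega> * real (S i n \<omega>))"

lemma occupied_Suc_opens:
  assumes "occupied n k \<omega>" "1 \<le> k" "\<omega> \<in> opens_table P S n"
  shows "S (Suc k) (Suc n) \<omega> = 1" "\<And>j. 1 \<le> j \<Longrightarrow> j \<noteq> Suc k \<Longrightarrow> S j (Suc n) \<omega> = S j n \<omega>"
    "occupied (Suc n) (Suc k) \<omega>"
proof -
  have lt: "last_table S n \<omega> = k" using assms last_table_occupied by blast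
  show *: "S (Suc k) (Suc n) \<omega> = 1" "\<And>j. 1 \<le> j \<Longrightarrow> j \<noteq> Suc k \<Longrightarrow> S j (Suc n) \<omega> = S j n \<omega>"
    using assms(3) lt by (auto simp: opens_table_def)
  show "occupied (Suc n) (Suc k) \<omega>"
    unfolding occupied_def
  proof (intro allI impI)
    fix i :: nat assume i: "1 \<le> i"
    show "S i (Suc n) \<omega> \<noteq> 0 \<longleftrightarrow> i \<le> Suc k"
      using *(1) *(2)[OF i] assms(1) i unfolding occupied_def by (cases "i = Suc k") auto
  qed
qed

lemma occupied_Suc_joins:
  assumes "occupied n k \<omega>" "i \<in> {1..k}" "\<omega> \<in> joins_table P S n i"
  shows "S i (Suc n) \<omega> = S i n \<omega> + 1" "\<And>j. 1 \<le> j \<Longrightarrow> j \<noteq> i \<Longrightarrow> S j (Suc n) \<omega> = S j n \<omega>"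
    "occupied (Suc n) k \<omega>"
proof -
  show *: "S i (Suc n) \<omega> = S i n \<omega> + 1" "\<And>j. 1 \<le> j \<Longrightarrow> j \<noteq> i \<Longrightarrow> S j (Suc n) \<omega> = S j n \<omega>"
    using assms(3) by (auto simp: joins_table_def)
  show "occupied (Suc n) k \<omega>"
    unfolding occupied_def
  proof (intro allI impI)
    fix j :: nat assume j: "1 \<le> j"
    show "S j (Suc n) \<omega> \<noteq> 0 \<longleftrightarrow> j \<le> k"
      using *(1) *(2)[OF j] assms(1,2) j unfolding occupied_def by (cases "j = i") auto
  qed
qed

lemma regular_config:
  assumes "regular \<omega>"
  shows "\<exists>k\<ge>1. k \<le> Suc n \<and> occupied n k \<omega> \<and> (\<Sum>i=1..k. S i n \<omega>) = Suc n"
proof (induction n)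
  case 0
  have "occupied 0 1 \<omega>"
    unfolding occupied_def
  proof (intro allI impI)
    fix i :: nat assume "1 \<le> i"
    then show "S i 0 \<omega> \<noteq> 0 \<longleftrightarrow> i \<le> 1" using assms by (cases "i = 1") (auto simp: regular_def)
  qed
  then show ?case using assms by (intro exI[of _ 1]) (auto simp: regular_def)
next
  case (Suc n)
  then obtain k where k: "1 \<le> k" "k \<le> Suc n" "occupied n k \<omega>" "(\<Sum>i=1..k. S i n \<omega>) = Suc n" by auto
  have "\<omega> \<in> opens_table P S n \<or> (\<exists>i\<in>{1..k}. \<omega> \<in> joins_table P S n i)"
    using assms k by (auto simp: regular_def)
  then show ?case
  proof
    assume o: "\<omega> \<in> opens_table P S n"
    note oc = occupied_Suc_opens[OF k(3,1) o]
    have "(\<Sum>i=1..Suc k. S i (Suc n) \<omega>) = (\<Sum>i=1..k. S i (Suc n) \<omega>) + 1" using oc(1) by simp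
    also have "(\<Sum>i=1..k. S i (Suc n) \<omega>) = (\<Sum>i=1..k. S i n \<omega>)"
      by (rule sum.cong) (use oc(2) in auto)
    finally have "(\<Sum>i=1..Suc k. S i (Suc n) \<omega>) = Suc (Suc n)" using k by simp
    then show ?thesis using oc(3) k by (intro exI[of _ "Suc k"]) simp
  next
    assume "\<exists>i\<in>{1..k}. \<omega> \<in> joins_table P S n i"
    then obtain i where i: "i \<in> {1..k}" "\<omega> \<in> joins_table P S n i" by auto
    note oc = occupied_Suc_joins[OF k(3) i]
    have "(\<Sum>j=1..k. S j (Suc n) \<omega>) = S i (Suc n) \<omega> + (\<Sum>j\<in>{1..k}-{i}. S j (Suc n) \<omega>)"
      using i by (simp add: sum.remove)
    also have "(\<Sum>j\<in>{1..k}-{i}. S j (Suc n) \<omega>) = (\<Sum>j\<in>{1..k}-{i}. S j n \<omega>)"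
      by (rule sum.cong) (use oc(2) in auto)
    also have "S i (Suc n) \<omega> + \<dots> = Suc (\<Sum>j=1..k. S j n \<omega>)"
      using i oc(1) by (simp add: sum.remove)
    finally have "(\<Sum>j=1..k. S j (Suc n) \<omega>) = Suc (Suc n)" using k by simp
    then show ?thesis using oc(3) k by (intro exI[of _ k]) simp
  qed
qed

lemma ntables_occupied:
  assumes "occupied n k \<omega>" "k \<le> Suc n" shows "ntables n \<omega> = k"
proof -
  have "{i \<in> {1..Suc n}. S i n \<omega> \<noteq> 0} = {1..k}" using assms by (auto simp: occupied_def)
  then show ?thesis by (simp add: ntables_def)
qed

lemma regular_ntables:
  assumes "regular \<omega>"
  shows "1 \<le> ntables n \<omega>" "ntables n \<omega> \<le> Suc n" "occupied n (ntables n \<omega>) \<omega>"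
    "(\<Sum>i=1..ntables n \<omega>. S i n \<omega>) = Suc n" "last_table S n \<omega> = ntables n \<omega>"
  using regular_config[OF assms, of n] ntables_occupied[of n _ \<omega>] last_table_occupied[of n _ \<omega>] by auto

lemma regular_S_eq_0:
  "regular \<omega> \<Longrightarrow> 1 \<le> i \<Longrightarrow> S i n \<omega> = 0 \<longleftrightarrow> ntables n \<omega> < i"
  using regular_ntables(3)[of \<omega> n] unfolding occupied_def by (meson not_le)

lemma regular_rate:
  assumes "regular \<omega>"
  shows "rate n \<omega> = total_rate \<theta> W S n \<omega>" "\<theta> \<le> rate n \<omega>"
proof -
  have "(\<Sum>i=1..Suc n. W i \<omega> * real (S i n \<omega>)) = (\<Sum>i=1..ntables n \<omega>. W i \<omega> * real (S i n \<omega>))"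
    by (rule sum.mono_neutral_right) (use regular_ntables(2)[OF assms, of n] regular_S_eq_0[OF assms, of _ n] in auto)
  then show "rate n \<omega> = total_rate \<theta> W S n \<omega>"
    by (simp add: rate_def total_rate_def regular_ntables(5)[OF assms])
  have "0 \<le> (\<Sum>i=1..Suc n. W i \<omega> * real (S i n \<omega>))"
    using assms by (intro sum_nonneg mult_nonneg_nonneg) (auto simp: regular_def intro: less_imp_le)
  then show "\<theta> \<le> rate n \<omega>" by (simp add: rate_def)
qed

lemma regular_ntables_Suc:
  assumes "regular \<omega>"
  shows "ntables (Suc n) \<omega> = (if \<omega> \<in> opens_table P S n then Suc (ntables n \<omega>) else ntables n \<omega>)"
proof (cases "\<omega> \<in> opens_table P S n")
  case True
  have "occupied (Suc n) (Suc (ntables n \<omega>)) \<omega>"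
    by (rule occupied_Suc_opens(3)[OF _ _ True]) (use regular_ntables[OF assms] in auto)
  then show ?thesis using True ntables_occupied regular_ntables(2)[OF assms, of n] by auto
next
  case False
  then obtain i where "i \<in> {1..ntables n \<omega>}" "\<omega> \<in> joins_table P S n i"
    using assms regular_ntables[OF assms, of n] unfolding regular_def by blast
  then have "occupied (Suc n) (ntables n \<omega>) \<omega>"
    using occupied_Suc_joins(3) regular_ntables(3)[OF assms] by blast
  then show ?thesis using False ntables_occupied regular_ntables(2)[OF assms, of n] by (simp add: le_SucI)
qed

lemma regular_S_Suc:
  assumes "regular \<omega>" "1 \<le> i"
  shows "S i (Suc n) \<omega> = (if S i n \<omega> = 0 then if \<omega> \<in> opens_table P S n \<and> i = Suc (ntables n \<omega>) then 1 else 0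
     else if \<omega> \<in> joins_table P S n i then Suc (S i n \<omega>) else S i n \<omega>)"
proof (cases "\<omega> \<in> opens_table P S n")
  case True
  note oc = occupied_Suc_opens[OF regular_ntables(3,1)[OF assms(1), of n] True]
  show ?thesis
  proof (cases "i = Suc (ntables n \<omega>)")
    case True
    then show ?thesis using oc(1) \<open>\<omega> \<in> opens_table P S n\<close> regular_S_eq_0[OF assms, of n] by simp
  next
    case False
    then have "S i (Suc n) \<omega> = S i n \<omega>" using oc(2) assms by blast
    then show ?thesis using False by (auto simp: joins_table_def)
  qed
next
  case False
  then obtain j where j: "j \<in> {1..ntables n \<omega>}" "\<omega> \<in> joins_table P S n j"
    using assms regular_ntables[OF assms(1), of n] unfolding regular_def by blast
  note oc = occupied_Suc_joins[OF regular_ntables(3)[OF assms(1)] j]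
  show ?thesis
  proof (cases "i = j")
    case True
    then show ?thesis using oc(1) j regular_S_eq_0[OF assms, of n] by auto
  next
    case False
    then have "S i (Suc n) \<omega> = S i n \<omega>" using oc(2) assms by blast
    then show ?thesis using \<open>\<omega> \<notin> opens_table P S n\<close> by (auto simp: joins_table_def)
  qed
qed

end

section \<open>Supermartingales\<close>

text \<open>For \<open>\<kappa> = -1\<close> this is \<open>s\<close>, for \<open>\<kappa> = 1/2\<close> it is of order \<open>1 / sqrt s\<close>. The
  product makes \<open>growth_weight \<kappa> s * exp (\<kappa> * w * t)\<close> a supermartingale of the growth of a table.\<close>

definition growth_weight :: "real \<Rightarrow> nat \<Rightarrow> real" where
  "growth_weight \<kappa> s = (\<Prod>j\<in>{1..<s}. 1 - \<kappa> / real j)"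

lemma growth_weight_simps [simp]:
  "growth_weight \<kappa> 0 = 1" "growth_weight \<kappa> (Suc 0) = 1"
  "1 \<le> s \<Longrightarrow> growth_weight \<kappa> (Suc s) = growth_weight \<kappa> s * (1 - \<kappa> / real s)"
  by (auto simp: growth_weight_def)

lemma growth_weight_nonneg: "\<kappa> \<le> 1 \<Longrightarrow> 0 \<le> growth_weight \<kappa> s"
  unfolding growth_weight_def by (intro prod_nonneg) (auto simp: field_simps)

lemma growth_weight_minus_one: "1 \<le> s \<Longrightarrow> growth_weight (-1) s = real s"
  by (induction s rule: dec_induct) (auto simp: field_simps)

lemma growth_weight_half: "1 \<le> s \<Longrightarrow> 1 / (2 * sqrt (real s)) \<le> growth_weight (1/2) s"
proof -
  \<comment> \<open>The bound \<open>1 / (4 * s)\<close> on the square is not inductive. The shifted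
    one, valid from \<open>s = 2\<close> on, is:
    \<open>1 / (4 * (s - 1)) * (1 - 1 / s) = 1 / (4 * s)\<close>.\<close>
  have sq: "1 / (4 * real s) \<le> (growth_weight (1/2) s)\<^sup>2 \<and> (s \<ge> 2 \<longrightarrow> 1 / (4 * (real s - 1)) \<le> (growth_weight (1/2) s)\<^sup>2)"
    if "1 \<le> s" using that
  proof (induction s rule: dec_induct)
    case (step s)
    have "1 / (4 * real s) \<le> (growth_weight (1/2) (Suc s))\<^sup>2"
    proof (cases "s = 1")
      case True
      then show ?thesis by (simp add: power2_eq_square)
    next
      case False
      then have s: "2 \<le> s" using step by simp
      have "1 / (4 * real s) = 1 / (4 * (real s - 1)) * (1 - 1 / real s)"
        using s by (simp add: field_simps)
      also have "\<dots> \<le> (growth_weight (1/2) s)\<^sup>2 * (1 - (1/2) / real s)\<^sup>2"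
      proof (rule mult_mono)
        show "1 / (4 * (real s - 1)) \<le> (growth_weight (1/2) s)\<^sup>2" using step s by simp
        have "(1 - (1/2) / real s)\<^sup>2 = 1 - 1 / real s + ((1/2) / real s)\<^sup>2"
          by (simp add: power2_eq_square algebra_simps)
        then show "1 - 1 / real s \<le> (1 - (1/2) / real s)\<^sup>2" by simp
      qed (use s in auto)
      also have "\<dots> = (growth_weight (1/2) (Suc s))\<^sup>2" using step by (simp add: power_mult_distrib)
      finally show ?thesis .
    qed
    moreover have "1 / (4 * real (Suc s)) \<le> 1 / (4 * real s)" using step by (simp add: field_simps)
    ultimately show ?case by auto
  qed simp
  assume s: "1 \<le> s"
  have "(1 / (2 * sqrt (real s)))\<^sup>2 \<le> (growth_weight (1/2) s)\<^sup>2"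
    using sq[OF s] by (simp add: power_divide power_mult_distrib)
  then show ?thesis by (rule power2_le_imp_le) (simp add: growth_weight_nonneg)
qed

context positive_CRP
begin

section \<open>The clock split at the opening of a table\<close>

definition wait :: "nat \<Rightarrow> nat \<Rightarrow> 'a \<Rightarrow> real" where
  "wait i n \<omega> = (\<Sum>k<n. if S i k \<omega> = 0 then 1 / rate k \<omega> else 0)"

definition age :: "nat \<Rightarrow> nat \<Rightarrow> 'a \<Rightarrow> real" where
  "age i n \<omega> = (\<Sum>k<n. if S i k \<omega> = 0 then 0 else 1 / rate k \<omega>)"

lemma rate_history [measurable (raw)]:
  assumes "k \<le> n" shows "rate k \<in> borel_measurable (Hist n)"
proof -
  have "(\<lambda>\<omega>. \<theta> + (\<Sum>i = 1..Suc k. W i \<omega> * real (S i k \<omega>))) \<in> borel_measurable (Hist n)"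
  proof (intro borel_measurable_add borel_measurable_const borel_measurable_sum borel_measurable_times)
    fix i assume i: "i \<in> {1..Suc k}"
    show "W i \<in> borel_measurable (Hist n)" using i by (intro W_history) auto
    show "(\<lambda>\<omega>. real (S i k \<omega>)) \<in> borel_measurable (Hist n)"
      by (rule measurable_compose[OF S_history]) (use i assms in auto)
  qed
  then show ?thesis by (simp add: rate_def[abs_def])
qed

lemma S_zero_history: "1 \<le> i \<Longrightarrow> k \<le> n \<Longrightarrow> {\<omega> \<in> space (Hist n). S i k \<omega> = 0} \<in> sets (Hist n)"
  using measurable_sets[OF S_history, of i k n "{0}"] by (simp add: vimage_def Int_def conj_commute del: space_history)

text \<open>The index may be one ahead of the history: \<open>wait i (Suc n)\<close> uses only
  configurations up to time \<open>n\<close>. This predictability lets the exponential factors be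
  treated as known in a one-step estimate.\<close>

lemma wait_history: "1 \<le> i \<Longrightarrow> m \<le> Suc n \<Longrightarrow> wait i m \<in> borel_measurable (Hist n)"
  unfolding wait_def[abs_def]
  by (intro borel_measurable_sum measurable_If borel_measurable_divide borel_measurable_const rate_history S_zero_history) auto

lemma age_history: "1 \<le> i \<Longrightarrow> m \<le> Suc n \<Longrightarrow> age i m \<in> borel_measurable (Hist n)"
  unfolding age_def[abs_def]
  by (intro borel_measurable_sum measurable_If borel_measurable_divide borel_measurable_const rate_history S_zero_history) auto

lemma ntables_history: "(\<lambda>\<omega>. real (ntables n \<omega>)) \<in> borel_measurable (Hist n)"
proof -
  have eq: "real (ntables n \<omega>) = (\<Sum>i=1..Suc n. if S i n \<omega> = 0 then 0 else 1)" for \<omega>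
  proof -
    have "(\<Sum>i=1..Suc n. if S i n \<omega> = 0 then 0 else 1::real) = (\<Sum>i\<in>{i \<in> {1..Suc n}. S i n \<omega> \<noteq> 0}. 1)"
      by (rule sum.mono_neutral_cong_right) auto
    then show ?thesis by (simp add: ntables_def)
  qed
  show ?thesis unfolding eq
    by (intro borel_measurable_sum measurable_If borel_measurable_const S_zero_history) auto
qed

lemma wait_plus_age: "wait i n \<omega> + age i n \<omega> = (\<Sum>k<n. 1 / rate k \<omega>)"
  unfolding wait_def age_def sum.distrib[symmetric] by (rule sum.cong) auto

text \<open>Joining multiplies \<open>growth_weight\<close> by \<open>1 - \<kappa> / s\<close> and
  has probability \<open>W i * s / rate n\<close>, so the mean relative change is \<open>- x\<close>
  with \<open>x = \<kappa> * W i / rate n\<close>, whatever \<open>s\<close> is. The clock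
  contributes \<open>exp x\<close>, and \<open>exp x * (1 - x) \<le> 1\<close>. The value
  \<open>\<kappa> = -1\<close> bounds sizes from above, \<open>\<kappa> = 1/2\<close> from
  below.\<close>

lemma growth_supermartingale:
  assumes i: "1 \<le> i" and \<kappa>: "\<kappa> \<le> 1"
  shows "(\<integral>\<^sup>+\<omega>. ennreal (growth_weight \<kappa> (S i n \<omega>) * exp (\<kappa> * W i \<omega> * age i n \<omega>)) \<partial>P) \<le> 1"
proof (induction n)
  case 0
  have "(\<integral>\<^sup>+\<omega>. ennreal (growth_weight \<kappa> (S i 0 \<omega>) * exp (\<kappa> * W i \<omega> * age i 0 \<omega>)) \<partial>P) = (\<integral>\<^sup>+\<omega>. 1 \<partial>P)"
  proof (rule nn_integral_cong_AE)
    show "AE \<omega> in P. ennreal (growth_weight \<kappa> (S i 0 \<omega>) * exp (\<kappa> * W i \<omega> * age i 0 \<omega>)) = 1"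
      using S_initial
    proof eventually_elim
      case (elim \<omega>)
      then have "S i 0 \<omega> = 0 \<or> S i 0 \<omega> = 1" using i by (cases "i = 1") auto
      then show ?case by (auto simp: age_def)
    qed
  qed
  then show ?case by (simp add: emeasure_space_1)
next
  case (Suc n)
  let ?J = "joins_table P S n i"
  define h0 where "h0 \<omega> = growth_weight \<kappa> (S i n \<omega>) * exp (\<kappa> * W i \<omega> * age i (Suc n) \<omega>)" for \<omega>
  \<comment> \<open>At an empty table the branches coincide: its age stands still, and opening
    changes the size from 0 to 1, where \<open>growth_weight\<close> is 1 at both.\<close>
  define h1 where "h1 \<omega> = (if S i n \<omega> = 0 then h0 \<omega>
     else growth_weight \<kappa> (Suc (S i n \<omega>)) * exp (\<kappa> * W i \<omega> * age i (Suc n) \<omega>))" for \<omega>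
  have m: "(\<lambda>\<omega>. f (S i n \<omega>)) \<in> borel_measurable (Hist n)" for f :: "nat \<Rightarrow> real"
    using S_history[OF i order_refl, of n] by (rule measurable_compose) simp
  have e: "(\<lambda>\<omega>. exp (\<kappa> * W i \<omega> * age i (Suc n) \<omega>)) \<in> borel_measurable (Hist n)"
    using W_history[OF i, of n] age_history[OF i order_refl, of n] by measurable
  have m0: "h0 \<in> borel_measurable (Hist n)"
    unfolding h0_def[abs_def] by (intro borel_measurable_times m e)
  have m1: "h1 \<in> borel_measurable (Hist n)"
    unfolding h1_def[abs_def]
    by (intro measurable_If borel_measurable_times m m0 e S_zero_history[OF i]
        m[of "\<lambda>s. growth_weight \<kappa> (Suc s)"]) auto
  have "(\<integral>\<^sup>+\<omega>. ennreal (growth_weight \<kappa> (S i (Suc n) \<omega>) * exp (\<kappa> * W i \<omega> * age i (Suc n) \<omega>)) \<partial>P)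
     \<le> (\<integral>\<^sup>+\<omega>. ennreal (growth_weight \<kappa> (S i n \<omega>) * exp (\<kappa> * W i \<omega> * age i n \<omega>)) \<partial>P)"
  proof (rule nn_integral_branch_le[OF subalgebra_history joins_event[OF i] m0 m1,
      where p = "\<lambda>\<omega>. W i \<omega> * real (S i n \<omega>) / rate n \<omega>"])
    show "0 \<le> h0 \<omega>" "0 \<le> h1 \<omega>" for \<omega>
      by (simp_all add: h0_def h1_def growth_weight_nonneg[OF \<kappa>] del: growth_weight_simps)
    show "AE \<omega> in P. h0 \<omega> \<noteq> h1 \<omega> \<longrightarrow> real_cond_exp P (Hist n) (indicator ?J) \<omega> = W i \<omega> * real (S i n \<omega>) / rate n \<omega>"
      using join_transition[of i n] AE_regular
    proof eventually_elim
      case (elim \<omega>)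
      show ?case
      proof
        assume "h0 \<omega> \<noteq> h1 \<omega>"
        then have "S i n \<omega> \<noteq> 0" unfolding h1_def by presburger
        then have "i \<le> last_table S n \<omega>" using regular_S_eq_0[OF elim(2) i] regular_ntables(5)[OF elim(2)] by simp
        then show "real_cond_exp P (Hist n) (indicator ?J) \<omega> = W i \<omega> * real (S i n \<omega>) / rate n \<omega>"
          using elim(1) i regular_rate(1)[OF elim(2)] by simp
      qed
    qed
    show "AE \<omega> in P. growth_weight \<kappa> (S i (Suc n) \<omega>) * exp (\<kappa> * W i \<omega> * age i (Suc n) \<omega>)
        = (if \<omega> \<in> ?J then h1 \<omega> else h0 \<omega>)"
      using AE_regular
    proof eventually_elim
      case (elim \<omega>)
      note E = regular_S_Suc[OF elim i, of n]
      show ?case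
      proof (cases "S i n \<omega> = 0")
        case True
        have "growth_weight \<kappa> (S i (Suc n) \<omega>) = 1" unfolding E if_P[OF True] by simp
        then show ?thesis using True by (simp add: h0_def h1_def)
      next
        case False
        have "S i (Suc n) \<omega> = (if \<omega> \<in> ?J then Suc (S i n \<omega>) else S i n \<omega>)"
          unfolding E if_not_P[OF False] ..
        then show ?thesis unfolding h0_def h1_def using False by (cases "\<omega> \<in> ?J") simp_all
      qed
    qed
    show "AE \<omega> in P. h0 \<omega> + (h1 \<omega> - h0 \<omega>) * (W i \<omega> * real (S i n \<omega>) / rate n \<omega>)
        \<le> growth_weight \<kappa> (S i n \<omega>) * exp (\<kappa> * W i \<omega> * age i n \<omega>)"
      using AE_regular
    proof eventually_elim
      case (elim \<omega>)
      show ?case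
      proof (cases "S i n \<omega> = 0")
        case True
        then show ?thesis by (simp add: h0_def h1_def age_def)
      next
        case False
        let ?s = "S i n \<omega>" and ?x = "\<kappa> * W i \<omega> / rate n \<omega>"
        have s: "real ?s > 0" "1 \<le> ?s" using False by auto
        have "rate n \<omega> > 0" using regular_rate(2)[OF elim, of n] theta_pos by simp
        have age: "exp (\<kappa> * W i \<omega> * age i (Suc n) \<omega>) = exp (\<kappa> * W i \<omega> * age i n \<omega>) * exp ?x"
        proof -
          have "\<kappa> * W i \<omega> * age i (Suc n) \<omega> = \<kappa> * W i \<omega> * age i n \<omega> + ?x"
            using False by (simp add: age_def distrib_left)
          then show ?thesis by (simp only: exp_add)
        qed
        have "h0 \<omega> + (h1 \<omega> - h0 \<omega>) * (W i \<omega> * real ?s / rate n \<omega>)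
          = growth_weight \<kappa> ?s * exp (\<kappa> * W i \<omega> * age i n \<omega>) * (exp ?x * (1 - ?x))"
        proof -
          have "h1 \<omega> - h0 \<omega> = - (growth_weight \<kappa> ?s * exp (\<kappa> * W i \<omega> * age i n \<omega>) * exp ?x * (\<kappa> / real ?s))"
            unfolding h0_def h1_def age if_not_P[OF False] growth_weight_simps(3)[OF s(2)]
            by (simp only: ring_distribs mult.assoc) simp
          moreover have "(\<kappa> / real ?s) * (W i \<omega> * real ?s / rate n \<omega>) = ?x" using s by simp
          ultimately show ?thesis unfolding h0_def age by (simp only:) algebra
        qed
        also have "\<dots> \<le> growth_weight \<kappa> ?s * exp (\<kappa> * W i \<omega> * age i n \<omega>) * (exp ?x * exp (- ?x))"
          using exp_ge_add_one_self[of "- ?x"]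
          by (intro mult_left_mono mult_nonneg_nonneg growth_weight_nonneg[OF \<kappa>]) auto
        also have "exp ?x * exp (- ?x) = 1" by (simp add: exp_add[symmetric])
        finally show ?thesis by simp
      qed
    qed
  qed
  with Suc show ?case by (rule order_trans[rotated])
qed

text \<open>This is the exponential supermartingale of a Poisson process of intensity
  \<open>\<theta>\<close>, stopped when table \<open>i\<close> opens, since
  \<open>min (ntables n) i\<close> and \<open>wait i n\<close> both freeze then. The bound is
  \<open>exp l\<close> instead of 1 because one table is open at the start. Small \<open>l\<close>
  of either sign gives sharp bounds on \<open>wait\<close>.\<close>

lemma ntables_supermartingale:
  assumes i: "1 \<le> i"
  shows "(\<integral>\<^sup>+\<omega>. ennreal (exp (l * real (min (ntables n \<omega>) i) - (exp l - 1) * \<theta> * wait i n \<omega>)) \<partial>P) \<le> ennreal (exp l)"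
proof (induction n)
  case 0
  have "(\<integral>\<^sup>+\<omega>. ennreal (exp (l * real (min (ntables 0 \<omega>) i) - (exp l - 1) * \<theta> * wait i 0 \<omega>)) \<partial>P) = (\<integral>\<^sup>+\<omega>. ennreal (exp l) \<partial>P)"
  proof (rule nn_integral_cong_AE)
    show "AE \<omega> in P. ennreal (exp (l * real (min (ntables 0 \<omega>) i) - (exp l - 1) * \<theta> * wait i 0 \<omega>)) = ennreal (exp l)"
      using AE_regular
    proof eventually_elim
      case (elim \<omega>)
      have "ntables 0 \<omega> = 1" using regular_ntables(1,2)[OF elim, of 0] by simp
      then show ?case using i by (simp add: wait_def)
    qed
  qed
  then show ?case by (simp add: emeasure_space_1)
next
  case (Suc n)
  let ?J = "opens_table P S n" and ?c = "(exp l - 1) * \<theta>"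
  define h0 where "h0 \<omega> = exp (l * min (real (ntables n \<omega>)) (real i) - ?c * wait i (Suc n) \<omega>)" for \<omega>
  define h1 where "h1 \<omega> = (if S i n \<omega> = 0 then h0 \<omega> * exp l else h0 \<omega>)" for \<omega>
  have m0: "h0 \<in> borel_measurable (Hist n)"
    unfolding h0_def[abs_def] using ntables_history[of n] wait_history[OF i order_refl, of n] by measurable
  have m1: "h1 \<in> borel_measurable (Hist n)"
    unfolding h1_def[abs_def]
    by (intro measurable_If borel_measurable_times borel_measurable_const m0 S_zero_history[OF i]) auto
  have "(\<integral>\<^sup>+\<omega>. ennreal (exp (l * real (min (ntables (Suc n) \<omega>) i) - ?c * wait i (Suc n) \<omega>)) \<partial>P)
     \<le> (\<integral>\<^sup>+\<omega>. ennreal (exp (l * real (min (ntables n \<omega>) i) - ?c * wait i n \<omega>)) \<partial>P)"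
  proof (rule nn_integral_branch_le[OF subalgebra_history opens_event m0 m1, where p = "\<lambda>\<omega>. \<theta> / rate n \<omega>"])
    show "0 \<le> h0 \<omega>" "0 \<le> h1 \<omega>" for \<omega> by (simp_all add: h0_def h1_def)
    show "AE \<omega> in P. h0 \<omega> \<noteq> h1 \<omega> \<longrightarrow> real_cond_exp P (Hist n) (indicator ?J) \<omega> = \<theta> / rate n \<omega>"
      using open_transition[of n] AE_regular by eventually_elim (simp add: regular_rate(1))
    show "AE \<omega> in P. exp (l * real (min (ntables (Suc n) \<omega>) i) - ?c * wait i (Suc n) \<omega>)
        = (if \<omega> \<in> ?J then h1 \<omega> else h0 \<omega>)"
      using AE_regular
    proof eventually_elim
      case (elim \<omega>)
      have K: "ntables (Suc n) \<omega> = (if \<omega> \<in> ?J then Suc (ntables n \<omega>) else ntables n \<omega>)"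
        by (rule regular_ntables_Suc[OF elim])
      show ?case
      proof (cases "\<omega> \<in> ?J")
        case False
        then show ?thesis using K by (simp add: h0_def of_nat_min)
      next
        case J: True
        show ?thesis
        proof (cases "S i n \<omega> = 0")
          case True
          then have "ntables n \<omega> < i" using regular_S_eq_0[OF elim i] by simp
          then have "real (min (ntables (Suc n) \<omega>) i) = real (ntables n \<omega>) + 1"
            "min (real (ntables n \<omega>)) (real i) = real (ntables n \<omega>)" using K J by auto
          then show ?thesis using True J unfolding h1_def h0_def
            by (simp add: exp_add[symmetric] distrib_left)
        next
          case False
          then have "i \<le> ntables n \<omega>" using regular_S_eq_0[OF elim i, of n] by simp
          then have "real (min (ntables (Suc n) \<omega>) i) = real i"
            "min (real (ntables n \<omega>)) (real i) = real i" using K J by auto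
          then show ?thesis using False J unfolding h1_def h0_def by simp
        qed
      qed
    qed
    show "AE \<omega> in P. h0 \<omega> + (h1 \<omega> - h0 \<omega>) * (\<theta> / rate n \<omega>)
        \<le> exp (l * real (min (ntables n \<omega>) i) - ?c * wait i n \<omega>)"
      using AE_regular
    proof eventually_elim
      case (elim \<omega>)
      show ?case
      proof (cases "S i n \<omega> = 0")
        case False
        then show ?thesis by (simp add: h0_def h1_def wait_def of_nat_min)
      next
        case True
        let ?x = "?c / rate n \<omega>" and ?e = "exp (l * real (min (ntables n \<omega>) i) - ?c * wait i n \<omega>)"
        have "h0 \<omega> = ?e * exp (- ?x)"
        proof -
          have "?c * wait i (Suc n) \<omega> = ?c * wait i n \<omega> + ?x"
            using True by (simp add: wait_def distrib_left)
          then show ?thesis unfolding h0_def of_nat_min by (simp add: exp_add[symmetric])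
        qed
        moreover have "h1 \<omega> = h0 \<omega> * exp l" using True by (simp add: h1_def)
        moreover have "(exp l - 1) * (\<theta> / rate n \<omega>) = ?x" by simp
        ultimately have "h0 \<omega> + (h1 \<omega> - h0 \<omega>) * (\<theta> / rate n \<omega>) = ?e * (exp (- ?x) * (1 + ?x))"
          by (simp only:) algebra
        also have "\<dots> \<le> ?e * (exp (- ?x) * exp ?x)"
          by (intro mult_left_mono exp_ge_add_one_self) auto
        also have "\<dots> = ?e" by (simp add: exp_add[symmetric])
        finally show ?thesis .
      qed
    qed
  qed
  with Suc show ?case by (rule order_trans[rotated])
qed

end

section \<open>Separation of the finishing times\<close>

lemma card_nat_open_interval:
  fixes c h :: real and J :: "nat set"
  assumes "\<And>j. j \<in> J \<Longrightarrow> \<bar>real j - c\<bar> < h" "finite J" "0 \<le> h"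
  shows "real (card J) \<le> 2 * h + 1"
proof (cases "J = {}")
  case False
  define a b where "a = Min J" and "b = Max J"
  have ab: "a \<in> J" "b \<in> J" "J \<subseteq> {a..b}" using False assms by (auto simp: a_def b_def)
  then have "card J \<le> card {a..b}" by (intro card_mono) auto
  also have "\<dots> = Suc b - a" by simp
  finally have "card J \<le> Suc b - a" .
  moreover have "a \<le> b" using ab by auto
  ultimately have "real (card J) \<le> real b - real a + 1" by linarith
  then show ?thesis using assms(1)[OF ab(1)] assms(1)[OF ab(2)] by linarith
qed (use assms in simp)

lemma (in prob_space) indep_vars_pair:
  assumes "indep_vars M' X I" "i \<in> I" "j \<in> I" "i \<noteq> j"
  shows "indep_var (M' i) (X i) (M' j) (X j)"
proof -
  have "indep_var (PiM {i} M') (\<lambda>\<omega>. restrict (\<lambda>k. X k \<omega>) {i}) (PiM {j} M') (\<lambda>\<omega>. restrict (\<lambda>k. X k \<omega>) {j})"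
    by (rule indep_var_restrict[OF assms(1)]) (use assms in auto)
  then have "indep_var (M' i) ((\<lambda>f. f i) \<circ> (\<lambda>\<omega>. restrict (\<lambda>k. X k \<omega>) {i})) (M' j) ((\<lambda>f. f j) \<circ> (\<lambda>\<omega>. restrict (\<lambda>k. X k \<omega>) {j}))"
    by (rule indep_var_compose) (auto intro!: measurable_component_singleton)
  moreover have "(\<lambda>f. f i) \<circ> (\<lambda>\<omega>. restrict (\<lambda>k. X k \<omega>) {i}) = X i" "(\<lambda>f. f j) \<circ> (\<lambda>\<omega>. restrict (\<lambda>k. X k \<omega>) {j}) = X j"
    by (auto simp: fun_eq_iff)
  ultimately show ?thesis by simp
qed

context positive_CRP
begin

section \<open>The weights as an independent sample\<close>

lemma sets_mu: "sets \<mu> = sets borel"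
  using weights_distr[of 1] by (metis le_refl sets_distr)

lemma prob_space_mu: "prob_space \<mu>"
  using weights_distr[of 1] prob_space_distr[OF W_measurable[of 1]] by simp

lemma prob_all_light:
  "prob {\<omega> \<in> space P. \<forall>i\<in>{1..N}. W i \<omega> < b} = (1 - measure \<mu> {b..}) ^ N"
proof -
  interpret mu: prob_space \<mu> by (rule prob_space_mu)
  have one: "prob (W i -` {..<b} \<inter> space P) = 1 - measure \<mu> {b..}" if "1 \<le> i" for i
  proof -
    have "prob (W i -` {..<b} \<inter> space P) = measure (distr P borel (W i)) {..<b}"
      using W_measurable[OF that] by (simp add: measure_distr)
    also have "\<dots> = measure \<mu> {..<b}" by (simp add: weights_distr[OF that])
    also have "\<dots> = measure \<mu> (space \<mu> - {b..})"
      using sets_eq_imp_space_eq[OF sets_mu] by (intro arg_cong[where f = "measure \<mu>"]) auto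
    also have "\<dots> = 1 - measure \<mu> {b..}" by (rule mu.prob_compl) (simp add: sets_mu)
    finally show ?thesis .
  qed
  show ?thesis
  proof (cases "N = 0")
    case True
    then show ?thesis by (simp add: prob_space)
  next
    case False
    have "{\<omega> \<in> space P. \<forall>i\<in>{1..N}. W i \<omega> < b} = (\<Inter>i\<in>{1..N}. W i -` {..<b} \<inter> space P)"
      using False by auto
    also have "prob \<dots> = (\<Prod>i\<in>{1..N}. prob (W i -` {..<b} \<inter> space P))"
      by (rule indep_varsD[OF weights_indep]) (use False in auto)
    also have "\<dots> = (\<Prod>i\<in>{1..N}. 1 - measure \<mu> {b..})" by (rule prod.cong) (use one in auto)
    finally show ?thesis by simp
  qed
qed

text \<open>A set of weight pairs rather than an event, so that by independence its probability is
  its measure under the product of \<open>\<mu>\<close> with itself, where the indices can be summed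
  pointwise.\<close>

definition close_pair :: "real \<Rightarrow> real \<Rightarrow> real \<Rightarrow> nat \<Rightarrow> nat \<Rightarrow> (real \<times> real) set" where
  "close_pair L g b i j = {(x, y). b \<le> x \<and> b \<le> y \<and>
     \<bar>(real i / \<theta> + L / x) - (real j / \<theta> + L / y)\<bar> < g}"

lemma close_pair_measurable: "close_pair L g b i j \<in> sets (borel \<Otimes>\<^sub>M borel)"
proof -
  have "Measurable.pred (borel \<Otimes>\<^sub>M borel) (\<lambda>p :: real \<times> real. b \<le> fst p \<and> b \<le> snd p \<and>
     \<bar>(real i / \<theta> + L / fst p) - (real j / \<theta> + L / snd p)\<bar> < g)"
    by measurable
  then show ?thesis
    by (simp add: pred_def close_pair_def space_pair_measure case_prod_unfold)
qed

text \<open>The sum over pairs is taken inside the integral over the weights, where it is bounded by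
  counting. What is left to integrate is the indicator that both weights are at least
  \<open>b\<close>, which gives the squared tail mass.\<close>

lemma prob_close_pair:
  assumes g: "0 \<le> g"
  shows "prob (\<Union>(i, j)\<in>{(i, j). i \<in> {1..r} \<and> j \<in> {1..r} \<and> i \<noteq> j}.
      {\<omega> \<in> space P. (W i \<omega>, W j \<omega>) \<in> close_pair L g b i j})
    \<le> real r * (2 * \<theta> * g + 1) * (measure \<mu> {b..})\<^sup>2"
proof -
  interpret mu: prob_space \<mu> by (rule prob_space_mu)
  interpret mm: pair_prob_space \<mu> \<mu> ..
  define I where "I = {(i, j). i \<in> {1..r} \<and> j \<in> {1..r} \<and> i \<noteq> j}"
  define E where "E = (\<lambda>(i, j). {\<omega> \<in> space P. (W i \<omega>, W j \<omega>) \<in> close_pair L g b i j})"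
  have smm: "sets (\<mu> \<Otimes>\<^sub>M \<mu>) = sets (borel \<Otimes>\<^sub>M borel)"
    by (intro sets_pair_measure_cong sets_mu)
  have fI: "finite I" by (rule finite_subset[of _ "{1..r} \<times> {1..r}"]) (auto simp: I_def)
  have E: "E p = (\<lambda>\<omega>. (W (fst p) \<omega>, W (snd p) \<omega>)) -` close_pair L g b (fst p) (snd p) \<inter> space P" for p
    by (auto simp: E_def split: prod.splits)
  have mp: "(\<lambda>\<omega>. (W (fst p) \<omega>, W (snd p) \<omega>)) \<in> measurable P (borel \<Otimes>\<^sub>M borel)" if "p \<in> I" for p
    using that W_measurable by (auto simp: I_def intro!: measurable_Pair)
  have Ee: "E p \<in> events" if "p \<in> I" for p
    unfolding E by (rule measurable_sets[OF mp[OF that] close_pair_measurable])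
  have eq: "emeasure P (E p) = emeasure (\<mu> \<Otimes>\<^sub>M \<mu>) (close_pair L g b (fst p) (snd p))" if "p \<in> I" for p
  proof -
    have ij: "fst p \<in> {1..}" "snd p \<in> {1..}" "fst p \<noteq> snd p" using that by (auto simp: I_def)
    have "distr P borel (W (fst p)) \<Otimes>\<^sub>M distr P borel (W (snd p))
      = distr P (borel \<Otimes>\<^sub>M borel) (\<lambda>\<omega>. (W (fst p) \<omega>, W (snd p) \<omega>))"
      using indep_vars_pair[OF weights_indep ij] unfolding indep_var_distribution_eq by blast
    then have "distr P (borel \<Otimes>\<^sub>M borel) (\<lambda>\<omega>. (W (fst p) \<omega>, W (snd p) \<omega>)) = \<mu> \<Otimes>\<^sub>M \<mu>"
      using ij by (simp add: weights_distr)
    then show ?thesis unfolding E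
      using emeasure_distr[OF mp[OF that] close_pair_measurable] by simp
  qed
  have count: "(\<Sum>p\<in>I. indicator (close_pair L g b (fst p) (snd p)) (x, y))
      \<le> ennreal (real r * (2 * \<theta> * g + 1)) * indicator ({b..} \<times> {b..}) (x, y)" for x y
  proof (cases "b \<le> x \<and> b \<le> y")
    case False
    then have "indicator (close_pair L g b (fst p) (snd p)) (x, y) = (0::ennreal)" for p
      by (auto simp: close_pair_def)
    then show ?thesis by simp
  next
    case True
    \<comment> \<open>For fixed \<open>i\<close>, \<open>x\<close>, \<open>y\<close> the condition
      confines \<open>j\<close> to an open interval of half-width
      \<open>\<theta> * g\<close>.\<close>
    have c1: "card {j \<in> {1..r}. \<bar>(real i / \<theta> + L / x) - (real j / \<theta> + L / y)\<bar> < g} \<le> 2 * (\<theta> * g) + 1" for i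
    proof (rule card_nat_open_interval[where c = "\<theta> * (real i / \<theta> + L / x - L / y)"])
      fix j assume "j \<in> {j \<in> {1..r}. \<bar>(real i / \<theta> + L / x) - (real j / \<theta> + L / y)\<bar> < g}"
      then have "\<theta> * \<bar>(real i / \<theta> + L / x) - (real j / \<theta> + L / y)\<bar> < \<theta> * g" using theta_pos by simp
      also have "\<theta> * \<bar>(real i / \<theta> + L / x) - (real j / \<theta> + L / y)\<bar> = \<bar>\<theta> * ((real i / \<theta> + L / x) - (real j / \<theta> + L / y))\<bar>"
        using theta_pos by (simp add: abs_mult)
      also have "\<theta> * ((real i / \<theta> + L / x) - (real j / \<theta> + L / y)) = \<theta> * (real i / \<theta> + L / x - L / y) - real j"
        using theta_pos by (simp add: algebra_simps)
      finally show "\<bar>real j - \<theta> * (real i / \<theta> + L / x - L / y)\<bar> < \<theta> * g" by (simp add: abs_minus_commute)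
    qed (use g theta_pos in auto)
    have "(\<Sum>p\<in>I. indicator (close_pair L g b (fst p) (snd p)) (x, y) :: real)
      \<le> (\<Sum>p\<in>{1..r} \<times> {1..r}. indicator (close_pair L g b (fst p) (snd p)) (x, y))"
      by (rule sum_mono2) (auto simp: I_def)
    also have "\<dots> = (\<Sum>i\<in>{1..r}. \<Sum>j\<in>{1..r}. indicator (close_pair L g b i j) (x, y))"
      by (simp add: sum.cartesian_product case_prod_unfold)
    also have "\<dots> = (\<Sum>i\<in>{1..r}. real (card {j \<in> {1..r}. \<bar>(real i / \<theta> + L / x) - (real j / \<theta> + L / y)\<bar> < g}))"
    proof (rule sum.cong)
      fix i
      have "(\<Sum>j\<in>{1..r}. indicator (close_pair L g b i j) (x, y)) =
        (\<Sum>j\<in>{j \<in> {1..r}. \<bar>(real i / \<theta> + L / x) - (real j / \<theta> + L / y)\<bar> < g}. 1 :: real)"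
        by (rule sum.mono_neutral_cong_right) (use True in \<open>auto simp: close_pair_def\<close>)
      then show "(\<Sum>j\<in>{1..r}. indicator (close_pair L g b i j) (x, y)) =
        real (card {j \<in> {1..r}. \<bar>(real i / \<theta> + L / x) - (real j / \<theta> + L / y)\<bar> < g})" by simp
    qed simp
    also have "\<dots> \<le> (\<Sum>i\<in>{1..r}. 2 * (\<theta> * g) + 1)" using c1 by (intro sum_mono) auto
    finally have "(\<Sum>p\<in>I. indicator (close_pair L g b (fst p) (snd p)) (x, y) :: real) \<le> real r * (2 * \<theta> * g + 1)"
      by (simp add: mult.assoc)
    then have "ennreal (\<Sum>p\<in>I. indicator (close_pair L g b (fst p) (snd p)) (x, y)) \<le> ennreal (real r * (2 * \<theta> * g + 1))"
      by (rule ennreal_leI)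
    then show ?thesis using True by (simp add: sum_ennreal[symmetric] ennreal_indicator)
  qed
  have "emeasure P (\<Union>p\<in>I. E p) \<le> (\<Sum>p\<in>I. emeasure P (E p))"
    using fI Ee by (intro emeasure_subadditive_finite) auto
  also have "\<dots> = (\<Sum>p\<in>I. \<integral>\<^sup>+z. indicator (close_pair L g b (fst p) (snd p)) z \<partial>(\<mu> \<Otimes>\<^sub>M \<mu>))"
    by (rule sum.cong) (simp_all add: eq smm close_pair_measurable)
  also have "\<dots> = (\<integral>\<^sup>+z. (\<Sum>p\<in>I. indicator (close_pair L g b (fst p) (snd p)) z) \<partial>(\<mu> \<Otimes>\<^sub>M \<mu>))"
    by (intro nn_integral_sum[symmetric] borel_measurable_indicator) (simp add: smm close_pair_measurable)
  also have "\<dots> \<le> (\<integral>\<^sup>+z. ennreal (real r * (2 * \<theta> * g + 1)) * indicator ({b..} \<times> {b..}) z \<partial>(\<mu> \<Otimes>\<^sub>M \<mu>))"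
    by (rule nn_integral_mono) (use count in auto)
  also have "\<dots> = ennreal (real r * (2 * \<theta> * g + 1)) * emeasure (\<mu> \<Otimes>\<^sub>M \<mu>) ({b..} \<times> {b..})"
    by (rule nn_integral_cmult_indicator) (simp add: smm)
  also have "emeasure (\<mu> \<Otimes>\<^sub>M \<mu>) ({b..} \<times> {b..}) = ennreal ((measure \<mu> {b..})\<^sup>2)"
    by (subst mu.emeasure_pair_measure_Times) (simp_all add: sets_mu mu.emeasure_eq_measure ennreal_mult power2_eq_square)
  also have "ennreal (real r * (2 * \<theta> * g + 1)) * \<dots> = ennreal (real r * (2 * \<theta> * g + 1) * (measure \<mu> {b..})\<^sup>2)"
    using g theta_pos by (intro ennreal_mult[symmetric]) auto
  finally have "emeasure P (\<Union>p\<in>I. E p) \<le> ennreal (real r * (2 * \<theta> * g + 1) * (measure \<mu> {b..})\<^sup>2)" .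
  then have "prob (\<Union>p\<in>I. E p) \<le> real r * (2 * \<theta> * g + 1) * (measure \<mu> {b..})\<^sup>2"
    using g theta_pos by (simp add: emeasure_eq_measure)
  then show ?thesis unfolding I_def E_def .
qed

text \<open>If one of the first \<open>N\<close> tables has \<open>1 / W i \<le> v1\<close>, it
  finishes by \<open>L * v2\<close>, hence so does the minimiser, whose reciprocal weight is then at
  most \<open>v2\<close>. A rival with reciprocal weight above \<open>v3\<close> finishes after
  \<open>L * v3\<close> and so respects the margin by itself. Only pairs of weights at least
  \<open>1 / v3\<close> have to be separated by \<open>close_pair\<close>.\<close>

lemma unique_minimiser:
  assumes v: "0 < v1" "v1 \<le> v2" "v2 < v3" and L: "0 < L" and g: "0 \<le> g" "g \<le> L * (v3 - v2)"
    and N: "real N / \<theta> \<le> L * (v2 - v1)" "N \<le> r"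
  obtains B where "B \<in> events"
    "prob B \<le> (1 - measure \<mu> {1 / v1..}) ^ N + real r * (2 * \<theta> * g + 1) * (measure \<mu> {1 / v3..})\<^sup>2"
    "\<And>\<omega>. regular \<omega> \<Longrightarrow> \<omega> \<notin> B \<Longrightarrow> \<exists>z\<in>{1..r}. real z / \<theta> + L / W z \<omega> \<le> L * v2 \<and>
       (\<forall>j\<in>{1..r}. j \<noteq> z \<longrightarrow> real z / \<theta> + L / W z \<omega> + g \<le> real j / \<theta> + L / W j \<omega>)"
proof -
  define I where "I = {(i, j). i \<in> {1..r} \<and> j \<in> {1..r} \<and> i \<noteq> j}"
  define B1 where "B1 = {\<omega> \<in> space P. \<forall>i\<in>{1..N}. W i \<omega> < 1 / v1}"
  define B2 where "B2 = (\<Union>(i, j)\<in>I. {\<omega> \<in> space P. (W i \<omega>, W j \<omega>) \<in> close_pair L g (1 / v3) i j})"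
  have B1: "B1 \<in> events"
  proof (cases "N = 0")
    case True
    then show ?thesis by (simp add: B1_def)
  next
    case False
    then have "B1 = (\<Inter>i\<in>{1..N}. W i -` {..<1 / v1} \<inter> space P)" by (auto simp: B1_def)
    also have "\<dots> \<in> events"
      by (rule sets.finite_INT) (use False W_measurable in \<open>auto intro!: measurable_sets\<close>)
    finally show ?thesis .
  qed
  have B2: "B2 \<in> events" unfolding B2_def
  proof (rule sets.finite_UN)
    show "finite I" by (rule finite_subset[of _ "{1..r} \<times> {1..r}"]) (auto simp: I_def)
    fix p assume "p \<in> I"
    then obtain i j where p: "p = (i, j)" "1 \<le> i" "1 \<le> j" by (auto simp: I_def)
    have "(\<lambda>\<omega>. (W i \<omega>, W j \<omega>)) \<in> measurable P (borel \<Otimes>\<^sub>M borel)"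
      using W_measurable p by (intro measurable_Pair) auto
    from measurable_sets[OF this close_pair_measurable[of L g "1 / v3" i j]]
    show "(case p of (i, j) \<Rightarrow> {\<omega> \<in> space P. (W i \<omega>, W j \<omega>) \<in> close_pair L g (1 / v3) i j}) \<in> events"
      by (simp add: p vimage_def Int_def conj_commute)
  qed
  show thesis
  proof
    show "B1 \<union> B2 \<in> events" using B1 B2 by auto
    have "prob (B1 \<union> B2) \<le> prob B1 + prob B2" by (rule measure_Un_le[OF B1 B2])
    moreover have "prob B1 = (1 - measure \<mu> {1 / v1..}) ^ N" unfolding B1_def by (rule prob_all_light)
    moreover have "prob B2 \<le> real r * (2 * \<theta> * g + 1) * (measure \<mu> {1 / v3..})\<^sup>2"
      unfolding B2_def I_def by (rule prob_close_pair[OF g(1)])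
    ultimately show "prob (B1 \<union> B2) \<le> (1 - measure \<mu> {1 / v1..}) ^ N + real r * (2 * \<theta> * g + 1) * (measure \<mu> {1 / v3..})\<^sup>2"
      by linarith
    fix \<omega> assume reg: "regular \<omega>" and nB: "\<omega> \<notin> B1 \<union> B2"
    have sp: "\<omega> \<in> space P" and Wp: "\<And>i. 1 \<le> i \<Longrightarrow> 0 < W i \<omega>" using reg by (auto simp: regular_def)
    define Z where "Z i = real i / \<theta> + L / W i \<omega>" for i
    obtain i where i: "i \<in> {1..N}" "1 / v1 \<le> W i \<omega>" using nB sp by (auto simp: B1_def not_less)
    then have ir: "i \<in> {1..r}" using N by auto
    have "1 / W i \<omega> \<le> v1" using i v Wp[of i] by (auto simp: field_simps)
    then have "L / W i \<omega> \<le> L * v1" using mult_left_mono[of "1 / W i \<omega>" v1 L] L by simp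
    moreover have "real i / \<theta> \<le> real N / \<theta>" using i theta_pos by (intro divide_right_mono) auto
    ultimately have Zi: "Z i \<le> L * v2" using N by (simp add: Z_def algebra_simps)
    obtain z where z: "z \<in> {1..r}" "\<And>j. j \<in> {1..r} \<Longrightarrow> Z z \<le> Z j"
      using ex_is_arg_min_if_finite[of "{1..r}" Z] ir by (auto simp: is_arg_min_linorder)
    have Zz: "Z z \<le> L * v2" using z(2)[OF ir] Zi by simp
    have Vz: "1 / v3 \<le> W z \<omega>"
    proof -
      have "0 \<le> real z / \<theta>" using theta_pos by simp
      then have "L / W z \<omega> \<le> L * v2" using Zz unfolding Z_def by linarith
      then have "1 / W z \<omega> \<le> v2" using L by (simp add: divide_inverse)
      then have "1 / W z \<omega> \<le> v3" using v by simp
      then show ?thesis using v Wp[of z] z by (auto simp: field_simps)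
    qed
    have "Z z + g \<le> Z j" if j: "j \<in> {1..r}" "j \<noteq> z" for j
    proof (cases "1 / v3 \<le> W j \<omega>")
      case True
      have "(z, j) \<in> I" using j z by (auto simp: I_def)
      then have "(W z \<omega>, W j \<omega>) \<notin> close_pair L g (1 / v3) z j" using nB sp by (auto simp: B2_def)
      then have "g \<le> \<bar>Z z - Z j\<bar>" using True Vz by (simp add: close_pair_def Z_def)
      then show ?thesis using z(2)[OF j(1)] by linarith
    next
      case False
      then have "v3 \<le> 1 / W j \<omega>" using v Wp[of j] j by (auto simp: field_simps)
      then have "L * v3 \<le> L / W j \<omega>" using mult_left_mono[of v3 "1 / W j \<omega>" L] L by simp
      moreover have "0 \<le> real j / \<theta>" using theta_pos by simp
      ultimately have "L * v3 \<le> Z j" unfolding Z_def by linarith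
      then show ?thesis using Zz g by (simp add: algebra_simps)
    qed
    then show "\<exists>z\<in>{1..r}. real z / \<theta> + L / W z \<omega> \<le> L * v2 \<and>
       (\<forall>j\<in>{1..r}. j \<noteq> z \<longrightarrow> real z / \<theta> + L / W z \<omega> + g \<le> real j / \<theta> + L / W j \<omega>)"
      using z(1) Zz unfolding Z_def by blast
  qed
qed

end

section \<open>Error probabilities\<close>

lemma (in prob_space) markov_union:
  fixes f :: "'i \<Rightarrow> 'a \<Rightarrow> real"
  assumes I: "finite I" and f: "\<And>i. i \<in> I \<Longrightarrow> f i \<in> borel_measurable M"
    and int: "\<And>i. i \<in> I \<Longrightarrow> (\<integral>\<^sup>+\<omega>. ennreal (f i \<omega>) \<partial>M) \<le> ennreal k" and y: "0 < y" "0 \<le> k"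
  shows "{\<omega> \<in> space M. \<exists>i\<in>I. y < f i \<omega>} \<in> events"
    and "prob {\<omega> \<in> space M. \<exists>i\<in>I. y < f i \<omega>} \<le> real (card I) * k / y"
proof -
  have E: "{\<omega> \<in> space M. y < f i \<omega>} \<in> events" if "i \<in> I" for i
    using f[OF that] by measurable
  have U: "{\<omega> \<in> space M. \<exists>i\<in>I. y < f i \<omega>} = (\<Union>i\<in>I. {\<omega> \<in> space M. y < f i \<omega>})" by auto
  show "{\<omega> \<in> space M. \<exists>i\<in>I. y < f i \<omega>} \<in> events" unfolding U using I E by auto
  have one: "prob {\<omega> \<in> space M. y < f i \<omega>} \<le> k / y" if i: "i \<in> I" for i
  proof -
    have [measurable]: "f i \<in> borel_measurable M" by (rule f[OF i])
    have "emeasure M {\<omega> \<in> space M. y < f i \<omega>} = (\<integral>\<^sup>+\<omega>. indicator {\<omega> \<in> space M. y < f i \<omega>} \<omega> \<partial>M)"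
      using E[OF i] by simp
    also have "\<dots> \<le> (\<integral>\<^sup>+\<omega>. ennreal (1 / y) * ennreal (f i \<omega>) \<partial>M)"
    proof (intro nn_integral_mono)
      fix \<omega>
      show "indicator {\<omega> \<in> space M. y < f i \<omega>} \<omega> \<le> ennreal (1 / y) * ennreal (f i \<omega>)"
      proof (cases "y < f i \<omega>")
        case True
        then have "ennreal 1 \<le> ennreal (1 / y * f i \<omega>)" using y by (intro ennreal_leI) (simp add: field_simps)
        then show ?thesis using y True by (simp add: ennreal_mult[symmetric] split: split_indicator)
      qed simp
    qed
    also have "\<dots> = ennreal (1 / y) * (\<integral>\<^sup>+\<omega>. ennreal (f i \<omega>) \<partial>M)" by (rule nn_integral_cmult) simp
    also have "\<dots> \<le> ennreal (1 / y) * ennreal k" by (intro mult_left_mono int[OF i]) simp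
    also have "\<dots> = ennreal (k / y)" using y by (simp add: ennreal_mult[symmetric])
    finally show ?thesis using y by (simp add: emeasure_eq_measure)
  qed
  have "prob (\<Union>i\<in>I. {\<omega> \<in> space M. y < f i \<omega>}) \<le> (\<Sum>i\<in>I. prob {\<omega> \<in> space M. y < f i \<omega>})"
    using I E by (intro finite_measure_subadditive_finite) auto
  also have "\<dots> \<le> (\<Sum>i\<in>I. k / y)" by (rule sum_mono) (rule one)
  finally show "prob {\<omega> \<in> space M. \<exists>i\<in>I. y < f i \<omega>} \<le> real (card I) * k / y" unfolding U by simp
qed

context positive_CRP
begin

section \<open>Ages and waiting times along regular paths\<close>

lemma age_nonneg: "regular \<omega> \<Longrightarrow> 0 \<le> age i n \<omega>"
  unfolding age_def using regular_rate(2)[of \<omega>] theta_pos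
  by (intro sum_nonneg) (auto intro: order_trans[of 0 \<theta>] less_imp_le)

lemma wait_nonneg: "regular \<omega> \<Longrightarrow> 0 \<le> wait i n \<omega>"
  unfolding wait_def using regular_rate(2)[of \<omega>] theta_pos
  by (intro sum_nonneg) (auto intro: order_trans[of 0 \<theta>] less_imp_le)

lemma ntables_mono:
  assumes "regular \<omega>" "k \<le> n" shows "ntables k \<omega> \<le> ntables n \<omega>"
  using assms(2) by (induction n rule: dec_induct) (auto simp: regular_ntables_Suc[OF assms(1)])

lemma age_unborn:
  assumes "regular \<omega>" "ntables n \<omega> < i" shows "age i n \<omega> = 0"
proof -
  have "S i k \<omega> = 0" if "k < n" for k
  proof -
    have "ntables k \<omega> < i" using ntables_mono[OF assms(1), of k n] that assms(2) by linarith
    then show ?thesis using regular_S_eq_0[OF assms(1), of i k] by simp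
  qed
  then show ?thesis by (simp add: age_def)
qed

lemma wait_mono:
  assumes "regular \<omega>" "1 \<le> i" "i \<le> j" shows "wait i n \<omega> \<le> wait j n \<omega>"
  unfolding wait_def
proof (rule sum_mono)
  fix k
  have "0 \<le> 1 / rate k \<omega>" using regular_rate(2)[OF assms(1), of k] theta_pos by simp
  moreover have "S i k \<omega> = 0 \<Longrightarrow> S j k \<omega> = 0"
    using regular_S_eq_0[OF assms(1), of i k] regular_S_eq_0[OF assms(1), of j k] assms by simp
  ultimately show "(if S i k \<omega> = 0 then 1 / rate k \<omega> else 0) \<le> (if S j k \<omega> = 0 then 1 / rate k \<omega> else 0)"
    by auto
qed

lemma growth_measurable:
  assumes "1 \<le> i"
  shows "(\<lambda>\<omega>. growth_weight \<kappa> (S i n \<omega>) * exp (\<kappa> * W i \<omega> * age i n \<omega>)) \<in> borel_measurable P"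
proof -
  have [measurable]: "W i \<in> borel_measurable P" "age i n \<in> borel_measurable P"
    using W_measurable[OF assms] measurable_from_subalg[OF subalgebra_history age_history[OF assms, of n n]] by auto
  have [measurable]: "(\<lambda>\<omega>. growth_weight \<kappa> (S i n \<omega>)) \<in> borel_measurable P"
    by (rule measurable_compose[OF S_measurable[OF assms]]) simp
  show ?thesis by measurable
qed

lemma ntables_weight_measurable:
  assumes "1 \<le> i"
  shows "(\<lambda>\<omega>. exp (l * real (min (ntables n \<omega>) i) - (exp l - 1) * \<theta> * wait i n \<omega>)) \<in> borel_measurable P"
proof -
  have [measurable]: "wait i n \<in> borel_measurable P" "(\<lambda>\<omega>. real (ntables n \<omega>)) \<in> borel_measurable P"
    using measurable_from_subalg[OF subalgebra_history wait_history[OF assms, of n n]]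
      measurable_from_subalg[OF subalgebra_history ntables_history[of n]] by auto
  show ?thesis unfolding of_nat_min by measurable
qed

text \<open>Markov's inequality at level \<open>m^2\<close>, with a union over at most
  \<open>m\<close> tables, leaves failure probabilities of order \<open>1 / m\<close>. The size
  \<open>x = ln (4 * m^4)\<close> comes from the lower bound on a table: the supermartingale with
  \<open>\<kappa> = 1/2\<close> controls \<open>sqrt s\<close>, so the level \<open>m^2\<close> and
  the factor 2 of \<open>growth_weight_half\<close> get squared.\<close>

lemma process_bounds:
  assumes m: "Suc r \<le> m"
  defines "x \<equiv> ln (4 * real m ^ 4)" and "\<phi> \<equiv> sqrt (real (Suc r)) * (1 + 4 * ln (real m)) / \<theta>"
  obtains B where "B \<in> events" "prob B \<le> 9 / real m"
    "\<And>\<omega> i. regular \<omega> \<Longrightarrow> \<omega> \<notin> B \<Longrightarrow> i \<in> {1..m} \<Longrightarrow> i \<le> ntables n \<omega> \<Longrightarrow>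
        real (S i n \<omega>) \<le> exp (x + W i \<omega> * age i n \<omega>)"
    "\<And>\<omega> i. regular \<omega> \<Longrightarrow> \<omega> \<notin> B \<Longrightarrow> i \<in> {1..r} \<Longrightarrow> i \<le> ntables n \<omega> \<Longrightarrow>
        exp (W i \<omega> * age i n \<omega>) \<le> exp x * real (S i n \<omega>)"
    "\<And>\<omega> i. regular \<omega> \<Longrightarrow> \<omega> \<notin> B \<Longrightarrow> i \<in> {1..Suc r} \<Longrightarrow> wait i n \<omega> \<le> real i / \<theta> + \<phi>"
    "\<And>\<omega> i. regular \<omega> \<Longrightarrow> \<omega> \<notin> B \<Longrightarrow> i \<in> {1..Suc r} \<Longrightarrow> i \<le> ntables n \<omega> \<Longrightarrow> real i / \<theta> - \<phi> \<le> wait i n \<omega>"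
    "\<And>\<omega>. regular \<omega> \<Longrightarrow> \<omega> \<notin> B \<Longrightarrow> m \<le> ntables n \<omega> \<Longrightarrow> (real m - 2 * ln (real m)) / (2 * \<theta>) \<le> wait m n \<omega>"
proof -
  define y where "y = (real m)\<^sup>2"
  \<comment> \<open>The bounds on \<open>\<theta> * wait i\<close> carry an error
    \<open>i * l\<close> from the second order of \<open>exp l\<close> and an error
    \<open>2 * ln m / l\<close> from the level. For \<open>i\<close> up to \<open>r + 1\<close> this
    \<open>l\<close> makes both of order \<open>sqrt (r + 1)\<close>, up to the logarithm.\<close>
  define l where "l = 1 / sqrt (real (Suc r))"
  have m1: "1 \<le> real m" using m by linarith
  have y: "0 < y" "1 \<le> y" "ln y = 2 * ln (real m)"
    using m1 by (auto simp: y_def ln_realpow)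
  have l: "0 < l" "l \<le> 1" by (auto simp: l_def)
  have lnm: "0 \<le> ln (real m)" using m1 by simp
  have ex: "exp x = 4 * y\<^sup>2" using m1 by (simp add: x_def y_def)
  define G where "G \<kappa> i \<omega> = growth_weight \<kappa> (S i n \<omega>) * exp (\<kappa> * W i \<omega> * age i n \<omega>)" for \<kappa> i \<omega>
  define C where "C c i \<omega> = exp (c * real (min (ntables n \<omega>) i) - (exp c - 1) * \<theta> * wait i n \<omega>)" for c i \<omega>
  define BG where "BG \<kappa> k = {\<omega> \<in> space P. \<exists>i\<in>{1..k}. y < G \<kappa> i \<omega>}" for \<kappa> and k :: nat
  define BC where "BC c I = {\<omega> \<in> space P. \<exists>i\<in>I. y < C c i \<omega>}" for c and I :: "nat set"
  have BG: "BG \<kappa> k \<in> events \<and> prob (BG \<kappa> k) \<le> 1 / real m" if "\<kappa> \<le> 1" "k \<le> m" for \<kappa> k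
  proof -
    have *: "finite {1..k}" "\<And>i. i \<in> {1..k} \<Longrightarrow> G \<kappa> i \<in> borel_measurable P"
      "\<And>i. i \<in> {1..k} \<Longrightarrow> (\<integral>\<^sup>+\<omega>. ennreal (G \<kappa> i \<omega>) \<partial>P) \<le> ennreal 1" "0 < y" "0 \<le> (1::real)"
      unfolding G_def using growth_measurable growth_supermartingale[OF _ that(1)] y by auto
    have "prob (BG \<kappa> k) \<le> real (card {1..k}) * 1 / y" unfolding BG_def by (rule markov_union(2)[OF *])
    also have "\<dots> \<le> real m / y" using that y by (simp add: divide_right_mono)
    finally show ?thesis using markov_union(1)[OF *] m1 unfolding BG_def by (simp add: y_def power2_eq_square)
  qed
  have BC: "BC c I \<in> events \<and> prob (BC c I) \<le> exp c / real m" if "finite I" "I \<subseteq> {1..}" "card I \<le> m" for c I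
  proof -
    have *: "finite I" "\<And>i. i \<in> I \<Longrightarrow> C c i \<in> borel_measurable P"
      "\<And>i. i \<in> I \<Longrightarrow> (\<integral>\<^sup>+\<omega>. ennreal (C c i \<omega>) \<partial>P) \<le> ennreal (exp c)" "0 < y" "0 \<le> exp c"
      unfolding C_def using ntables_weight_measurable ntables_supermartingale y that by auto
    have "prob (BC c I) \<le> real (card I) * exp c / y" unfolding BC_def by (rule markov_union(2)[OF *])
    also have "\<dots> \<le> real m * exp c / y" using that y by (intro divide_right_mono mult_right_mono) auto
    also have "\<dots> = exp c / real m" using m1 by (simp add: y_def power2_eq_square)
    finally show ?thesis using markov_union(1)[OF *] unfolding BC_def by simp
  qed
  \<comment> \<open>In this order: sizes too large, sizes too small, tables among the first
    \<open>r + 1\<close> opening too early, the same opening too late, and table \<open>m\<close>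
    opening far too early. The bounds \<open>1 + 1 + 3 + 1 + 3\<close> on the numerators give the
    9.\<close>
  define B where "B = BG (-1) m \<union> BG (1/2) r \<union> BC l {1..Suc r} \<union> BC (- l) {1..Suc r} \<union> BC 1 {m}"
  have b1: "BG (-1) m \<in> events \<and> prob (BG (-1) m) \<le> 1 / real m" by (rule BG) auto
  have b2: "BG (1/2) r \<in> events \<and> prob (BG (1/2) r) \<le> 1 / real m" by (rule BG) (use m in auto)
  have b3: "BC l {1..Suc r} \<in> events \<and> prob (BC l {1..Suc r}) \<le> exp l / real m" by (rule BC) (use m in auto)
  have b4: "BC (- l) {1..Suc r} \<in> events \<and> prob (BC (- l) {1..Suc r}) \<le> exp (- l) / real m" by (rule BC) (use m in auto)
  have b5: "BC 1 {m} \<in> events \<and> prob (BC 1 {m}) \<le> exp 1 / real m" by (rule BC) (use m in auto)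
  have el: "exp l \<le> 3" using l exp_le by (meson exp_le_cancel_iff order_trans)
  have "exp l / real m \<le> 3 / real m" "exp (- l) / real m \<le> 1 / real m" "exp 1 / real m \<le> 3 / real m"
    using el l exp_le m1 by (intro divide_right_mono; simp)+
  then have "prob B \<le> 9 / real m"
    using b1 b2 b3 b4 b5 unfolding B_def
    by (smt (verit) measure_Un_le sets.Un add_divide_distrib)
  note Bprob = this
  have notG: "G \<kappa> i \<omega> \<le> y" if "regular \<omega>" "\<omega> \<notin> BG \<kappa> k" "i \<in> {1..k}" for \<kappa> i k \<omega>
    using that unfolding BG_def regular_def by (auto simp: not_less)
  have notC: "c * real (min (ntables n \<omega>) i) - (exp c - 1) * \<theta> * wait i n \<omega> \<le> 2 * ln (real m)"
    if "regular \<omega>" "\<omega> \<notin> BC c I" "i \<in> I" for c i I \<omega>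
  proof -
    have "C c i \<omega> \<le> y" using that unfolding BC_def regular_def by (auto simp: not_less)
    then have "ln (C c i \<omega>) \<le> ln y" by (intro ln_mono) (auto simp: C_def)
    then show ?thesis by (simp add: C_def y)
  qed
  have th_phi: "\<theta> * \<phi> = sqrt (real (Suc r)) * (1 + 4 * ln (real m))"
    using theta_pos by (simp add: \<phi>_def)
  have sr: "real i * l \<le> sqrt (real (Suc r))" "1 / l = sqrt (real (Suc r))" if "i \<in> {1..Suc r}" for i
  proof -
    have "real i * l \<le> real (Suc r) * l" using that l by (intro mult_right_mono) auto
    also have "\<dots> = sqrt (real (Suc r))" by (simp add: l_def real_div_sqrt)
    finally show "real i * l \<le> sqrt (real (Suc r))" .
  qed (simp add: l_def)
  show thesis
  proof
    show "B \<in> events" using b1 b2 b3 b4 b5 unfolding B_def by auto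
    show "prob B \<le> 9 / real m" by (rule Bprob)
  next
    fix \<omega> i assume reg: "regular \<omega>" and nB: "\<omega> \<notin> B" and i: "i \<in> {1..m}" "i \<le> ntables n \<omega>"
    have "1 \<le> S i n \<omega>" using regular_S_eq_0[OF reg, of i n] i by force
    then have "real (S i n \<omega>) * exp (- (W i \<omega> * age i n \<omega>)) \<le> y"
      using notG[OF reg _ i(1), of "-1"] nB by (simp add: B_def G_def growth_weight_minus_one)
    then have "real (S i n \<omega>) \<le> y * exp (W i \<omega> * age i n \<omega>)"
      by (simp add: exp_minus field_simps)
    also have "y \<le> exp x" using y self_le_power[of y 2] unfolding ex by linarith
    finally show "real (S i n \<omega>) \<le> exp (x + W i \<omega> * age i n \<omega>)" by (simp add: exp_add)
  next
    fix \<omega> i assume reg: "regular \<omega>" and nB: "\<omega> \<notin> B" and i: "i \<in> {1..r}" "i \<le> ntables n \<omega>"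
    have s: "1 \<le> S i n \<omega>" using regular_S_eq_0[OF reg, of i n] i by force
    let ?e = "exp (1/2 * (W i \<omega> * age i n \<omega>))"
    have "1 / (2 * sqrt (real (S i n \<omega>))) * ?e \<le> growth_weight (1/2) (S i n \<omega>) * ?e"
      by (intro mult_right_mono growth_weight_half s) auto
    also have "\<dots> \<le> y" using notG[OF reg _ i(1), of "1/2"] nB by (simp add: B_def G_def mult.assoc)
    finally have "?e \<le> y * (2 * sqrt (real (S i n \<omega>)))" using s by (simp add: field_simps)
    then have "?e\<^sup>2 \<le> (y * (2 * sqrt (real (S i n \<omega>))))\<^sup>2" by (intro power_mono) auto
    also have "?e\<^sup>2 = exp (W i \<omega> * age i n \<omega>)" by (simp add: power2_eq_square exp_add[symmetric])
    also have "(y * (2 * sqrt (real (S i n \<omega>))))\<^sup>2 = exp x * real (S i n \<omega>)"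
      by (simp add: power_mult_distrib ex)
    finally show "exp (W i \<omega> * age i n \<omega>) \<le> exp x * real (S i n \<omega>)" .
  next
    fix \<omega> i assume reg: "regular \<omega>" and nB: "\<omega> \<notin> B" and i: "i \<in> {1..Suc r}"
    have c0: "0 \<le> wait i n \<omega>" by (rule wait_nonneg[OF reg])
    \<comment> \<open>A late opening is caught by the negative parameter. Since only
      \<open>min (ntables n \<omega>) i \<le> i\<close> is used, this bound also holds for tables
      that are not open yet.\<close>
    have "- l * real (min (ntables n \<omega>) i) - (exp (- l) - 1) * \<theta> * wait i n \<omega> \<le> 2 * ln (real m)"
      by (rule notC[OF reg _ i]) (use nB in \<open>auto simp: B_def\<close>)
    then have "(1 - exp (- l)) * (\<theta> * wait i n \<omega>) \<le> l * real (min (ntables n \<omega>) i) + 2 * ln (real m)"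
      by (simp add: algebra_simps)
    also have "l * real (min (ntables n \<omega>) i) \<le> l * real i" using l by (intro mult_left_mono) auto
    finally have 1: "(1 - exp (- l)) * (\<theta> * wait i n \<omega>) \<le> l * real i + 2 * ln (real m)" by simp
    have "exp (- l) \<le> 1 / (1 + l)" using exp_ge_add_one_self[of l] l by (simp add: exp_minus inverse_eq_divide frac_le)
    then have "l / (1 + l) \<le> 1 - exp (- l)" using l by (simp add: field_simps)
    then have "l / (1 + l) * (\<theta> * wait i n \<omega>) \<le> (1 - exp (- l)) * (\<theta> * wait i n \<omega>)"
      using c0 theta_pos by (intro mult_right_mono) auto
    with 1 have "l / (1 + l) * (\<theta> * wait i n \<omega>) \<le> l * real i + 2 * ln (real m)" by linarith
    then have "\<theta> * wait i n \<omega> \<le> (l * real i + 2 * ln (real m)) * ((1 + l) / l)" using l by (simp add: field_simps)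
    also have "\<dots> = real i + real i * l + 2 * ln (real m) * (1 / l) * (1 + l)" using l by (simp add: field_simps)
    also have "\<dots> \<le> real i + sqrt (real (Suc r)) + 2 * ln (real m) * (1 / l) * 2"
      using sr(1)[OF i] l lnm by (intro add_mono mult_left_mono) auto
    also have "\<dots> = real i + \<theta> * \<phi>" unfolding sr(2)[OF i] th_phi by (simp add: algebra_simps)
    finally show "wait i n \<omega> \<le> real i / \<theta> + \<phi>" using theta_pos by (simp add: field_simps)
  next
    fix \<omega> i assume reg: "regular \<omega>" and nB: "\<omega> \<notin> B" and i: "i \<in> {1..Suc r}" "i \<le> ntables n \<omega>"
    let ?c = "\<theta> * wait i n \<omega>" and ?q = "2 * ln (real m) * (1 / l)"
    have c0: "0 \<le> ?c" using wait_nonneg[OF reg, of i n] theta_pos by simp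
    have "l * real (min (ntables n \<omega>) i) - (exp l - 1) * \<theta> * wait i n \<omega> \<le> 2 * ln (real m)"
      by (rule notC[OF reg _ i(1)]) (use nB in \<open>auto simp: B_def\<close>)
    then have "l * real i - 2 * ln (real m) \<le> (exp l - 1) * ?c" using i by (simp add: algebra_simps)
    \<comment> \<open>Uses \<open>exp l - 1 \<le> l + l^2\<close> for \<open>l\<close> in the unit
      interval; the factor \<open>1 + l\<close> is then removed through
      \<open>(1 - l) * (1 + l) \<le> 1\<close>.\<close>
    also have "\<dots> \<le> (l * (1 + l)) * ?c"
      using exp_bound[of l] l c0 by (intro mult_right_mono) (auto simp: algebra_simps power2_eq_square)
    finally have "l * (real i - ?q) \<le> l * ((1 + l) * ?c)" using l by (simp add: algebra_simps)
    then have 1: "real i - ?q \<le> (1 + l) * ?c" using l by simp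
    have "real i - real i * l - ?q \<le> ?c"
    proof (cases "0 \<le> real i - ?q")
      case True
      have "(1 - l) * (real i - ?q) \<le> (1 - l) * ((1 + l) * ?c)" using 1 l by (intro mult_left_mono) auto
      also have "\<dots> = ?c - l * l * ?c" by (simp add: algebra_simps)
      also have "\<dots> \<le> ?c" using c0 by simp
      finally have "(1 - l) * (real i - ?q) \<le> ?c" .
      moreover have "(1 - l) * (real i - ?q) = real i - real i * l - ?q + l * ?q" by (simp only: ring_distribs mult_1_left) simp
      ultimately have "real i - real i * l - ?q + l * ?q \<le> ?c" by linarith
      moreover have "0 \<le> l * ?q" using l lnm by simp
      ultimately show ?thesis by linarith
    next
      case False
      moreover have "0 \<le> real i * l" using l by simp
      ultimately show ?thesis using c0 by linarith
    qed
    moreover have "real i * l + ?q \<le> \<theta> * \<phi>"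
    proof -
      have "real i * l + ?q \<le> sqrt (real (Suc r)) + 2 * ln (real m) * sqrt (real (Suc r))"
        using sr[OF i(1)] by simp
      also have "\<dots> \<le> sqrt (real (Suc r)) + 4 * ln (real m) * sqrt (real (Suc r))"
        using lnm by (intro add_left_mono mult_right_mono) auto
      also have "\<dots> = \<theta> * \<phi>" unfolding th_phi by (simp add: algebra_simps)
      finally show ?thesis .
    qed
    ultimately have "real i - \<theta> * \<phi> \<le> ?c" by linarith
    then show "real i / \<theta> - \<phi> \<le> wait i n \<omega>" using theta_pos by (simp add: field_simps)
  next
    fix \<omega> assume reg: "regular \<omega>" and nB: "\<omega> \<notin> B" and mK: "m \<le> ntables n \<omega>"
    \<comment> \<open>The parameter 1 gives a crude bound, off by a constant factor, but with only a
      logarithmic error. It serves to show that fewer than \<open>m\<close> tables are open.\<close>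
    have "1 * real (min (ntables n \<omega>) m) - (exp 1 - 1) * \<theta> * wait m n \<omega> \<le> 2 * ln (real m)"
      by (rule notC[OF reg, of _ "{m}"]) (use nB in \<open>auto simp: B_def\<close>)
    then have "real m - 2 * ln (real m) \<le> (exp 1 - 1) * (\<theta> * wait m n \<omega>)" using mK by (simp add: mult.assoc)
    also have "\<dots> \<le> 2 * (\<theta> * wait m n \<omega>)"
      using exp_le wait_nonneg[OF reg, of m n] theta_pos by (intro mult_right_mono) auto
    finally show "(real m - 2 * ln (real m)) / (2 * \<theta>) \<le> wait m n \<omega>" using theta_pos by (simp add: field_simps)
  qed
qed

text \<open>There are \<open>n + 1\<close> customers at time \<open>n\<close>, so a ratio can exceed
  1, but by no more than \<open>1 / n\<close>. The maximum runs over infinitely many tables and is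
  attained because the sizes take only values up to \<open>n + 1\<close>.\<close>

lemma max_ratio_close_to_one:
  assumes reg: "regular \<omega>" and n: "1 \<le> n" and z: "1 \<le> z" and \<eta>: "0 \<le> \<eta>"
    and big: "real (Suc n) * (1 - \<eta>) \<le> real (S z n \<omega>)"
  shows "\<bar>Max ((\<lambda>i. real (S i n \<omega>) / real n) ` {1..}) - 1\<bar> \<le> \<eta> + 1 / real n"
proof -
  let ?X = "(\<lambda>i. real (S i n \<omega>) / real n) ` {1..}"
  have S_le: "S i n \<omega> \<le> Suc n" if "1 \<le> i" for i
  proof (cases "i \<le> ntables n \<omega>")
    case True
    then have "S i n \<omega> \<le> (\<Sum>i=1..ntables n \<omega>. S i n \<omega>)" using that by (intro member_le_sum) auto
    then show ?thesis unfolding regular_ntables(4)[OF reg] .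
  next
    case False
    then show ?thesis using regular_S_eq_0[OF reg that, of n] by simp
  qed
  have fin: "finite ?X"
  proof (rule finite_subset)
    show "?X \<subseteq> (\<lambda>k. real k / real n) ` {..Suc n}" using S_le by auto
  qed simp
  have le: "v \<le> 1 + 1 / real n" if "v \<in> ?X" for v
  proof -
    obtain i where i: "1 \<le> i" "v = real (S i n \<omega>) / real n" using \<open>v \<in> ?X\<close> by auto
    have "v \<le> real (Suc n) / real n" unfolding i(2) using S_le[OF i(1)] by (intro divide_right_mono) auto
    also have "\<dots> = 1 + 1 / real n" using n by (simp add: field_simps)
    finally show ?thesis .
  qed
  have "1 - \<eta> \<le> real (S z n \<omega>) / real n"
  proof (cases "\<eta> \<le> 1")
    case True
    have "real n * (1 - \<eta>) \<le> real (Suc n) * (1 - \<eta>)" using True by (intro mult_right_mono) auto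
    then show ?thesis using big n by (simp add: pos_le_divide_eq mult.commute)
  next
    case False
    then show ?thesis by (smt (verit) divide_nonneg_nonneg of_nat_0_le_iff)
  qed
  also have "\<dots> \<le> Max ?X" using fin z by (intro Max_ge) auto
  finally have "1 - \<eta> \<le> Max ?X" .
  moreover have "Max ?X \<in> ?X" using fin by (intro Max_in) auto
  then have "Max ?X \<le> 1 + 1 / real n" by (rule le)
  moreover have "0 \<le> 1 / real n" by simp
  ultimately show ?thesis using \<eta> by linarith
qed

lemma prob_max_ratio_far:
  assumes n: "1 \<le> n" and L: "L = ln (real (Suc n))"
    and v: "0 < v1" "v1 \<le> v2" "v2 < v3" and v0: "AE y in \<mu>. v0 \<le> 1 / y"
    and N: "real N / \<theta> \<le> L * (v2 - v1)" "N \<le> r" and m: "Suc r \<le> m"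
    and r: "L * (v3 - v0) \<le> real (Suc r) / \<theta>" and g: "0 \<le> g" "g \<le> L * (v3 - v2)"
    and tables: "L * v3 < (real m - 2 * ln (real m)) / (2 * \<theta>)"
    and gap: "2 * (sqrt (real (Suc r)) * (1 + 4 * ln (real m)) / \<theta>) + x * v2 + 2 * v3 * (2 * x) \<le> g"
    and x: "x = ln (4 * real m ^ 4)" "2 * x \<le> L / 2" and \<epsilon>: "real m * exp (- x) + 1 / real n \<le> \<epsilon>"
  shows "prob {\<omega> \<in> space P. \<bar>Max ((\<lambda>i. real (S i n \<omega>) / real n) ` {1..}) - 1\<bar> > \<epsilon>}
    \<le> 9 / real m + (1 - measure \<mu> {1 / v1..}) ^ N + real r * (2 * \<theta> * g + 1) * (measure \<mu> {1 / v3..})\<^sup>2"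
proof -
  have L0: "0 < L" using n by (simp add: L)
  define \<phi> where "\<phi> = sqrt (real (Suc r)) * (1 + 4 * ln (real m)) / \<theta>"
  have m1: "1 \<le> real m" using m by linarith
  have x0: "0 \<le> x"
  proof -
    have "1 * 1 \<le> 4 * real m ^ 4" using m1 by (intro mult_mono) auto
    then show ?thesis unfolding x by simp
  qed
  have \<phi>0: "0 \<le> \<phi>" using m1 theta_pos by (simp add: \<phi>_def)
  obtain B1 where B1: "B1 \<in> events"
    "prob B1 \<le> (1 - measure \<mu> {1 / v1..}) ^ N + real r * (2 * \<theta> * g + 1) * (measure \<mu> {1 / v3..})\<^sup>2"
    "\<And>\<omega>. regular \<omega> \<Longrightarrow> \<omega> \<notin> B1 \<Longrightarrow> \<exists>z\<in>{1..r}. real z / \<theta> + L / W z \<omega> \<le> L * v2 \<and>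
       (\<forall>j\<in>{1..r}. j \<noteq> z \<longrightarrow> real z / \<theta> + L / W z \<omega> + g \<le> real j / \<theta> + L / W j \<omega>)"
    using unique_minimiser[OF v L0 g N] by blast
  obtain B2 where B2: "B2 \<in> events" "prob B2 \<le> 9 / real m"
    "\<And>\<omega> i. regular \<omega> \<Longrightarrow> \<omega> \<notin> B2 \<Longrightarrow> i \<in> {1..m} \<Longrightarrow> i \<le> ntables n \<omega> \<Longrightarrow>
        real (S i n \<omega>) \<le> exp (x + W i \<omega> * age i n \<omega>)"
    "\<And>\<omega> i. regular \<omega> \<Longrightarrow> \<omega> \<notin> B2 \<Longrightarrow> i \<in> {1..r} \<Longrightarrow> i \<le> ntables n \<omega> \<Longrightarrow>
        exp (W i \<omega> * age i n \<omega>) \<le> exp x * real (S i n \<omega>)"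
    "\<And>\<omega> i. regular \<omega> \<Longrightarrow> \<omega> \<notin> B2 \<Longrightarrow> i \<in> {1..Suc r} \<Longrightarrow> wait i n \<omega> \<le> real i / \<theta> + \<phi>"
    "\<And>\<omega> i. regular \<omega> \<Longrightarrow> \<omega> \<notin> B2 \<Longrightarrow> i \<in> {1..Suc r} \<Longrightarrow> i \<le> ntables n \<omega> \<Longrightarrow> real i / \<theta> - \<phi> \<le> wait i n \<omega>"
    "\<And>\<omega>. regular \<omega> \<Longrightarrow> \<omega> \<notin> B2 \<Longrightarrow> m \<le> ntables n \<omega> \<Longrightarrow> (real m - 2 * ln (real m)) / (2 * \<theta>) \<le> wait m n \<omega>"
    using process_bounds[OF m, of n] unfolding x(1) \<phi>_def by blast
  have "AE \<omega> in P. 1 \<le> j \<longrightarrow> v0 \<le> 1 / W j \<omega>" for j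
  proof (cases "1 \<le> j")
    case True
    have "AE y in distr P borel (W j). v0 \<le> 1 / y" unfolding weights_distr[OF True] by (rule v0)
    then have "AE \<omega> in P. v0 \<le> 1 / W j \<omega>" by (rule AE_distrD[OF W_measurable[OF True]])
    then show ?thesis by (rule AE_mp) simp
  qed simp
  then have V0: "AE \<omega> in P. \<forall>j. 1 \<le> j \<longrightarrow> v0 \<le> 1 / W j \<omega>" unfolding AE_all_countable by blast
  have "prob {\<omega> \<in> space P. \<bar>Max ((\<lambda>i. real (S i n \<omega>) / real n) ` {1..}) - 1\<bar> > \<epsilon>} \<le> prob (B1 \<union> B2)"
  proof (rule finite_measure_mono_AE)
    show "AE \<omega> in P. \<omega> \<in> {\<omega> \<in> space P. \<bar>Max ((\<lambda>i. real (S i n \<omega>) / real n) ` {1..}) - 1\<bar> > \<epsilon>} \<longrightarrow> \<omega> \<in> B1 \<union> B2"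
      using AE_regular V0
    proof eventually_elim
      case (elim \<omega>)
      note reg = elim(1)
      have "\<bar>Max ((\<lambda>i. real (S i n \<omega>) / real n) ` {1..}) - 1\<bar> \<le> \<epsilon>" if nB: "\<omega> \<notin> B1" "\<omega> \<notin> B2"
      proof -
        obtain z where z: "z \<in> {1..r}" "real z / \<theta> + L / W z \<omega> \<le> L * v2"
          "\<And>j. j \<in> {1..r} \<Longrightarrow> j \<noteq> z \<Longrightarrow> real z / \<theta> + L / W z \<omega> + g \<le> real j / \<theta> + L / W j \<omega>"
          using B1(3)[OF reg nB(1)] by blast
        \<comment> \<open>The margin \<open>D = 2 * x\<close> beats the fluctuation factor
          \<open>exp x\<close> of each rival, and \<open>exp x = 4 * m^4\<close> also beats the
          number \<open>m\<close> of rivals.\<close>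
        have "real (Suc n) * (1 - real m * exp (x - 2 * x)) \<le> real (S z n \<omega>)"
        proof (rule dominant_table[where w = "\<lambda>i. W i \<omega>" and c = "\<lambda>i. wait i n \<omega>" and a = "\<lambda>i. age i n \<omega>"
            and s = "\<lambda>i. S i n \<omega>" and K = "ntables n \<omega>" and m = m and r = r and z = z and \<phi> = \<phi> and g = g and L = L
            and \<theta> = \<theta> and ?v2.0 = v2 and ?v3.0 = v3 and ?v0.0 = v0 and \<tau> = "\<Sum>k<n. 1 / rate k \<omega>"])
          show "0 < W i \<omega>" if "1 \<le> i" for i using reg that by (simp add: regular_def)
          show "(\<Sum>i = 1..ntables n \<omega>. S i n \<omega>) = Suc n" by (rule regular_ntables(4)[OF reg])
          show "wait i n \<omega> + age i n \<omega> = (\<Sum>k<n. 1 / rate k \<omega>)" for i by (rule wait_plus_age)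
          show "L * v3 < wait m n \<omega>" if "m \<le> ntables n \<omega>" using B2(7)[OF reg nB(2) that] tables by linarith
          show "2 * \<phi> + x * v2 + 2 * v3 * (2 * x) \<le> g" using gap by (simp add: \<phi>_def)
          show "1 \<le> m" using m by simp
        qed (use reg nB z B2 age_nonneg wait_nonneg wait_mono age_unborn theta_pos L L0 elim(2) r g x x0 \<phi>0 v in auto)
        then have "real (Suc n) * (1 - real m * exp (- x)) \<le> real (S z n \<omega>)" by simp
        then have "\<bar>Max ((\<lambda>i. real (S i n \<omega>) / real n) ` {1..}) - 1\<bar> \<le> real m * exp (- x) + 1 / real n"
          using z(1) by (intro max_ratio_close_to_one[OF reg n, of z]) auto
        then show ?thesis using \<epsilon> by linarith
      qed
      then show ?case unfolding mem_Collect_eq Un_iff not_less[symmetric] by blast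
    qed
    show "B1 \<union> B2 \<in> events" using B1 B2 by auto
  qed
  also have "\<dots> \<le> prob B1 + prob B2" by (rule measure_Un_le[OF B1(1) B2(1)])
  finally show ?thesis using B1(2) B2(2) by linarith
qed

end

section \<open>Choice of the scale\<close>

context positive_CRP
begin

text \<open>Once \<open>L\<close> is tied to \<open>t\<close> by the scale equation, the conditions
  of \<open>prob_max_ratio_far\<close> depend on \<open>t\<close> alone, apart from the term
  \<open>1 / n\<close>. So \<open>K\<close> and \<open>T\<close> can be chosen before
  \<open>n\<close>.\<close>

lemma eventually_max_ratio_bound:
  assumes sc: "tail_scales \<mu> v0 d v1 v2 v3 p C t0" and \<epsilon>: "0 < \<epsilon>" and \<delta>: "0 < \<delta>"
  obtains K T where "0 < K" "t0 \<le> T"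
    "\<And>t n. T \<le> t \<Longrightarrow> 2 / \<epsilon> \<le> real n \<Longrightarrow> 1 \<le> n \<Longrightarrow> \<theta> * ln (real (Suc n)) * d t = K * t \<Longrightarrow>
      prob {\<omega> \<in> space P. \<bar>Max ((\<lambda>i. real (S i n \<omega>) / real n) ` {1..}) - 1\<bar> > \<epsilon>} < \<delta>"
proof -
  interpret mu: prob_space \<mu> by (rule prob_space_mu)
  have C: "1 \<le> C" and p: "0 \<le> p" and t0: "1 \<le> t0" and v0: "0 \<le> v0" "AE y in \<mu>. v0 \<le> 1 / y"
    using sc by (auto simp: tail_scales_def)
  have sct: "0 < v1 t" "0 < d t" "d t \<le> v2 t - v1 t" "d t \<le> v3 t - v2 t"
        "v3 t - v0 \<le> C * t powr (1/10) * d t" "v3 t \<le> C" "1 \<le> C * t powr p * d t"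
        "t * measure \<mu> {1 / v3 t..} \<le> C" "1 \<le> C * (t * measure \<mu> {1 / v1 t..})" if "t0 \<le> t" for t
    using sc that by (auto simp: tail_scales_def)
  \<comment> \<open>Each of the first \<open>N\<close> tables has \<open>1 / W i \<le> v1 t\<close>
    with probability at least \<open>1 / (C * t)\<close>, and \<open>N \<ge> (K - 1) * t\<close>.
    None of them does with probability at most \<open>exp (- (K - 1) / C) = exp (- 2 / \<delta>)
    \<le> \<delta> / 2\<close>.\<close>
  define K where "K = 1 + 2 * C / \<delta>"
  \<comment> \<open>Coefficient in \<open>m \<le> M * t powr (2 + p)\<close>: the terms stem from
    \<open>4 * \<theta> * C * L\<close>, from \<open>r\<close>, and from additive constants;
    \<open>2 + p\<close> dominates the exponents \<open>1 + p\<close> and 11/10.\<close>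
  define M where "M = 4 * C\<^sup>2 * K + 2 * C * K + 5"
  have K: "1 \<le> K" using C \<delta> by (simp add: K_def)
  have M: "0 < M" using C K by (simp add: M_def add_pos_pos)
  have pos: "0 < C" "0 < K" using C K by auto
  have "\<forall>\<^sub>F t in at_top. 2 * (sqrt (2 * C * K * t powr (11/10) + 2) * (1 + 4 * (ln M + (2 + p) * ln t)) / \<theta>)
     + 5 * C * (ln 4 + 4 * (ln M + (2 + p) * ln t)) \<le> t powr (3/5)"
    using pos theta_pos M p by real_asymp
  moreover have "\<forall>\<^sub>F t in at_top. 4 * (ln 4 + 4 * (ln M + (2 + p) * ln t)) \<le> K * t / (\<theta> * C)"
    using pos theta_pos M p by real_asymp
  moreover have "\<forall>\<^sub>F t in at_top. (2 * C * K * t powr (11/10) + 1) * (2 * \<theta> * t powr (3/5) + 1) * (C / t)\<^sup>2 < \<delta> / 4"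
    using pos theta_pos \<delta> by real_asymp
  moreover have "\<forall>\<^sub>F t in at_top. t powr (3/5) \<le> K * t / \<theta>"
    using pos theta_pos by real_asymp
  moreover have "\<forall>\<^sub>F t :: real in at_top. 9 / t < \<delta> / 8" using \<delta> by real_asymp
  moreover have "\<forall>\<^sub>F t :: real in at_top. 1 / t \<le> \<epsilon> / 2" using \<epsilon> by real_asymp
  moreover have "\<forall>\<^sub>F m :: real in at_top. 2 * ln m \<le> m / 4" by real_asymp
  then have "\<forall>\<^sub>F t :: real in at_top. \<forall>m\<ge>t. 2 * ln m \<le> m / 4" by (rule eventually_all_ge_at_top)
  ultimately have "\<forall>\<^sub>F t in at_top. t0 \<le> t \<and>
      2 * (sqrt (2 * C * K * t powr (11/10) + 2) * (1 + 4 * (ln M + (2 + p) * ln t)) / \<theta>)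
        + 5 * C * (ln 4 + 4 * (ln M + (2 + p) * ln t)) \<le> t powr (3/5) \<and>
      4 * (ln 4 + 4 * (ln M + (2 + p) * ln t)) \<le> K * t / (\<theta> * C) \<and>
      (2 * C * K * t powr (11/10) + 1) * (2 * \<theta> * t powr (3/5) + 1) * (C / t)\<^sup>2 < \<delta> / 4 \<and>
      t powr (3/5) \<le> K * t / \<theta> \<and> 9 / t < \<delta> / 8 \<and> 1 / t \<le> \<epsilon> / 2 \<and> (\<forall>m\<ge>t. 2 * ln m \<le> m / 4)"
    using eventually_ge_at_top[of t0] by eventually_elim blast
  then obtain T where T: "\<And>t. T \<le> t \<Longrightarrow> t0 \<le> t \<and>
      2 * (sqrt (2 * C * K * t powr (11/10) + 2) * (1 + 4 * (ln M + (2 + p) * ln t)) / \<theta>)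
        + 5 * C * (ln 4 + 4 * (ln M + (2 + p) * ln t)) \<le> t powr (3/5) \<and>
      4 * (ln 4 + 4 * (ln M + (2 + p) * ln t)) \<le> K * t / (\<theta> * C) \<and>
      (2 * C * K * t powr (11/10) + 1) * (2 * \<theta> * t powr (3/5) + 1) * (C / t)\<^sup>2 < \<delta> / 4 \<and>
      t powr (3/5) \<le> K * t / \<theta> \<and> 9 / t < \<delta> / 8 \<and> 1 / t \<le> \<epsilon> / 2 \<and> (\<forall>m\<ge>t. 2 * ln m \<le> m / 4)"
    unfolding eventually_at_top_linorder by blast
  show thesis
  proof
    show "0 < K" "t0 \<le> T" using K T[of T] by auto
    fix t n
    assume "T \<le> t" and n: "2 / \<epsilon> \<le> real n" "1 \<le> n" and Ld: "\<theta> * ln (real (Suc n)) * d t = K * t"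
    note T = T[OF \<open>T \<le> t\<close>]
    then have tt: "t0 \<le> t" by blast
    have T2: "4 * (ln 4 + 4 * (ln M + (2 + p) * ln t)) \<le> K * t / (\<theta> * C)" and T3: "t powr (3/5) \<le> K * t / \<theta>"
      using T by blast+
    have t: "1 \<le> t" using tt t0 by linarith
    note sct = sct[OF tt]
    define L where "L = ln (real (Suc n))"
    have L: "0 < L" using n by (simp add: L_def)
    \<comment> \<open>\<open>N\<close> counts the candidates opening within \<open>L * d t\<close>,
      and past \<open>r\<close> a table opens too late to compete whatever its weight; the summand
      \<open>N\<close> in \<open>r\<close> ensures \<open>N \<le> r\<close>. In \<open>m\<close>,
      the term \<open>4 * \<theta> * C * L\<close> is twice what \<open>L * v3 t \<le> L * C\<close>
      demands, to absorb the logarithm in the bound on \<open>wait m\<close>.\<close>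
    define N where "N = nat \<lfloor>K * t\<rfloor>"
    define r where "r = nat \<lceil>\<theta> * L * (v3 t - v0)\<rceil> + N"
    define m where "m = nat \<lceil>4 * \<theta> * C * L\<rceil> + r + 2"
    define g where "g = t powr (3/5)"
    define x where "x = ln (4 * real m ^ 4)"
    have Ld': "\<theta> * L * d t = K * t" using Ld by (simp add: L_def)
    have Kt: "1 \<le> K * t" using mult_mono[of 1 K 1 t] K t by simp
    have NK: "real N \<le> K * t" "K * t - 1 \<le> real N" using Kt unfolding N_def by linarith+
    have v23: "0 < v2 t" "0 < v3 t" "v1 t \<le> v2 t" "v2 t < v3 t" using sct by linarith+
    have dC: "d t \<le> C" using sct v23 by linarith
    have tp: "1 \<le> t powr (1/10)" "1 \<le> t powr (11/10)" "t \<le> t powr (11/10)"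
      using t powr_mono[of 1 "11/10" t] by (auto intro: ge_one_powr_ge_zero)
    have Lv: "\<theta> * L * (v3 t - v0) \<le> C * K * t powr (11/10)"
    proof -
      have "\<theta> * L * (v3 t - v0) \<le> \<theta> * L * (C * t powr (1/10) * d t)"
        using sct L theta_pos by (intro mult_left_mono) auto
      also have "\<dots> = C * (t powr (1/10)) * (\<theta> * L * d t)" by (simp only: mult_ac)
      also have "\<dots> = C * K * (t powr (1/10) * t powr 1)" using Ld' t by simp
      also have "t powr (1/10) * t powr 1 = t powr (11/10)" by (simp only: powr_add[symmetric]) simp
      finally show ?thesis .
    qed
    have CK: "0 \<le> C * K * t powr (11/10)" using pos by simp
    have r_le: "real r \<le> 2 * C * K * t powr (11/10) + 1"
    proof -
      have "K * t \<le> C * K * t powr (11/10)"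
        using mult_mono[of 1 C "K * t" "K * t powr (11/10)"] C K t tp by (simp add: mult.assoc)
      moreover have "real (nat \<lceil>\<theta> * L * (v3 t - v0)\<rceil>) \<le> C * K * t powr (11/10) + 1"
        using Lv CK by linarith
      ultimately show ?thesis using NK(1) unfolding r_def by simp
    qed
    have r_ge: "\<theta> * L * (v3 t - v0) \<le> real r" unfolding r_def by linarith
    have L_ge: "K * t / (\<theta> * C) \<le> L"
    proof -
      have "K * t \<le> \<theta> * L * C" unfolding Ld'[symmetric] using dC L theta_pos by (intro mult_left_mono) auto
      then show ?thesis using theta_pos pos by (simp add: pos_divide_le_eq mult_ac)
    qed
    \<comment> \<open>The polynomial lower bound on \<open>d\<close> enters here: it keeps
      \<open>L\<close>, and with it \<open>m\<close>, polynomial in \<open>t\<close>, so all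
      logarithmic errors are of order \<open>ln t\<close>.\<close>
    have L_le: "\<theta> * L \<le> C * K * t powr (1 + p)"
    proof -
      have "\<theta> * L * 1 \<le> \<theta> * L * (C * t powr p * d t)" using sct L theta_pos by (intro mult_left_mono) auto
      also have "\<dots> = C * t powr p * (\<theta> * L * d t)" by (simp only: mult_ac)
      also have "\<dots> = C * K * (t powr 1 * t powr p)" using Ld' t by simp
      finally show ?thesis by (simp only: powr_add mult_1_right)
    qed
    have m_ge: "4 * \<theta> * C * L \<le> real m" "Suc r \<le> m" unfolding m_def by linarith+
    have tm: "t \<le> real m"
    proof -
      have "1 * t \<le> 4 * K * t" using K t by (intro mult_right_mono) auto
      also have "\<dots> = 4 * (\<theta> * L * d t)" by (simp add: Ld')
      also have "\<dots> \<le> 4 * (\<theta> * L * C)" using dC L theta_pos by (intro mult_left_mono) auto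
      also have "\<dots> \<le> real m" using m_ge(1) by (simp add: mult_ac)
      finally show ?thesis by simp
    qed
    have m_le: "real m \<le> M * t powr (2 + p)"
    proof -
      have pw: "t powr (1 + p) \<le> t powr (2 + p)" "t powr (11/10) \<le> t powr (2 + p)" "1 \<le> t powr (2 + p)"
        using t p by (auto intro: powr_mono ge_one_powr_ge_zero)
      have "4 * C * (\<theta> * L) \<le> 4 * C * (C * K * t powr (1 + p))" using L_le pos by (intro mult_left_mono) auto
      also have "\<dots> \<le> 4 * C * (C * K * t powr (2 + p))" using pw pos by (intro mult_left_mono) auto
      finally have 1: "4 * \<theta> * C * L \<le> 4 * C\<^sup>2 * K * t powr (2 + p)" by (simp add: power2_eq_square mult_ac)
      have 2: "2 * C * K * t powr (11/10) \<le> 2 * C * K * t powr (2 + p)" using pw pos by (intro mult_left_mono) auto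
      have "0 \<le> 4 * \<theta> * C * L" using theta_pos pos L by simp
      then have "real m \<le> 4 * \<theta> * C * L + 1 + real r + 2"
        unfolding m_def by linarith
      also have "\<dots> \<le> 4 * C\<^sup>2 * K * t powr (2 + p) + 2 * C * K * t powr (2 + p) + 5 * t powr (2 + p)"
        using 1 2 r_le pw(3) by linarith
      finally show ?thesis by (simp add: M_def algebra_simps)
    qed
    have m1: "1 \<le> real m" using tm t by linarith
    define lb where "lb = ln M + (2 + p) * ln t"
    have lnm: "ln (real m) \<le> lb" "0 \<le> ln (real m)"
    proof -
      have "ln (real m) \<le> ln (M * t powr (2 + p))" using m_le m1 by (intro ln_mono) auto
      also have "\<dots> = lb" using M t by (simp add: ln_mult ln_powr lb_def)
      finally show "ln (real m) \<le> lb" .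
    qed (use m1 in simp)
    have x_eq: "x = ln 4 + 4 * ln (real m)" using m1 by (simp add: x_def ln_mult ln_realpow)
    have x_le: "x \<le> ln 4 + 4 * lb" "0 \<le> x" using lnm x_eq by auto
    have far: "prob {\<omega> \<in> space P. \<bar>Max ((\<lambda>i. real (S i n \<omega>) / real n) ` {1..}) - 1\<bar> > \<epsilon>}
      \<le> 9 / real m + (1 - measure \<mu> {1 / v1 t..}) ^ N + real r * (2 * \<theta> * g + 1) * (measure \<mu> {1 / v3 t..})\<^sup>2"
    proof (rule prob_max_ratio_far[where L = L and ?v2.0 = "v2 t" and ?v0.0 = v0 and x = x])
      show "L = ln (real (Suc n))" "1 \<le> n" "0 < v1 t" "v1 t \<le> v2 t" "v2 t < v3 t" "AE y in \<mu>. v0 \<le> 1 / y"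
        "N \<le> r" "Suc r \<le> m" "x = ln (4 * real m ^ 4)" "0 \<le> g"
        using n sct v23 v0 m_ge by (simp_all add: L_def r_def x_def g_def)
      have "real N \<le> \<theta> * (L * d t)" using NK(1) Ld' by (simp add: mult.assoc)
      also have "\<dots> \<le> \<theta> * (L * (v2 t - v1 t))" using sct L theta_pos by (intro mult_left_mono) auto
      finally show "real N / \<theta> \<le> L * (v2 t - v1 t)" using theta_pos by (simp add: pos_divide_le_eq mult_ac)
      show "L * (v3 t - v0) \<le> real (Suc r) / \<theta>"
        using r_ge theta_pos by (simp add: pos_le_divide_eq mult_ac)
      have "L * d t = K * t / \<theta>" using Ld' theta_pos by (simp add: field_simps)
      then have "g \<le> L * d t" using T3 by (simp add: g_def)
      also have "\<dots> \<le> L * (v3 t - v2 t)" using sct L by (intro mult_left_mono) auto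
      finally show "g \<le> L * (v3 t - v2 t)" .
      have "2 * ln (real m) \<le> real m / 4" using T tm by blast
      then have "real m * (3 / 4) \<le> real m - 2 * ln (real m)" by simp
      moreover have "L * v3 t * (2 * \<theta>) \<le> L * C * (2 * \<theta>)"
        using sct L theta_pos by (intro mult_right_mono mult_left_mono) auto
      moreover have "L * C * (2 * \<theta>) \<le> real m / 2" using m_ge(1) by (simp add: mult_ac)
      ultimately have "L * v3 t * (2 * \<theta>) < real m - 2 * ln (real m)" using m1 by linarith
      then show "L * v3 t < (real m - 2 * ln (real m)) / (2 * \<theta>)"
        using theta_pos by (simp add: pos_less_divide_eq)
      show "2 * (sqrt (real (Suc r)) * (1 + 4 * ln (real m)) / \<theta>) + x * v2 t + 2 * v3 t * (2 * x) \<le> g"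
      proof -
        have "sqrt (real (Suc r)) * (1 + 4 * ln (real m)) \<le> sqrt (2 * C * K * t powr (11/10) + 2) * (1 + 4 * lb)"
          using r_le lnm by (intro mult_mono real_sqrt_le_mono) auto
        then have "2 * (sqrt (real (Suc r)) * (1 + 4 * ln (real m)) / \<theta>)
            \<le> 2 * (sqrt (2 * C * K * t powr (11/10) + 2) * (1 + 4 * lb) / \<theta>)"
          using theta_pos by (intro mult_left_mono divide_right_mono) auto
        moreover have "x * v2 t \<le> x * C" "x * v3 t \<le> x * C"
          using x_le v23 sct by (intro mult_left_mono; simp)+
        moreover have "x * C \<le> C * (ln 4 + 4 * lb)" using x_le pos by (simp add: mult.commute)
        moreover have "2 * v3 t * (2 * x) = 4 * (x * v3 t)" "5 * C * (ln 4 + 4 * lb) = 5 * (C * (ln 4 + 4 * lb))" by simp_all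
        ultimately show ?thesis using T unfolding g_def lb_def[symmetric] by linarith
      qed
      show "2 * x \<le> L / 2" using order_trans[OF T2[folded lb_def] L_ge] x_le(1) by argo
      have "real m * exp (- x) = 1 / (4 * real m ^ 3)"
        using m1 by (simp add: x_def exp_minus exp_ln field_simps power_numeral_reduce)
      also have "\<dots> \<le> 1 / real m"
      proof -
        have "real m * 1 \<le> real m ^ 3 * 4" using m1 by (intro mult_mono self_le_power) auto
        then show ?thesis using m1 by (intro divide_left_mono) (auto simp: mult.commute)
      qed
      also have "\<dots> \<le> 1 / t" using tm t by (intro divide_left_mono) auto
      also have "\<dots> \<le> \<epsilon> / 2" using T by blast
      finally have "real m * exp (- x) \<le> \<epsilon> / 2" .
      moreover have "1 / real n \<le> \<epsilon> / 2" using n \<epsilon> by (simp add: field_simps)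
      ultimately show "real m * exp (- x) + 1 / real n \<le> \<epsilon>" by linarith
    qed
    have "9 / real m \<le> 9 / t" using tm t by (intro divide_left_mono) auto
    then have a: "9 / real m < \<delta> / 8" using T by linarith
    let ?q = "measure \<mu> {1 / v1 t..}"
    have b: "(1 - ?q) ^ N \<le> \<delta> / 2"
    proof -
      have q: "1 / (C * t) \<le> ?q" using sct(9) pos t by (simp add: pos_divide_le_eq mult_ac)
      have "(1 - ?q) ^ N \<le> exp (- ?q) ^ N"
        using exp_ge_add_one_self[of "- ?q"] mu.prob_le_1 by (intro power_mono) auto
      also have "\<dots> = exp (- (real N * ?q))" by (simp add: exp_of_nat_mult[symmetric])
      also have "\<dots> \<le> exp (- (2 / \<delta>))"
      proof -
        have "K * t - t \<le> real N" using NK t by linarith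
        then have "(K * t - t) * (1 / (C * t)) \<le> real N * ?q"
          using q K t pos by (intro mult_mono) auto
        moreover have "(K * t - t) * (1 / (C * t)) = 2 / \<delta>"
          using pos t \<delta> by (simp add: K_def field_simps)
        ultimately show ?thesis by simp
      qed
      also have "\<dots> \<le> 1 / (2 / \<delta>)"
      proof -
        have "2 / \<delta> \<le> exp (2 / \<delta>)" using exp_ge_add_one_self[of "2 / \<delta>"] by linarith
        then show ?thesis using \<delta> unfolding exp_minus inverse_eq_divide by (intro divide_left_mono) auto
      qed
      finally show ?thesis by simp
    qed
    have c: "real r * (2 * \<theta> * g + 1) * (measure \<mu> {1 / v3 t..})\<^sup>2 < \<delta> / 4"
    proof -
      have "measure \<mu> {1 / v3 t..} \<le> C / t" using sct(8) t by (simp add: pos_le_divide_eq mult.commute)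
      then have "real r * (2 * \<theta> * g + 1) * (measure \<mu> {1 / v3 t..})\<^sup>2
        \<le> (2 * C * K * t powr (11/10) + 1) * (2 * \<theta> * t powr (3/5) + 1) * (C / t)\<^sup>2"
        using r_le theta_pos pos t unfolding g_def
        by (intro mult_mono power_mono mult_nonneg_nonneg add_nonneg_nonneg) auto
      then show ?thesis using T by linarith
    qed
    show "prob {\<omega> \<in> space P. \<bar>Max ((\<lambda>i. real (S i n \<omega>) / real n) ` {1..}) - 1\<bar> > \<epsilon>} < \<delta>"
      using far a b c \<delta> by linarith
  qed
qed

text \<open>For each large \<open>n\<close> the scale equation has a solution
  \<open>t \<ge> T\<close> by the intermediate value theorem, since \<open>d t / t\<close> is
  continuous and takes values on both sides of \<open>K / (\<theta> * L)\<close>.\<close>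

lemma max_ratio_tendsto_one:
  assumes sc: "tail_scales \<mu> v0 d v1 v2 v3 p C t0"
  shows "tendsto_in_probability P (\<lambda>n \<omega>. Max ((\<lambda>i. real (S i n \<omega>) / real n) ` {1..})) 1"
  unfolding tendsto_in_probability_def
proof (intro allI impI)
  fix \<epsilon> :: real assume \<epsilon>: "0 < \<epsilon>"
  show "(\<lambda>n. prob {\<omega> \<in> space P. \<epsilon> < \<bar>Max ((\<lambda>i. real (S i n \<omega>) / real n) ` {1..}) - 1\<bar>}) \<longlonglongrightarrow> 0"
  proof (rule order_tendstoI)
    fix \<delta> :: real assume "\<delta> < 0"
    then show "\<forall>\<^sub>F n in sequentially. \<delta> < prob {\<omega> \<in> space P. \<epsilon> < \<bar>Max ((\<lambda>i. real (S i n \<omega>) / real n) ` {1..}) - 1\<bar>}"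
      by (intro always_eventually allI) (rule less_le_trans[OF _ measure_nonneg])
  next
    fix \<delta> :: real assume \<delta>: "0 < \<delta>"
    obtain K T where KT: "0 < K" "t0 \<le> T"
      "\<And>t n. T \<le> t \<Longrightarrow> 2 / \<epsilon> \<le> real n \<Longrightarrow> 1 \<le> n \<Longrightarrow> \<theta> * ln (real (Suc n)) * d t = K * t \<Longrightarrow>
        prob {\<omega> \<in> space P. \<bar>Max ((\<lambda>i. real (S i n \<omega>) / real n) ` {1..}) - 1\<bar> > \<epsilon>} < \<delta>"
      using eventually_max_ratio_bound[OF sc \<epsilon> \<delta>] by blast
    have t0: "1 \<le> t0" and C: "1 \<le> C" and cont: "continuous_on {t0..} d" using sc by (auto simp: tail_scales_def)
    have d: "0 < d t" "d t \<le> C" if "t0 \<le> t" for t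
    proof -
      have "0 < v1 t" "0 < d t" "d t \<le> v2 t - v1 t" "d t \<le> v3 t - v2 t" "v3 t \<le> C"
        using sc that by (auto simp: tail_scales_def)
      then show "0 < d t" "d t \<le> C" by linarith+
    qed
    have T: "0 < T" using KT t0 by linarith
    have "filterlim (\<lambda>n. ln (real (Suc n))) at_top sequentially" by real_asymp
    then have "\<forall>\<^sub>F n in sequentially. K * T / (\<theta> * d T) \<le> ln (real (Suc n))"
      by (simp add: filterlim_at_top)
    moreover have "\<forall>\<^sub>F n in sequentially. 2 / \<epsilon> \<le> real n"
      using filterlim_real_sequentially by (simp add: filterlim_at_top)
    ultimately show "\<forall>\<^sub>F n in sequentially. prob {\<omega> \<in> space P. \<epsilon> < \<bar>Max ((\<lambda>i. real (S i n \<omega>) / real n) ` {1..}) - 1\<bar>} < \<delta>"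
      using eventually_ge_at_top[of 1]
    proof eventually_elim
      case (elim n)
      define L where "L = ln (real (Suc n))"
      have L: "0 < L" using elim by (simp add: L_def)
      define y where "y = K / (\<theta> * L)"
      have y: "0 < y" using KT theta_pos L by (simp add: y_def)
      \<comment> \<open>The right end point: \<open>d \<le> C\<close> gives
        \<open>d s / s \<le> C / s \<le> y\<close>. At the left end \<open>T\<close> the reverse
        inequality holds because \<open>n\<close>, and thus \<open>L\<close>, is large.\<close>
      define s where "s = max T (C / y)"
      have "\<exists>t. T \<le> t \<and> t \<le> s \<and> d t / t = y"
      proof (rule IVT2')
        have "d s \<le> C" "0 < s" using d[of s] KT T by (auto simp: s_def)
        moreover have "C \<le> y * s" using y by (simp add: s_def max_def field_simps)
        ultimately show "d s / s \<le> y" by (simp add: pos_divide_le_eq)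
        have "K * T \<le> L * (\<theta> * d T)" using elim(1) theta_pos d[of T] KT by (simp add: L_def pos_divide_le_eq)
        then show "y \<le> d T / T" using T L theta_pos by (simp add: y_def field_simps)
        show "T \<le> s" by (simp add: s_def)
        show "continuous_on {T..s} (\<lambda>t. d t / t)"
          using KT T by (intro continuous_on_divide continuous_on_id continuous_on_subset[OF cont]) auto
      qed
      then obtain t where t: "T \<le> t" "d t / t = y" by blast
      have "\<theta> * L * d t = K * t"
      proof -
        have "d t = y * t" using t T by (simp add: field_simps)
        then show ?thesis using theta_pos L by (simp add: y_def)
      qed
      then show ?case using KT(3)[OF t(1) elim(2,3)] by (simp add: L_def)
    qed
  qed
qed

end

theorem theorem1p2:
  fixes P :: "'a measure" and \<theta> :: real and \<mu> :: "real measure"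
    and W :: "nat \<Rightarrow> 'a \<Rightarrow> real" and S :: "nat \<Rightarrow> nat \<Rightarrow> 'a \<Rightarrow> nat"
  assumes "\<theta> > 0"
    and "prob_space \<mu>" and "sets \<mu> = sets borel" and "AE x in \<mu>. 0 < x"
    and "extreme_value \<mu>"
    and "disordered_CRP P \<theta> \<mu> W S"
  shows "tendsto_in_probability P
           (\<lambda>n \<omega>. Max ((\<lambda>i. real (S i n \<omega>) / real n) ` {1..})) 1"
proof -
  interpret positive_CRP P \<theta> \<mu> W S
    using assms unfolding positive_CRP_def positive_CRP_axioms_def by blast
  obtain v0 d v1 v2 v3 p C t0 where "tail_scales \<mu> v0 d v1 v2 v3 p C t0"
    using extreme_value_tail_scales[OF assms(2,3,5,4)] .
  then show ?thesis by (rule max_ratio_tendsto_one)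
qed

end
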